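(* Let $(E,[\![\cdot,\cdot]\!],\rho,\alpha)$ be a Loday algebroid over a smooth manifold $M$, $N$ a smooth manifold, $\phi:N\to M$ a smooth map, $\phi^*E$ the pullback vector bundle of $E$ over $N$, $\phi^*:\Gamma(E)\to\Gamma(\phi^*E)$ the map which assigns to each smooth section of $E$ its pullback section, and $(\varrho,\mathfrak a^T)$ an action of $E$ on $\phi$. Then the pullback vector bundle $\phi^*E$ carries a Loday algebroid structure with the following data. (i) Left anchor map: the map $\varrho_N:\Gamma(\phi^*E)\to\Gamma(TN)$ given, for any $f\phi^*e=f\otimes e\in\Gamma(\phi^*E)$, where $f\in C^\infty(N,\mathbb R)$ and $e\in\Gamma(E)$, by $\varrho_N(f\phi^*e)=f\varrho(e)$. (ii) Map which controls the right anchor map: the map $\mathfrak a_N^T:\Gamma(\phi^*E)\otimes\Gamma(\phi^*E)\otimes\Gamma(\phi^*E^* )\to\Gamma(TN)$ defined, for any $f_1\phi^*e_1,f_2\phi^*e_2\in\Gamma(\phi^*E)$ and $g\phi^*\mu\in\Gamma(\phi^*E^* )=\Gamma((\phi^*E)^* )$, where $f_1,f_2,g\in C^\infty(N,\mathbb R)$, $e_1,e_2\in\Gamma(E)$, $\mu\in\Gamma(E^* )$, by $$\mathfrak a_N^T(f_1\phi^*e_1\otimes f_2\phi^*e_2\otimes g\phi^*\mu)=f_1f_2g\,\mathfrak a^T(e_1\otimes e_2\otimes\mu).$$ (iii) $\mathbb R$-bilinear bracket on $\Gamma(\phi^*E)$: the bracket $\{\!\{\cdot,\cdot\}\!\}$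 defined, for any $e_1,e_2\in\Gamma(E)$ and $f_1,f_2\in C^\infty(N,\mathbb R)$, by $$\{\!\{f_1\phi^*e_1,f_2\phi^*e_2\}\!\}=f_1f_2\,\phi^*[\![e_1,e_2]\!]+f_1\varrho_N(\phi^*e_1)(f_2)\,\phi^*e_2-f_2\varrho_N(\phi^*e_2)(f_1)\,\phi^*e_1+f_2\,\mathfrak a_N(df_1\otimes\phi^*e_1)(\phi^*e_2),$$ where $\mathfrak a_N:\Gamma(T^*N)\otimes\Gamma(\phi^*E)\to\mathrm{End}(\Gamma(\phi^*E))$ is the map related with $\mathfrak a_N^T$ by $$\langle g\phi^*\mu,\mathfrak a_N(df_1\otimes\phi^*e_1)(f_2\phi^*e_2)\rangle=\mathfrak a_N^T(\phi^*e_1\otimes f_2\phi^*e_2\otimes g\phi^*\mu)(f_1).$$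
   Context: A Loday algebroid $(E,[\![\cdot,\cdot]\!],\rho,\alpha)$ over a smooth manifold $M$ consists of a vector bundle $E\to M$ of constant rank, an $\mathbb R$-bilinear bracket $[\![\cdot,\cdot]\!]$ on the space $\Gamma(E)$ of smooth sections (not necessarily skew-symmetric) with $[\![e_1,[\![e_2,e_3]\!]]\!]=[\![[\![e_1,e_2]\!],e_3]\!]+[\![e_2,[\![e_1,e_3]\!]]\!]$, and vector bundle morphisms over $\mathrm{id}_M$, $\rho:E\to TM$ (left anchor) and $\alpha:T^*M\otimes E\to\mathrm{End}(E)$, such that for all $e_1,e_2\in\Gamma(E)$, $f\in C^\infty(M,\mathbb R)$: $[\![e_1,fe_2]\!]=f[\![e_1,e_2]\!]+\rho(e_1)(f)e_2$ and $[\![fe_1,e_2]\!]=f[\![e_1,e_2]\!]-\rho(e_2)(f)e_1+\alpha(df\otimes e_1)(e_2)$. Write $[\![e_1,e_2]\!]_+=[\![e_1,e_2]\!]+[\![e_2,e_1]\!]$, and let $\alpha^T:E\otimes E\otimes E^*\to TM$ be the map with $\alpha^T(e_1\otimes e_2\otimes\mu)(f)=\langle\mu,\alpha(df\otimes e_1)(e_2)\rangle$. An (infinitesimal) action of $E$ on $\phi:N\to M$ is a pair $(\varrho,\mathfrak a^T)$ of $\mathbb R$-linear maps $\varrho:\Gamma(E)\to\Gamma(TN)$ and $\mathfrak a^T:\Gamma(E)\otimes\Gamma(E)\otimes\Gamma(E^* )\to\Gamma(TN)$ (tensor products over $C^\infty(M,\mathbb R)$) such that: (1) $\varrho$ is a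 Loday algebra homomorphism, $\varrho([\![e_1,e_2]\!])=[\varrho(e_1),\varrho(e_2)]$ for all $e_1,e_2\in\Gamma(E)$, which is $C^\infty(M,\mathbb R)$-linear, $\varrho(he)=(h\circ\phi)\varrho(e)$ for $h\in C^\infty(M,\mathbb R)$, $e\in\Gamma(E)$, and $\phi$-related with the left anchor, $(d\phi\circ\varrho)(e)=\rho(e)\circ\phi$. (2) $\mathfrak a^T$ satisfies: (a) it is $C^\infty(M,\mathbb R)$-linear: $\mathfrak a^T(he_1\otimes e_2\otimes\mu)=(h\circ\phi)\,\mathfrak a^T(e_1\otimes e_2\otimes\mu)$ for $e_1,e_2\in\Gamma(E)$, $\mu\in\Gamma(E^* )$, $h\in C^\infty(M,\mathbb R)$; (b) it is $\phi$-related with $\alpha^T$: $(d\phi\circ\mathfrak a^T)(e_1\otimes e_2\otimes\mu)=\alpha^T(e_1\otimes e_2\otimes\mu)\circ\phi$; (c) it is compatible with the bracket $[\![\cdot,\cdot]\!]$ on $\Gamma(E)$: for any $e_1,e_2,e_3\in\Gamma(E)$ and $f,g\in C^\infty(N,\mathbb R)$, $$\mathfrak a(df\otimes e_1)([\![e_2,e_3]\!])-[\![\mathfrak a(df\otimes e_1)(e_2),e_3]\!]-[\![e_2,\mathfrak a(df\otimes e_1)(e_3)]\!]=-\varrho(e_3)(f)[\![e_1,e_2]\!]_++\mathfrak a(df\otimes[\![e_1,e_2]\!])(e_3)-\mathfrak a(d\varrho(e_2)(f)\otimes e_1)(e_3),$$ $$[\![e_1,\mathfrak a(dg\otimes e_2)(e_3)]\!]=\mathfrak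 a(dg\otimes[\![e_1,e_2]\!])(e_3)+\mathfrak a(d\varrho(e_1)(g)\otimes e_2)(e_3)+\mathfrak a(dg\otimes e_2)([\![e_1,e_3]\!]),$$ $$[\mathfrak a(df\otimes e_1),\mathfrak a(dg\otimes e_2)]_{com}(e_3)=\mathfrak a(dg\otimes\mathfrak a(df\otimes e_1)(e_2))(e_3)+\varrho(e_1)(g)\,\mathfrak a(df\otimes e_2)(e_3)-\varrho(e_2)(f)\,\mathfrak a(dg\otimes e_1)(e_3)-\varrho(e_3)(f)\,\mathfrak a(dg\otimes e_2)(e_1),$$ where $[\cdot,\cdot]_{com}$ is the commutator and $\mathfrak a:\Gamma(T^*N)\otimes\Gamma(E)\to\mathrm{End}(\Gamma(E))$ denotes the "transpose" map of $\mathfrak a^T$, i.e. $\langle\mu,\mathfrak a(\eta\otimes e_1)(e_2)\rangle=\langle\eta,\mathfrak a^T(e_1\otimes e_2\otimes\mu)\rangle$ for $\eta\in\Gamma(T^*N)$; (d) the associated map $\mathfrak a^T:\Gamma(T^*N)\otimes\Gamma(E)\otimes\Gamma(E)\to\Gamma(E)$, $\mathfrak a^T(\eta\otimes e_1\otimes e_2)=\mathfrak a(\eta\otimes e_1)(e_2)$, takes values in $\ker\varrho$: $\varrho(\mathfrak a^T(df\otimes e_1\otimes e_2))=0$. *)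

theory Defs
  imports "HOL-Analysis.Analysis"
begin

section \<open>Smooth manifolds, functions and maps\<close>

primrec k_smooth_on :: "nat \<Rightarrow> 'a::real_normed_vector set \<Rightarrow> ('a \<Rightarrow> 'c::real_normed_vector) \<Rightarrow> bool" where
  "k_smooth_on 0 S f \<longleftrightarrow> continuous_on S f"
| "k_smooth_on (Suc k) S f \<longleftrightarrow>
     (\<forall>x\<in>S. f differentiable (at x)) \<and> (\<forall>v. k_smooth_on k S (\<lambda>x. frechet_derivative f (at x) v))"

definition smooth_on :: "'a::real_normed_vector set \<Rightarrow> ('a \<Rightarrow> 'c::real_normed_vector) \<Rightarrow> bool" where
  "smooth_on S f \<longleftrightarrow> (\<forall>k. k_smooth_on k S f)"

text \<open>
  A manifold is a whole topological type with a smooth atlas. The model space is a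
  finite-dimensional inner product space; unlike \<open>euclidean_space\<close>, the class
  \<open>real_inner\<close> admits the zero space, so that manifolds of dimension 0 (in particular
  the one-point base of a Loday algebra) are included.
\<close>

type_synonym ('m, 'b) atlas = "('m set \<times> ('m \<Rightarrow> 'b)) set"

definition smooth_manifold ::
    "('m::{t2_space,second_countable_topology}, 'b::real_inner) atlas \<Rightarrow> bool" where
  "smooth_manifold A \<longleftrightarrow>
     (\<exists>B::'b set. finite B \<and> span B = UNIV) \<and>
     (\<Union>(U, c)\<in>A. U) = UNIV \<and>
     (\<forall>(U, c)\<in>A. open U \<and> open (c ` U) \<and> homeomorphism U (c ` U) c (inv_into U c)) \<and>
     (\<forall>(U, c)\<in>A. \<forall>(V, d)\<in>A. smooth_on (c ` (U \<inter> V)) (d \<circ> inv_into U c))"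

definition smooth_fun_on :: "('m::topological_space, 'b::real_inner) atlas \<Rightarrow> 'm set \<Rightarrow> ('m \<Rightarrow> real) \<Rightarrow> bool" where
  "smooth_fun_on A W f \<longleftrightarrow> (\<forall>(U, c)\<in>A. smooth_on (c ` (U \<inter> W)) (f \<circ> inv_into U c))"

abbreviation smooth_funs :: "('m::topological_space, 'b::real_inner) atlas \<Rightarrow> ('m \<Rightarrow> real) set" where
  "smooth_funs A \<equiv> {f. smooth_fun_on A UNIV f}"

definition smooth_map ::
    "('n::topological_space, 'c::real_inner) atlas \<Rightarrow> ('m::topological_space, 'b::real_inner) atlas
      \<Rightarrow> ('n \<Rightarrow> 'm) \<Rightarrow> bool" where
  "smooth_map AN AM \<phi> \<longleftrightarrow> continuous_on UNIV \<phi> \<and>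
     (\<forall>(V, d)\<in>AN. \<forall>(U, c)\<in>AM. smooth_on (d ` (V \<inter> \<phi> -` U)) (c \<circ> \<phi> \<circ> inv_into V d))"


section \<open>Tangent and cotangent vectors\<close>

text \<open>
  Tangent vectors at \<open>x\<close> are derivations at \<open>x\<close> of the algebra of smooth functions. They are
  set to 0 on non-smooth functions, so that equality of tangent vectors is equality in HOL;
  covectors and sections of dual bundles are normalised in the same way.
\<close>

type_synonym 'm tvec = "('m \<Rightarrow> real) \<Rightarrow> real"
type_synonym 'm covec = "'m tvec \<Rightarrow> real"

definition tangent_space :: "('m::topological_space, 'b::real_inner) atlas \<Rightarrow> 'm \<Rightarrow> 'm tvec set" where
  "tangent_space A x = {v.
     (\<forall>f. f \<notin> smooth_funs A \<longrightarrow> v f = 0) \<and>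
     (\<forall>f\<in>smooth_funs A. \<forall>g\<in>smooth_funs A. v (\<lambda>y. f y + g y) = v f + v g) \<and>
     (\<forall>f\<in>smooth_funs A. \<forall>r. v (\<lambda>y. r * f y) = r * v f) \<and>
     (\<forall>f\<in>smooth_funs A. \<forall>g\<in>smooth_funs A. v (\<lambda>y. f y * g y) = f x * v g + g x * v f)}"

definition vector_fields :: "('m::topological_space, 'b::real_inner) atlas \<Rightarrow> ('m \<Rightarrow> 'm tvec) set" where
  "vector_fields A = {X. (\<forall>x. X x \<in> tangent_space A x) \<and>
     (\<forall>f\<in>smooth_funs A. (\<lambda>x. X x f) \<in> smooth_funs A)}"

definition lie_bracket :: "('m \<Rightarrow> 'm tvec) \<Rightarrow> ('m \<Rightarrow> 'm tvec) \<Rightarrow> 'm \<Rightarrow> 'm tvec" where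
  "lie_bracket X Y = (\<lambda>x f. X x (\<lambda>y. Y y f) - Y x (\<lambda>y. X y f))"

definition tangent_map ::
    "('m::topological_space, 'b::real_inner) atlas \<Rightarrow> ('n \<Rightarrow> 'm) \<Rightarrow> 'n tvec \<Rightarrow> 'm tvec" where
  "tangent_map AM \<phi> v = (\<lambda>h. if h \<in> smooth_funs AM then v (h \<circ> \<phi>) else 0)"

definition cotangent_space :: "('m::topological_space, 'b::real_inner) atlas \<Rightarrow> 'm \<Rightarrow> 'm covec set" where
  "cotangent_space A x = {\<eta>.
     (\<forall>v. v \<notin> tangent_space A x \<longrightarrow> \<eta> v = 0) \<and>
     (\<forall>v\<in>tangent_space A x. \<forall>w\<in>tangent_space A x. \<eta> (\<lambda>f. v f + w f) = \<eta> v + \<eta> w) \<and>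
     (\<forall>v\<in>tangent_space A x. \<forall>r. \<eta> (\<lambda>f. r * v f) = r * \<eta> v)}"

definition one_forms :: "('m::topological_space, 'b::real_inner) atlas \<Rightarrow> ('m \<Rightarrow> 'm covec) set" where
  "one_forms A = {\<eta>. (\<forall>x. \<eta> x \<in> cotangent_space A x) \<and>
     (\<forall>X\<in>vector_fields A. (\<lambda>x. \<eta> x (X x)) \<in> smooth_funs A)}"

definition differential :: "('m::topological_space, 'b::real_inner) atlas \<Rightarrow> ('m \<Rightarrow> real) \<Rightarrow> 'm \<Rightarrow> 'm covec" where
  "differential A f x = (\<lambda>v. if v \<in> tangent_space A x then v f else 0)"


section \<open>Vector bundles\<close>

text \<open>
  The fibres are linear subspaces of an ambient real vector space without topology; this is no
  restriction, since any family of vector spaces embeds into its direct sum. A local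
  trivialisation \<open>U \<times> \<real>\<^sup>r \<rightarrow> E|\<^sub>U\<close>, \<open>(x, a) \<mapsto> \<Sum>i<r. a\<^sub>i s\<^sub>i(x)\<close>, is stored as its frame \<open>(U, s)\<close>;
  the matrices \<open>g\<close> below are the transition functions.
\<close>

record ('m, 'e) vbundle =
  fibre :: "'m \<Rightarrow> 'e set"
  rank :: nat
  frames :: "('m set \<times> (nat \<Rightarrow> 'm \<Rightarrow> 'e)) set"

definition vector_bundle ::
    "('m::topological_space, 'b::real_inner) atlas \<Rightarrow> ('m, 'e::real_vector) vbundle \<Rightarrow> bool" where
  "vector_bundle A E \<longleftrightarrow>
     (\<forall>x. subspace (fibre E x)) \<and>
     (\<Union>(U, s)\<in>frames E. U) = UNIV \<and>
     (\<forall>(U, s)\<in>frames E. open U \<and>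
        (\<forall>x\<in>U. inj_on (\<lambda>i. s i x) {..<rank E} \<and> independent ((\<lambda>i. s i x) ` {..<rank E}) \<and>
               span ((\<lambda>i. s i x) ` {..<rank E}) = fibre E x)) \<and>
     (\<forall>(U, s)\<in>frames E. \<forall>(V, t)\<in>frames E. \<exists>g.
        (\<forall>i<rank E. \<forall>j<rank E. smooth_fun_on A (U \<inter> V) (g i j)) \<and>
        (\<forall>x\<in>U \<inter> V. \<forall>j<rank E. t j x = (\<Sum>i<rank E. g i j x *\<^sub>R s i x)))"

definition sections ::
    "('m::topological_space, 'b::real_inner) atlas \<Rightarrow> ('m, 'e::real_vector) vbundle \<Rightarrow> ('m \<Rightarrow> 'e) set" where
  "sections A E = {\<sigma>. (\<forall>x. \<sigma> x \<in> fibre E x) \<and>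
     (\<forall>(U, s)\<in>frames E. \<exists>a. (\<forall>i<rank E. smooth_fun_on A U (a i)) \<and>
        (\<forall>x\<in>U. \<sigma> x = (\<Sum>i<rank E. a i x *\<^sub>R s i x)))}"

text \<open>Smooth sections of the dual bundle: the coefficients in the dual frames are smooth.\<close>

definition dual_sections ::
    "('m::topological_space, 'b::real_inner) atlas \<Rightarrow> ('m, 'e::real_vector) vbundle \<Rightarrow> ('m \<Rightarrow> 'e \<Rightarrow> real) set" where
  "dual_sections A E = {\<mu>.
     (\<forall>x. (\<forall>v. v \<notin> fibre E x \<longrightarrow> \<mu> x v = 0) \<and>
          (\<forall>v\<in>fibre E x. \<forall>w\<in>fibre E x. \<mu> x (v + w) = \<mu> x v + \<mu> x w) \<and>
          (\<forall>v\<in>fibre E x. \<forall>r. \<mu> x (r *\<^sub>R v) = r * \<mu> x v)) \<and>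
     (\<forall>(U, s)\<in>frames E. \<forall>i<rank E. smooth_fun_on A U (\<lambda>x. \<mu> x (s i x)))}"

definition pullback_bundle :: "('n::topological_space \<Rightarrow> 'm) \<Rightarrow> ('m, 'e) vbundle \<Rightarrow> ('n, 'e) vbundle" where
  "pullback_bundle \<phi> E =
     \<lparr>fibre = (\<lambda>p. fibre E (\<phi> p)), rank = rank E,
      frames = (\<lambda>(U, s). (\<phi> -` U, \<lambda>i p. s i (\<phi> p))) ` frames E\<rparr>"


section \<open>Loday algebroids\<close>

text \<open>
  Vector bundle morphisms over the identity are families of fibrewise linear maps sending smooth
  sections to smooth sections. A morphism \<open>\<alpha> : T\<^sup>*M \<otimes> E \<rightarrow> End(E)\<close> is written as the
  corresponding family of fibrewise trilinear maps \<open>(\<eta>, u, v) \<mapsto> \<alpha>(\<eta> \<otimes> u)(v)\<close>.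
\<close>

definition left_anchor ::
    "('m::topological_space, 'b::real_inner) atlas \<Rightarrow> ('m, 'e::real_vector) vbundle
      \<Rightarrow> ('m \<Rightarrow> 'e \<Rightarrow> 'm tvec) \<Rightarrow> bool" where
  "left_anchor A E \<rho> \<longleftrightarrow>
     (\<forall>x. \<forall>u\<in>fibre E x. \<rho> x u \<in> tangent_space A x \<and>
        (\<forall>v\<in>fibre E x. \<rho> x (u + v) = (\<lambda>f. \<rho> x u f + \<rho> x v f)) \<and>
        (\<forall>r. \<rho> x (r *\<^sub>R u) = (\<lambda>f. r * \<rho> x u f))) \<and>
     (\<forall>e\<in>sections A E. (\<lambda>x. \<rho> x (e x)) \<in> vector_fields A)"

definition right_anchor_control ::
    "('m::topological_space, 'b::real_inner) atlas \<Rightarrow> ('m, 'e::real_vector) vbundle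
      \<Rightarrow> ('m \<Rightarrow> 'm covec \<Rightarrow> 'e \<Rightarrow> 'e \<Rightarrow> 'e) \<Rightarrow> bool" where
  "right_anchor_control A E \<alpha> \<longleftrightarrow>
     (\<forall>x. \<forall>\<eta>\<in>cotangent_space A x. \<forall>u\<in>fibre E x. \<forall>v\<in>fibre E x.
        \<alpha> x \<eta> u v \<in> fibre E x \<and>
        (\<forall>\<zeta>\<in>cotangent_space A x. \<alpha> x (\<lambda>X. \<eta> X + \<zeta> X) u v = \<alpha> x \<eta> u v + \<alpha> x \<zeta> u v) \<and>
        (\<forall>w\<in>fibre E x. \<alpha> x \<eta> (u + w) v = \<alpha> x \<eta> u v + \<alpha> x \<eta> w v) \<and>
        (\<forall>w\<in>fibre E x. \<alpha> x \<eta> u (v + w) = \<alpha> x \<eta> u v + \<alpha> x \<eta> u w) \<and>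
        (\<forall>r. \<alpha> x (\<lambda>X. r * \<eta> X) u v = r *\<^sub>R \<alpha> x \<eta> u v) \<and>
        (\<forall>r. \<alpha> x \<eta> (r *\<^sub>R u) v = r *\<^sub>R \<alpha> x \<eta> u v) \<and>
        (\<forall>r. \<alpha> x \<eta> u (r *\<^sub>R v) = r *\<^sub>R \<alpha> x \<eta> u v)) \<and>
     (\<forall>\<eta>\<in>one_forms A. \<forall>e1\<in>sections A E. \<forall>e2\<in>sections A E.
        (\<lambda>x. \<alpha> x (\<eta> x) (e1 x) (e2 x)) \<in> sections A E)"

definition bilinear_bracket ::
    "('m::topological_space, 'b::real_inner) atlas \<Rightarrow> ('m, 'e::real_vector) vbundle
      \<Rightarrow> (('m \<Rightarrow> 'e) \<Rightarrow> ('m \<Rightarrow> 'e) \<Rightarrow> 'm \<Rightarrow> 'e) \<Rightarrow> bool" where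
  "bilinear_bracket A E br \<longleftrightarrow>
     (\<forall>e1\<in>sections A E. \<forall>e2\<in>sections A E.
        br e1 e2 \<in> sections A E \<and>
        (\<forall>e\<in>sections A E. br (\<lambda>x. e1 x + e x) e2 = (\<lambda>x. br e1 e2 x + br e e2 x)) \<and>
        (\<forall>e\<in>sections A E. br e1 (\<lambda>x. e2 x + e x) = (\<lambda>x. br e1 e2 x + br e1 e x)) \<and>
        (\<forall>r. br (\<lambda>x. r *\<^sub>R e1 x) e2 = (\<lambda>x. r *\<^sub>R br e1 e2 x)) \<and>
        (\<forall>r. br e1 (\<lambda>x. r *\<^sub>R e2 x) = (\<lambda>x. r *\<^sub>R br e1 e2 x)))"

definition loday_algebroid ::
    "('m::{t2_space,second_countable_topology}, 'b::real_inner) atlas \<Rightarrow> ('m, 'e::real_vector) vbundle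
      \<Rightarrow> (('m \<Rightarrow> 'e) \<Rightarrow> ('m \<Rightarrow> 'e) \<Rightarrow> 'm \<Rightarrow> 'e)
      \<Rightarrow> ('m \<Rightarrow> 'e \<Rightarrow> 'm tvec) \<Rightarrow> ('m \<Rightarrow> 'm covec \<Rightarrow> 'e \<Rightarrow> 'e \<Rightarrow> 'e) \<Rightarrow> bool" where
  "loday_algebroid A E br \<rho> \<alpha> \<longleftrightarrow>
     smooth_manifold A \<and> vector_bundle A E \<and> bilinear_bracket A E br \<and>
     left_anchor A E \<rho> \<and> right_anchor_control A E \<alpha> \<and>
     (\<forall>e1\<in>sections A E. \<forall>e2\<in>sections A E. \<forall>e3\<in>sections A E.
        br e1 (br e2 e3) = (\<lambda>x. br (br e1 e2) e3 x + br e2 (br e1 e3) x)) \<and>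
     (\<forall>e1\<in>sections A E. \<forall>e2\<in>sections A E. \<forall>f\<in>smooth_funs A.
        br e1 (\<lambda>x. f x *\<^sub>R e2 x) = (\<lambda>x. f x *\<^sub>R br e1 e2 x + \<rho> x (e1 x) f *\<^sub>R e2 x)) \<and>
     (\<forall>e1\<in>sections A E. \<forall>e2\<in>sections A E. \<forall>f\<in>smooth_funs A.
        br (\<lambda>x. f x *\<^sub>R e1 x) e2 =
          (\<lambda>x. f x *\<^sub>R br e1 e2 x - \<rho> x (e2 x) f *\<^sub>R e1 x + \<alpha> x (differential A f x) (e1 x) (e2 x)))"

definition alpha_transpose ::
    "('m::topological_space, 'b::real_inner) atlas \<Rightarrow> ('m \<Rightarrow> 'm covec \<Rightarrow> 'e \<Rightarrow> 'e \<Rightarrow> 'e)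
      \<Rightarrow> ('m \<Rightarrow> 'e) \<Rightarrow> ('m \<Rightarrow> 'e) \<Rightarrow> ('m \<Rightarrow> 'e \<Rightarrow> real) \<Rightarrow> 'm \<Rightarrow> 'm tvec" where
  "alpha_transpose A \<alpha> e1 e2 \<mu> x =
     (\<lambda>f. if f \<in> smooth_funs A then \<mu> x (\<alpha> x (differential A f x) (e1 x) (e2 x)) else 0)"


section \<open>Actions of Loday algebroids\<close>

text \<open>
  Linear maps \<open>\<Gamma>(E) \<otimes> \<Gamma>(E) \<otimes> \<Gamma>(E\<^sup>*) \<rightarrow> \<Gamma>(TN)\<close> over \<open>\<phi>\<^sup>* : C\<^sup>\<infinity>(M) \<rightarrow> C\<^sup>\<infinity>(N)\<close>, the tensor products being
  over \<open>C\<^sup>\<infinity>(M)\<close>, are written as trilinear maps. For \<open>\<phi> = id\<close> these are the \<open>C\<^sup>\<infinity>(N)\<close>-trilinear maps.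
\<close>

definition tensor_map ::
    "('m::topological_space, 'b::real_inner) atlas \<Rightarrow> ('m, 'e::real_vector) vbundle
      \<Rightarrow> ('n::topological_space, 'c::real_inner) atlas \<Rightarrow> ('n \<Rightarrow> 'm)
      \<Rightarrow> (('m \<Rightarrow> 'e) \<Rightarrow> ('m \<Rightarrow> 'e) \<Rightarrow> ('m \<Rightarrow> 'e \<Rightarrow> real) \<Rightarrow> 'n \<Rightarrow> 'n tvec) \<Rightarrow> bool" where
  "tensor_map AM E AN \<phi> T \<longleftrightarrow>
     (\<forall>e1\<in>sections AM E. \<forall>e2\<in>sections AM E. \<forall>\<mu>\<in>dual_sections AM E.
        T e1 e2 \<mu> \<in> vector_fields AN \<and>
        (\<forall>e\<in>sections AM E. T (\<lambda>x. e1 x + e x) e2 \<mu> = (\<lambda>p f. T e1 e2 \<mu> p f + T e e2 \<mu> p f)) \<and>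
        (\<forall>e\<in>sections AM E. T e1 (\<lambda>x. e2 x + e x) \<mu> = (\<lambda>p f. T e1 e2 \<mu> p f + T e1 e \<mu> p f)) \<and>
        (\<forall>\<nu>\<in>dual_sections AM E. T e1 e2 (\<lambda>x v. \<mu> x v + \<nu> x v) = (\<lambda>p f. T e1 e2 \<mu> p f + T e1 e2 \<nu> p f)) \<and>
        (\<forall>h\<in>smooth_funs AM.
           T (\<lambda>x. h x *\<^sub>R e1 x) e2 \<mu> = (\<lambda>p f. h (\<phi> p) * T e1 e2 \<mu> p f) \<and>
           T e1 (\<lambda>x. h x *\<^sub>R e2 x) \<mu> = (\<lambda>p f. h (\<phi> p) * T e1 e2 \<mu> p f) \<and>
           T e1 e2 (\<lambda>x v. h x * \<mu> x v) = (\<lambda>p f. h (\<phi> p) * T e1 e2 \<mu> p f)))"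

text \<open>
  The map \<open>\<aa>\<close> paired with \<open>\<mu> \<in> \<Gamma>(E\<^sup>*)\<close> is a function on \<open>N\<close>, so \<open>\<aa>(\<eta> \<otimes> e1)(e2)\<close> is a section of
  \<open>\<phi>\<^sup>*E\<close>, not of \<open>E\<close>. Being tensorial, \<open>\<aa>\<close> and \<open>\<rho>'\<close> (the first component of an action) amount
  to fibrewise maps on \<open>\<phi>\<^sup>*E\<close>, through which they are applied to arbitrary sections of \<open>\<phi>\<^sup>*E\<close>.
\<close>

definition induced_anchor ::
    "('m::topological_space, 'b::real_inner) atlas \<Rightarrow> ('m, 'e::real_vector) vbundle \<Rightarrow> ('n \<Rightarrow> 'm)
      \<Rightarrow> (('m \<Rightarrow> 'e) \<Rightarrow> 'n \<Rightarrow> 'n tvec) \<Rightarrow> 'n \<Rightarrow> 'e \<Rightarrow> 'n tvec" where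
  "induced_anchor AM E \<phi> \<rho>' p u = (THE X. \<forall>e\<in>sections AM E. e (\<phi> p) = u \<longrightarrow> \<rho>' e p = X)"

definition induced_transpose ::
    "('m::topological_space, 'b::real_inner) atlas \<Rightarrow> ('m, 'e::real_vector) vbundle \<Rightarrow> ('n \<Rightarrow> 'm)
      \<Rightarrow> (('m \<Rightarrow> 'e) \<Rightarrow> ('m \<Rightarrow> 'e) \<Rightarrow> ('m \<Rightarrow> 'e \<Rightarrow> real) \<Rightarrow> 'n \<Rightarrow> 'n tvec)
      \<Rightarrow> 'n \<Rightarrow> 'n covec \<Rightarrow> 'e \<Rightarrow> 'e \<Rightarrow> 'e" where
  "induced_transpose AM E \<phi> aT p \<eta> u v =
     (THE w. w \<in> fibre E (\<phi> p) \<and>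
        (\<forall>e1\<in>sections AM E. \<forall>e2\<in>sections AM E. \<forall>\<mu>\<in>dual_sections AM E.
           e1 (\<phi> p) = u \<longrightarrow> e2 (\<phi> p) = v \<longrightarrow> \<mu> (\<phi> p) w = \<eta> (aT e1 e2 \<mu> p)))"

definition bracket_on_generators ::
    "('n::topological_space, 'c::real_inner) atlas \<Rightarrow> (('m \<Rightarrow> 'e) \<Rightarrow> ('m \<Rightarrow> 'e) \<Rightarrow> 'm \<Rightarrow> 'e) \<Rightarrow> ('n \<Rightarrow> 'm)
      \<Rightarrow> ('n \<Rightarrow> 'e \<Rightarrow> 'n tvec) \<Rightarrow> ('n \<Rightarrow> 'n covec \<Rightarrow> 'e \<Rightarrow> 'e \<Rightarrow> 'e)
      \<Rightarrow> ('n \<Rightarrow> real) \<Rightarrow> ('m \<Rightarrow> 'e) \<Rightarrow> ('n \<Rightarrow> real) \<Rightarrow> ('m \<Rightarrow> 'e) \<Rightarrow> 'n \<Rightarrow> 'e::real_vector" where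
  "bracket_on_generators AN br \<phi> \<rho>N aN f1 e1 f2 e2 = (\<lambda>p.
     (f1 p * f2 p) *\<^sub>R br e1 e2 (\<phi> p)
     + (f1 p * \<rho>N p (e1 (\<phi> p)) f2) *\<^sub>R e2 (\<phi> p)
     - (f2 p * \<rho>N p (e2 (\<phi> p)) f1) *\<^sub>R e1 (\<phi> p)
     + f2 p *\<^sub>R aN p (differential AN f1 p) (e1 (\<phi> p)) (e2 (\<phi> p)))"

text \<open>
  The compatibility conditions of an action take brackets of elements of \<open>\<Gamma>(E)\<close> with values
  of \<open>\<aa>\<close>, that is, with elements of \<open>\<Gamma>(\<phi>\<^sup>*E) = C\<^sup>\<infinity>(N) \<otimes> \<Gamma>(E)\<close>. The bracket meant is the bilinear
  extension to \<open>\<Gamma>(\<phi>\<^sup>*E)\<close> forced by the Leibniz rules. As \<open>\<Gamma>(\<phi>\<^sup>*E)\<close> consists of finite sums of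
  sections \<open>f \<phi>\<^sup>*e\<close>, at most one map satisfies the following predicate on sections; one exists as
  soon as the linearity and \<open>\<phi>\<close>-relatedness conditions of \<open>loday_action\<close> below hold, so the quantifier
  over \<open>B\<close> there ranges over a unique bracket.
\<close>

definition extended_bracket ::
    "('m::topological_space, 'b::real_inner) atlas \<Rightarrow> ('m, 'e::real_vector) vbundle
      \<Rightarrow> (('m \<Rightarrow> 'e) \<Rightarrow> ('m \<Rightarrow> 'e) \<Rightarrow> 'm \<Rightarrow> 'e)
      \<Rightarrow> ('n::topological_space, 'c::real_inner) atlas \<Rightarrow> ('n \<Rightarrow> 'm)
      \<Rightarrow> ('n \<Rightarrow> 'e \<Rightarrow> 'n tvec) \<Rightarrow> ('n \<Rightarrow> 'n covec \<Rightarrow> 'e \<Rightarrow> 'e \<Rightarrow> 'e)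
      \<Rightarrow> (('n \<Rightarrow> 'e) \<Rightarrow> ('n \<Rightarrow> 'e) \<Rightarrow> 'n \<Rightarrow> 'e) \<Rightarrow> bool" where
  "extended_bracket AM E br AN \<phi> \<rho>N aN B \<longleftrightarrow>
     bilinear_bracket AN (pullback_bundle \<phi> E) B \<and>
     (\<forall>e1\<in>sections AM E. \<forall>e2\<in>sections AM E. \<forall>f1\<in>smooth_funs AN. \<forall>f2\<in>smooth_funs AN.
        B (\<lambda>p. f1 p *\<^sub>R e1 (\<phi> p)) (\<lambda>p. f2 p *\<^sub>R e2 (\<phi> p)) =
          bracket_on_generators AN br \<phi> \<rho>N aN f1 e1 f2 e2)"

text \<open>
  In the three equations, \<open>a f \<sigma> \<tau>\<close> is the section \<open>\<aa>(df \<otimes> \<sigma>)(\<tau>)\<close> of \<open>\<phi>\<^sup>*E\<close>, and sections of \<open>E\<close>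
  occurring as arguments of \<open>a\<close> and \<open>B\<close> are pulled back to \<open>N\<close>.
\<close>

definition bracket_compatible ::
    "('m::topological_space, 'b::real_inner) atlas \<Rightarrow> ('m, 'e::real_vector) vbundle
      \<Rightarrow> (('m \<Rightarrow> 'e) \<Rightarrow> ('m \<Rightarrow> 'e) \<Rightarrow> 'm \<Rightarrow> 'e)
      \<Rightarrow> ('n::topological_space, 'c::real_inner) atlas \<Rightarrow> ('n \<Rightarrow> 'm)
      \<Rightarrow> (('m \<Rightarrow> 'e) \<Rightarrow> 'n \<Rightarrow> 'n tvec) \<Rightarrow> ('n \<Rightarrow> 'n covec \<Rightarrow> 'e \<Rightarrow> 'e \<Rightarrow> 'e)
      \<Rightarrow> (('n \<Rightarrow> 'e) \<Rightarrow> ('n \<Rightarrow> 'e) \<Rightarrow> 'n \<Rightarrow> 'e) \<Rightarrow> bool" where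
  "bracket_compatible AM E br AN \<phi> \<rho>' aN B \<longleftrightarrow>
     (let a = (\<lambda>f \<sigma> \<tau> p. aN p (differential AN f p) (\<sigma> p) (\<tau> p)) in
      \<forall>e1\<in>sections AM E. \<forall>e2\<in>sections AM E. \<forall>e3\<in>sections AM E.
      \<forall>f\<in>smooth_funs AN. \<forall>g\<in>smooth_funs AN. \<forall>p.
        a f (e1 \<circ> \<phi>) (br e2 e3 \<circ> \<phi>) p - B (a f (e1 \<circ> \<phi>) (e2 \<circ> \<phi>)) (e3 \<circ> \<phi>) p
            - B (e2 \<circ> \<phi>) (a f (e1 \<circ> \<phi>) (e3 \<circ> \<phi>)) p
          = - (\<rho>' e3 p f *\<^sub>R (br e1 e2 (\<phi> p) + br e2 e1 (\<phi> p)))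
            + a f (br e1 e2 \<circ> \<phi>) (e3 \<circ> \<phi>) p - a (\<lambda>q. \<rho>' e2 q f) (e1 \<circ> \<phi>) (e3 \<circ> \<phi>) p
        \<and>
        B (e1 \<circ> \<phi>) (a g (e2 \<circ> \<phi>) (e3 \<circ> \<phi>)) p
          = a g (br e1 e2 \<circ> \<phi>) (e3 \<circ> \<phi>) p + a (\<lambda>q. \<rho>' e1 q g) (e2 \<circ> \<phi>) (e3 \<circ> \<phi>) p
            + a g (e2 \<circ> \<phi>) (br e1 e3 \<circ> \<phi>) p
        \<and>
        a f (e1 \<circ> \<phi>) (a g (e2 \<circ> \<phi>) (e3 \<circ> \<phi>)) p - a g (e2 \<circ> \<phi>) (a f (e1 \<circ> \<phi>) (e3 \<circ> \<phi>)) p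
          = a g (a f (e1 \<circ> \<phi>) (e2 \<circ> \<phi>)) (e3 \<circ> \<phi>) p
            + \<rho>' e1 p g *\<^sub>R a f (e2 \<circ> \<phi>) (e3 \<circ> \<phi>) p
            - \<rho>' e2 p f *\<^sub>R a g (e1 \<circ> \<phi>) (e3 \<circ> \<phi>) p
            - \<rho>' e3 p f *\<^sub>R a g (e2 \<circ> \<phi>) (e1 \<circ> \<phi>) p)"

definition loday_action ::
    "('m::{t2_space,second_countable_topology}, 'b::real_inner) atlas \<Rightarrow> ('m, 'e::real_vector) vbundle
      \<Rightarrow> (('m \<Rightarrow> 'e) \<Rightarrow> ('m \<Rightarrow> 'e) \<Rightarrow> 'm \<Rightarrow> 'e)
      \<Rightarrow> ('m \<Rightarrow> 'e \<Rightarrow> 'm tvec) \<Rightarrow> ('m \<Rightarrow> 'm covec \<Rightarrow> 'e \<Rightarrow> 'e \<Rightarrow> 'e)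
      \<Rightarrow> ('n::{t2_space,second_countable_topology}, 'c::real_inner) atlas \<Rightarrow> ('n \<Rightarrow> 'm)
      \<Rightarrow> (('m \<Rightarrow> 'e) \<Rightarrow> 'n \<Rightarrow> 'n tvec)
      \<Rightarrow> (('m \<Rightarrow> 'e) \<Rightarrow> ('m \<Rightarrow> 'e) \<Rightarrow> ('m \<Rightarrow> 'e \<Rightarrow> real) \<Rightarrow> 'n \<Rightarrow> 'n tvec) \<Rightarrow> bool" where
  "loday_action AM E br \<rho> \<alpha> AN \<phi> \<rho>' aT \<longleftrightarrow>
     (\<forall>e1\<in>sections AM E.
        \<rho>' e1 \<in> vector_fields AN \<and>
        (\<forall>e2\<in>sections AM E. \<rho>' (\<lambda>x. e1 x + e2 x) = (\<lambda>p f. \<rho>' e1 p f + \<rho>' e2 p f)) \<and>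
        (\<forall>h\<in>smooth_funs AM. \<rho>' (\<lambda>x. h x *\<^sub>R e1 x) = (\<lambda>p f. h (\<phi> p) * \<rho>' e1 p f)) \<and>
        (\<forall>e2\<in>sections AM E. \<rho>' (br e1 e2) = lie_bracket (\<rho>' e1) (\<rho>' e2)) \<and>
        (\<forall>p. tangent_map AM \<phi> (\<rho>' e1 p) = \<rho> (\<phi> p) (e1 (\<phi> p)))) \<and>
     tensor_map AM E AN \<phi> aT \<and>
     (\<forall>e1\<in>sections AM E. \<forall>e2\<in>sections AM E. \<forall>\<mu>\<in>dual_sections AM E. \<forall>p.
        tangent_map AM \<phi> (aT e1 e2 \<mu> p) = alpha_transpose AM \<alpha> e1 e2 \<mu> (\<phi> p)) \<and>
     (let \<rho>N = induced_anchor AM E \<phi> \<rho>'; aN = induced_transpose AM E \<phi> aT in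
       (\<forall>B. extended_bracket AM E br AN \<phi> \<rho>N aN B \<longrightarrow> bracket_compatible AM E br AN \<phi> \<rho>' aN B) \<and>
       (\<forall>e1\<in>sections AM E. \<forall>e2\<in>sections AM E. \<forall>f\<in>smooth_funs AN. \<forall>p.
          \<rho>N p (aN p (differential AN f p) (e1 (\<phi> p)) (e2 (\<phi> p))) = (\<lambda>_. 0)))"

end

theory Submission
  imports Defs "HOL-Library.Function_Algebras"
begin

text \<open>
  Let \<open>B\<close> be the bracket on \<open>\<Gamma>(\<phi>\<^sup>*E)\<close> given by the Leibniz formula on generators \<open>f \<phi>\<^sup>*e\<close>. It is well
  defined because the formula is balanced over \<open>C\<^sup>\<infinity>(M)\<close>, which is the \<open>\<phi>\<close>-relatedness of \<open>\<rho>'\<close> and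
  \<open>\<aa>\<^sup>T\<close> with the two anchors of \<open>E\<close>. For the Jacobi identity, write \<open>[u, v]\<^sub>+ = B u v + B v u\<close>.
  Given the second compatibility condition, the first one is equivalent to
  \<open>B (\<aa>(df \<otimes> u)(v)) w = \<rho>'(w)(f) [u, v]\<^sub>+ - \<aa>(df \<otimes> [u, v]\<^sub>+)(w)\<close>.
  Comparing both sides for a product \<open>f h\<close> gives an identity on compositions of values of \<open>\<aa>\<close> that is
  symmetric in \<open>f\<close> and \<open>h\<close>, and the symmetric part of the third condition gives another one. These two
  identities are what is needed to extend the displayed equation from pullbacks of sections of \<open>E\<close> to
  all of \<open>\<Gamma>(\<phi>\<^sup>*E)\<close>; the second condition extends by the third. The displayed equation makes
  \<open>B [u, v]\<^sub>+ w\<close> tensorial, hence zero, so that the Jacobiator is skew in its first two arguments. It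
  is tensorial in the last two arguments by the second condition, hence in all three, and vanishes.
\<close>

text \<open>The compatibility conditions speak of a bracket on all of
  \<open>\<Gamma>(\<phi>\<^sup>*E)\<close>, since they bracket values of a. So \<open>B\<close> has
  to be constructed from linearity and relatedness alone before they can be invoked.

  No global finite family of generators is used. Each point \<open>x\<close> of \<open>M\<close> has
  its own finite family of global sections \<open>e i\<close> and functionals \<open>\<mu> i\<close>
  with \<open>\<psi> v = (\<Sum>i. \<mu> i v e i)\<close>, where \<open>\<psi> x = 1\<close>. For an
  identity known to be tensorial the value 1 is enough. The bracket, however, is a first-order
  operator in each argument: replacing a section by its multiple with
  \<open>\<psi> \<circ> \<phi>\<close> keeps the value at \<open>p\<close> if the differential of
  the weight vanishes there as well. A polynomial with value 1 and derivative 0 at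
  \<open>t = 1\<close> achieves this, hence \<open>3t\<^sup>2 - 2t\<^sup>3\<close>.

  The price is that the family defining \<open>B \<sigma> \<tau> p\<close> changes with
  \<open>p\<close> by arbitrary choice. Smoothness of \<open>B \<sigma> \<tau>\<close> is therefore
  a separate matter, settled with a family that stays fixed while \<open>p\<close> moves.\<close>

section \<open>Iterated differentiability\<close>

lemma k_smooth_on_cong:
  fixes f g :: "'a::real_normed_vector \<Rightarrow> 'c::real_normed_vector"
  assumes "open S" "\<And>x. x \<in> S \<Longrightarrow> f x = g x" "k_smooth_on k S f"
  shows "k_smooth_on k S g"
  using assms(2,3)
proof (induction k arbitrary: f g)
  case 0
  then show ?case by (simp cong: continuous_on_cong)
next
  case (Suc k)
  have der: "(g has_derivative frechet_derivative f (at x)) (at x)" if "x \<in> S" for x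
  proof -
    have "(f has_derivative frechet_derivative f (at x)) (at x)"
      using Suc.prems(2) that by (simp add: frechet_derivative_works)
    then show ?thesis
      by (rule has_derivative_transform_within_open[OF _ \<open>open S\<close> that]) (use Suc.prems(1) in auto)
  qed
  have fd: "frechet_derivative f (at x) = frechet_derivative g (at x)" if "x \<in> S" for x
    using frechet_derivative_at[OF der[OF that]] .
  have "k_smooth_on k S (\<lambda>x. frechet_derivative g (at x) v)" for v
    by (rule Suc.IH[of "\<lambda>x. frechet_derivative f (at x) v"]) (use fd Suc.prems(2) in auto)
  then show ?case using der by (auto simp: differentiable_def)
qed

lemma k_smooth_on_subset:
  assumes "k_smooth_on k T f" "S \<subseteq> T"
  shows "k_smooth_on k S f"
  using assms by (induction k arbitrary: f) (auto intro: continuous_on_subset)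

text \<open>Any explicitly known derivative may stand in for the one chosen by
  \<open>frechet_derivative\<close>, because derivatives at a point are unique. Openness of
  \<open>S\<close> lets the exchange survive further differentiation.\<close>

lemma k_smooth_on_SucI:
  assumes "open S" "\<And>x. x \<in> S \<Longrightarrow> (f has_derivative f' x) (at x)"
    "\<And>v. k_smooth_on k S (\<lambda>x. f' x v)"
  shows "k_smooth_on (Suc k) S f"
proof -
  have "k_smooth_on k S (\<lambda>x. frechet_derivative f (at x) v)" for v
    by (rule k_smooth_on_cong[OF assms(1) _ assms(3)[of v]])
      (use frechet_derivative_at[OF assms(2)] in metis)
  then show ?thesis using assms(2) by (auto simp: differentiable_def)
qed

lemma k_smooth_on_Suc_has_derivative:
  assumes "k_smooth_on (Suc k) S f"
  shows "\<exists>f'. (\<forall>x\<in>S. (f has_derivative f' x) (at x)) \<and> (\<forall>v. k_smooth_on k S (\<lambda>x. f' x v))"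
  by (rule exI[of _ "\<lambda>x. frechet_derivative f (at x)"])
    (use assms in \<open>auto simp: frechet_derivative_works\<close>)

lemma k_smooth_on_SucD:
  assumes "k_smooth_on (Suc k) S f"
  shows "k_smooth_on k S f"
  using assms
proof (induction k arbitrary: f)
  case 0
  then show ?case
    by (auto simp: continuous_on_eq_continuous_within intro!: differentiable_imp_continuous_within
        intro: differentiable_at_withinI)
next
  case (Suc k)
  have "k_smooth_on k S (\<lambda>x. frechet_derivative f (at x) v)" for v
    by (rule Suc.IH) (use Suc.prems in simp)
  then show ?case using Suc.prems by simp
qed

lemma k_smooth_on_local:
  assumes "open S" "\<And>x. x \<in> S \<Longrightarrow> \<exists>T. open T \<and> x \<in> T \<and> k_smooth_on k (S \<inter> T) f"
  shows "k_smooth_on k S f"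
  using assms(2)
proof (induction k arbitrary: f)
  case 0
  then have "isCont f x" if "x \<in> S" for x
    by (metis IntI assms(1) continuous_on_eq_continuous_at k_smooth_on.simps(1) open_Int that)
  then show ?case using assms(1) by (simp add: continuous_on_eq_continuous_at)
next
  case (Suc k)
  then have 1: "f differentiable at x" if "x \<in> S" for x
    using that by (metis IntI k_smooth_on.simps(2))
  have 2: "k_smooth_on k S (\<lambda>x. frechet_derivative f (at x) v)" for v
  proof (rule Suc.IH)
    fix x assume "x \<in> S"
    then show "\<exists>T. open T \<and> x \<in> T \<and> k_smooth_on k (S \<inter> T) (\<lambda>x. frechet_derivative f (at x) v)"
      using Suc.prems by (metis k_smooth_on.simps(2))
  qed
  show ?case using 1 2 by simp
qed

lemma k_smooth_on_const: "k_smooth_on k S (\<lambda>x. c)"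
  by (induction k arbitrary: c) auto

lemma k_smooth_on_bounded_linear:
  assumes "bounded_linear L" "open S" "k_smooth_on k S f"
  shows "k_smooth_on k S (\<lambda>x. L (f x))"
  using assms(3)
proof (induction k arbitrary: f)
  case 0
  then show ?case using bounded_linear.continuous_on[OF assms(1)] by auto
next
  case (Suc k)
  obtain f' where f': "\<And>x. x \<in> S \<Longrightarrow> (f has_derivative f' x) (at x)"
    "\<And>v. k_smooth_on k S (\<lambda>x. f' x v)"
    using k_smooth_on_Suc_has_derivative[OF Suc.prems] by blast
  show ?case
    by (rule k_smooth_on_SucI[where f' = "\<lambda>x v. L (f' x v)", OF assms(2)])
      (auto intro!: f' Suc.IH bounded_linear.has_derivative[OF assms(1)])
qed

lemma k_smooth_on_ident: "k_smooth_on k S (\<lambda>x. x)"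
proof (cases k)
  case (Suc j)
  have "frechet_derivative (\<lambda>x. x) (at x) = (\<lambda>v. v)" for x :: 'a
    using frechet_derivative_at[OF has_derivative_ident[of "at x"]] by simp
  then show ?thesis using Suc by (auto simp: k_smooth_on_const)
qed auto

lemma k_smooth_on_add:
  assumes "open S" "k_smooth_on k S f" "k_smooth_on k S g"
  shows "k_smooth_on k S (\<lambda>x. f x + g x)"
  using assms(2,3)
proof (induction k arbitrary: f g)
  case 0
  then show ?case by (auto intro: continuous_on_add)
next
  case (Suc k)
  obtain f' where f': "\<And>x. x \<in> S \<Longrightarrow> (f has_derivative f' x) (at x)"
    "\<And>v. k_smooth_on k S (\<lambda>x. f' x v)"
    using k_smooth_on_Suc_has_derivative[OF Suc.prems(1)] by blast
  obtain g' where g': "\<And>x. x \<in> S \<Longrightarrow> (g has_derivative g' x) (at x)"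
    "\<And>v. k_smooth_on k S (\<lambda>x. g' x v)"
    using k_smooth_on_Suc_has_derivative[OF Suc.prems(2)] by blast
  show ?case
    by (rule k_smooth_on_SucI[where f' = "\<lambda>x v. f' x v + g' x v", OF assms(1)])
      (use f' g' Suc.IH has_derivative_add in auto)
qed

lemma k_smooth_on_sum:
  assumes "open S" "\<And>i. i \<in> I \<Longrightarrow> k_smooth_on k S (f i)"
  shows "k_smooth_on k S (\<lambda>x. \<Sum>i\<in>I. f i x)"
  using assms(2)
  by (induction I rule: infinite_finite_induct)
    (auto simp: k_smooth_on_const intro!: k_smooth_on_add[OF assms(1)])

lemma k_smooth_on_scaleR:
  fixes u :: "'a::real_normed_vector \<Rightarrow> real"
  assumes "open S" "k_smooth_on k S u" "k_smooth_on k S g"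
  shows "k_smooth_on k S (\<lambda>x. u x *\<^sub>R g x)"
  using assms(2,3)
proof (induction k arbitrary: u g)
  case 0
  then show ?case by (auto intro: continuous_on_scaleR)
next
  case (Suc k)
  obtain u' where u': "\<And>x. x \<in> S \<Longrightarrow> (u has_derivative u' x) (at x)"
    "\<And>v. k_smooth_on k S (\<lambda>x. u' x v)"
    using k_smooth_on_Suc_has_derivative[OF Suc.prems(1)] by blast
  obtain g' where g': "\<And>x. x \<in> S \<Longrightarrow> (g has_derivative g' x) (at x)"
    "\<And>v. k_smooth_on k S (\<lambda>x. g' x v)"
    using k_smooth_on_Suc_has_derivative[OF Suc.prems(2)] by blast
  show ?case
  proof (rule k_smooth_on_SucI[where f' = "\<lambda>x v. u x *\<^sub>R g' x v + u' x v *\<^sub>R g x", OF assms(1)])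
    show "k_smooth_on k S (\<lambda>x. u x *\<^sub>R g' x v + u' x v *\<^sub>R g x)" for v
      by (intro k_smooth_on_add[OF assms(1)] Suc.IH u' g' k_smooth_on_SucD[OF Suc.prems(1)]
          k_smooth_on_SucD[OF Suc.prems(2)])
  qed (use u' g' has_derivative_scaleR in auto)
qed

section \<open>Coordinates on the model space and the chain rule\<close>

lemma orthogonal_expansion:
  fixes C :: "'b::real_inner set"
  assumes "finite C" "pairwise orthogonal C" "w \<in> span C"
  shows "w = (\<Sum>b\<in>C. ((w \<bullet> b) / (b \<bullet> b)) *\<^sub>R b)"
proof -
  obtain u where u: "w = (\<Sum>b\<in>C. u b *\<^sub>R b)"
    using assms(3) unfolding span_finite[OF assms(1)] by auto
  have "w \<bullet> b = u b * (b \<bullet> b)" if "b \<in> C" for b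
  proof -
    have "w \<bullet> b = (\<Sum>c\<in>C. u c * (c \<bullet> b))"
      unfolding u by (simp add: inner_sum_left)
    also have "\<dots> = (\<Sum>c\<in>C. if c = b then u b * (b \<bullet> b) else 0)"
      by (rule sum.cong) (use assms(2) that in \<open>auto simp: pairwise_def orthogonal_def\<close>)
    finally show ?thesis using assms(1) that by simp
  qed
  \<comment> \<open>For \<open>b = 0\<close> the coefficient is \<open>0 / 0 = 0\<close> and
    multiplies the zero vector, so an orthogonal set containing 0 does no harm.\<close>
  then show ?thesis
    unfolding u by (intro sum.cong) (auto simp flip: u)
qed

text \<open>Provides continuous coordinates on every model space, the zero space included: along an
  orthogonal spanning set the coefficients are rescaled inner products, hence bounded
  linear.\<close>

lemma finite_spanning_expansion:
  fixes B :: "'b::real_inner set"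
  assumes "finite B" "span B = UNIV"
  obtains C :: "'b set" and l where "finite C" "\<And>b. bounded_linear (l b)"
    "\<And>w. w = (\<Sum>b\<in>C. l b w *\<^sub>R b)" 
proof -
  obtain C where C: "finite C" "span C = span B" "pairwise orthogonal C"
    using basis_orthogonal[OF assms(1)] by blast
  show ?thesis
  proof (rule that[of C "\<lambda>b w. (w \<bullet> b) / (b \<bullet> b)"])
    show "bounded_linear (\<lambda>w. (w \<bullet> b) / (b \<bullet> b))" for b :: 'b
      by (intro bounded_linear_divide[THEN bounded_linear_compose] bounded_linear_inner_left)
    show "w = (\<Sum>b\<in>C. ((w \<bullet> b) / (b \<bullet> b)) *\<^sub>R b)" for w
      using orthogonal_expansion[OF C(1,3), of w] C(2) assms(2) by auto
  qed (use C in auto)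
qed

lemma k_smooth_on_compose:
  fixes g :: "'a::real_normed_vector \<Rightarrow> 'b::real_inner" and f :: "'b \<Rightarrow> 'c::real_normed_vector"
  assumes fin: "\<exists>B::'b set. finite B \<and> span B = UNIV"
    and "open S" "open T" "g ` S \<subseteq> T" "k_smooth_on k T f" "k_smooth_on k S g"
  shows "k_smooth_on k S (\<lambda>x. f (g x))"
  using assms(5,6)
proof (induction k arbitrary: f)
  case 0
  then show ?case using assms(4) continuous_on_compose2 by fastforce
next
  case (Suc k)
  obtain C :: "'b set" and l where C: "finite C" "\<And>b. bounded_linear (l b)"
    "\<And>w. w = (\<Sum>b\<in>C. l b w *\<^sub>R b)"
    using fin finite_spanning_expansion by metis
  obtain f' where f': "\<And>x. x \<in> T \<Longrightarrow> (f has_derivative f' x) (at x)"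
    "\<And>v. k_smooth_on k T (\<lambda>x. f' x v)"
    using k_smooth_on_Suc_has_derivative[OF Suc.prems(1)] by blast
  obtain g' where g': "\<And>x. x \<in> S \<Longrightarrow> (g has_derivative g' x) (at x)"
    "\<And>v. k_smooth_on k S (\<lambda>x. g' x v)"
    using k_smooth_on_Suc_has_derivative[OF Suc.prems(2)] by blast
  show ?case
  proof (rule k_smooth_on_SucI[where f' = "\<lambda>x v. f' (g x) (g' x v)", OF assms(2)])
    show "((\<lambda>x. f (g x)) has_derivative (\<lambda>v. f' (g x) (g' x v))) (at x)" if "x \<in> S" for x
      using has_derivative_compose[OF g'(1)[OF that] f'(1)] that assms(4) by blast
  next
    fix v
    \<comment> \<open>The direction \<open>g' x v\<close> moves with \<open>x\<close>, whereas the
      induction hypothesis covers derivatives of \<open>f\<close> in fixed directions only.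
      Expanding it in coordinates leaves the fixed directions \<open>b\<close> with smooth scalar
      coefficients.\<close>
    have "k_smooth_on k S (\<lambda>x. \<Sum>b\<in>C. l b (g' x v) *\<^sub>R f' (g x) b)"
      by (intro k_smooth_on_sum k_smooth_on_scaleR k_smooth_on_bounded_linear[OF C(2)] Suc.IH
          f' g' k_smooth_on_SucD[OF Suc.prems(2)] assms)
    moreover have "(\<Sum>b\<in>C. l b (g' x v) *\<^sub>R f' (g x) b) = f' (g x) (g' x v)" if "x \<in> S" for x
    proof -
      have "linear (f' (g x))"
        using f'(1) that assms(4) has_derivative_linear by blast
      then show ?thesis
        by (subst (2) C(3)[of "g' x v"]) (simp add: linear_sum linear_scale)
    qed
    ultimately show "k_smooth_on k S (\<lambda>x. f' (g x) (g' x v))"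
      by (rule k_smooth_on_cong[OF assms(2), rotated])
  qed
qed

section \<open>Functions of one variable: the reciprocal and flat exponentials\<close>

lemma finite_spanning_real: "\<exists>B::real set. finite B \<and> span B = UNIV"
proof -
  have "x \<in> span {1}" for x :: real
  proof -
    have "x *\<^sub>R 1 \<in> span {1::real}" by (intro span_scale span_base) simp
    then show ?thesis unfolding real_scaleR_def mult_1_right .
  qed
  then show ?thesis by (intro exI[of _ "{1}"]) auto
qed

text \<open>The derivative is a product of values of \<open>inverse\<close> itself, so order
  \<open>k\<close> of the function yields order \<open>k\<close> of its derivative.\<close>

lemma k_smooth_on_inverse: "k_smooth_on k (- {0}) (inverse :: real \<Rightarrow> real)"
proof (induction k)
  case 0
  show ?case by (auto intro!: continuous_intros)
next
  case (Suc k)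
  show ?case
  proof (rule k_smooth_on_SucI[where f' = "\<lambda>x v. (inverse x * v) *\<^sub>R (- inverse x)"])
    show "k_smooth_on k (- {0}) (\<lambda>x. (inverse x * v) *\<^sub>R (- inverse x))" for v :: real
      by (intro k_smooth_on_scaleR k_smooth_on_bounded_linear[OF bounded_linear_mult_left]
          k_smooth_on_bounded_linear[OF bounded_linear_minus[OF bounded_linear_ident]] Suc) auto
  qed (auto intro!: derivative_eq_intros)
qed

text \<open>The case \<open>n = 0\<close> is the classical flat function. The powers of
  \<open>1 / t\<close> make the family closed under differentiation up to linear
  combinations.\<close>

definition flat_exp :: "nat \<Rightarrow> real \<Rightarrow> real" where
  "flat_exp n t = (if t > 0 then exp (- (1 / t)) / t ^ n else 0)"

text \<open>The substitution \<open>s = 1 / t\<close> turns the right-hand limit into that of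
  \<open>s ^ n / exp s\<close> at infinity.\<close>

lemma tendsto_flat_exp_0: "(flat_exp n \<longlongrightarrow> 0) (at 0)"
proof -
  have "((\<lambda>s::real. s ^ n / exp s) \<longlongrightarrow> 0) at_top"
    by (rule tendsto_power_div_exp_0)
  then have "((\<lambda>t::real. inverse t ^ n / exp (inverse t)) \<longlongrightarrow> 0) (at_right 0)"
    by (rule filterlim_compose[OF _ filterlim_inverse_at_top_right])
  moreover have "\<forall>\<^sub>F t in at_right 0. inverse t ^ n / exp (inverse t) = flat_exp n t"
    by (rule eventually_mono[OF eventually_at_right_less])
      (simp add: flat_exp_def exp_minus divide_simps)
  ultimately have "(flat_exp n \<longlongrightarrow> 0) (at_right 0)"
    by (simp add: tendsto_cong)
  moreover have "\<forall>\<^sub>F t in at_left 0. flat_exp n t = 0"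
    by (auto simp: flat_exp_def eventually_at_filter)
  then have "(flat_exp n \<longlongrightarrow> 0) (at_left 0)"
    by (simp add: tendsto_eventually)
  ultimately show ?thesis
    by (rule filterlim_split_at[rotated])
qed

lemma DERIV_flat_exp:
  "(flat_exp n has_real_derivative (flat_exp (n + 2) t - n * flat_exp (n + 1) t)) (at t)"
proof -
  consider "t > 0" | "t < 0" | "t = 0" by linarith
  then show ?thesis
  proof cases
    case 1
    have "((\<lambda>t. exp (- (1 / t))) has_real_derivative exp (- (1 / t)) / t\<^sup>2) (at t)"
      using 1 by (auto intro!: derivative_eq_intros simp: power2_eq_square)
    from DERIV_divide[OF this DERIV_pow[of n]]
    have "((\<lambda>t. exp (- (1 / t)) / t ^ n) has_real_derivative
        (flat_exp (n + 2) t - n * flat_exp (n + 1) t)) (at t)"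
    proof (rule DERIV_cong)
      \<comment> \<open>For \<open>n = 0\<close> the exponent is truncated, but the factor
        \<open>n\<close> makes both sides vanish.\<close>
      have "n * t ^ (n - Suc 0) = n * t ^ n / t" using 1 by (cases n) auto
      then show "(exp (- (1 / t)) / t\<^sup>2 * t ^ n - exp (- (1 / t)) * (n * t ^ (n - Suc 0))) / (t ^ n * t ^ n)
        = flat_exp (n + 2) t - n * flat_exp (n + 1) t"
        using 1 by (simp only: flat_exp_def) (simp add: field_simps power2_eq_square)
    qed (use 1 in auto)
    then show ?thesis
      by (rule has_field_derivative_transform_within_open[where S = "{0<..}"])
        (use 1 in \<open>auto simp: flat_exp_def\<close>)
  next
    case 2
    have "((\<lambda>t. 0) has_real_derivative (flat_exp (n + 2) t - n * flat_exp (n + 1) t)) (at t)"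
      using 2 by (auto simp: flat_exp_def)
    then show ?thesis
      by (rule has_field_derivative_transform_within_open[where S = "{..<0}"])
        (use 2 in \<open>auto simp: flat_exp_def\<close>)
  next
    case 3
    \<comment> \<open>At 0 the difference quotient of one member of the family is the next member,
      so the limit computed above is the derivative.\<close>
    have "(flat_exp n (0 + h) - flat_exp n 0) / h = flat_exp (n + 1) h" for h
      by (simp add: flat_exp_def)
    moreover have "flat_exp (n + 2) 0 - n * flat_exp (n + 1) 0 = 0"
      by (simp add: flat_exp_def)
    ultimately show ?thesis
      unfolding DERIV_def 3 using tendsto_flat_exp_0[of "n + 1"] by (simp only:)
  qed
qed

lemma k_smooth_on_flat_exp: "k_smooth_on k UNIV (flat_exp n)"
proof (induction k arbitrary: n)
  case 0
  show ?case
    by (simp add: continuous_on_eq_continuous_at DERIV_isCont[OF DERIV_flat_exp])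
next
  case (Suc k)
  show ?case
  proof (rule k_smooth_on_SucI
      [where f' = "\<lambda>t v. v * flat_exp (n + 2) t + (- (v * n)) * flat_exp (n + 1) t"])
    show "k_smooth_on k UNIV (\<lambda>t. v * flat_exp (n + 2) t + (- (v * n)) * flat_exp (n + 1) t)" for v
      by (intro k_smooth_on_add k_smooth_on_bounded_linear[OF bounded_linear_mult_right] Suc) auto
  next
    fix t :: real
    have "(\<lambda>v. (flat_exp (n + 2) t - n * flat_exp (n + 1) t) * v)
      = (\<lambda>v::real. v * flat_exp (n + 2) t + (- (v * n)) * flat_exp (n + 1) t)"
      by (auto simp: algebra_simps)
    then show "(flat_exp n has_derivative
        (\<lambda>v. v * flat_exp (n + 2) t + (- (v * n)) * flat_exp (n + 1) t)) (at t)"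
      using DERIV_flat_exp[of n t] unfolding has_field_derivative_def by simp
  qed auto
qed

text \<open>The ball around 0 is a closed subset of the set \<open>P C\<close> of combinations with
  bounded coefficients, which is a finite sum of compact segments. Translation moves the
  centre.\<close>

lemma compact_cball_finite_span:
  fixes x :: "'b::real_inner"
  assumes fin: "\<exists>B::'b set. finite B \<and> span B = UNIV"
  shows "compact (cball x r)"
proof -
  obtain C :: "'b set" and l where C: "finite C" "\<And>b. bounded_linear (l b)"
    "\<And>w. w = (\<Sum>b\<in>C. l b w *\<^sub>R b)"
    using fin finite_spanning_expansion by metis
  have "\<exists>K>0. \<forall>w. norm (l b w) \<le> norm w * K" for b
    using bounded_linear.pos_bounded[OF C(2)] by blast
  then obtain K where K: "\<And>b. K b > 0" "\<And>b w. norm (l b w) \<le> norm w * K b" by metis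
  define P where "P D = {(\<Sum>b\<in>D. u b *\<^sub>R b) | u. \<forall>b\<in>D. \<bar>u b\<bar> \<le> r * K b}" for D
  have "compact (P D)" if "finite D" for D
    using that
  proof (induction D rule: finite_induct)
    case empty
    show ?case by (simp add: P_def)
  next
    case (insert b D)
    have "P (insert b D) = {y + z | y z. y \<in> (\<lambda>t. t *\<^sub>R b) ` {- (r * K b)..r * K b} \<and> z \<in> P D}"
    proof (intro equalityI subsetI)
      fix w assume "w \<in> P (insert b D)"
      then obtain u where u: "w = (\<Sum>c\<in>insert b D. u c *\<^sub>R c)"
        "\<forall>c\<in>insert b D. \<bar>u c\<bar> \<le> r * K c"
        unfolding P_def by blast
      then have "w = u b *\<^sub>R b + (\<Sum>c\<in>D. u c *\<^sub>R c)"
        using insert by simp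
      moreover have "u b \<in> {- (r * K b)..r * K b}" using u(2) by (auto simp: abs_le_iff)
      moreover have "(\<Sum>c\<in>D. u c *\<^sub>R c) \<in> P D" using u(2) by (auto simp: P_def)
      ultimately show "w \<in> {y + z | y z. y \<in> (\<lambda>t. t *\<^sub>R b) ` {- (r * K b)..r * K b} \<and> z \<in> P D}"
        by blast
    next
      fix w assume "w \<in> {y + z | y z. y \<in> (\<lambda>t. t *\<^sub>R b) ` {- (r * K b)..r * K b} \<and> z \<in> P D}"
      then obtain t u where tu: "w = t *\<^sub>R b + (\<Sum>c\<in>D. u c *\<^sub>R c)" "\<bar>t\<bar> \<le> r * K b"
        "\<forall>c\<in>D. \<bar>u c\<bar> \<le> r * K c"
        unfolding P_def by (auto simp: abs_le_iff)
      have "w = (\<Sum>c\<in>insert b D. (u(b := t)) c *\<^sub>R c)"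
        using insert tu(1) by (auto intro!: sum.cong)
      moreover have "\<forall>c\<in>insert b D. \<bar>(u(b := t)) c\<bar> \<le> r * K c"
        using tu by auto
      ultimately show "w \<in> P (insert b D)" unfolding P_def by blast
    qed
    moreover have "compact ((\<lambda>t. t *\<^sub>R b) ` {- (r * K b)..r * K b})"
      by (intro compact_continuous_image continuous_intros) auto
    ultimately show ?case using compact_sums[OF _ insert.IH] by simp
  qed
  then have "compact (P C)" using C(1) by simp
  moreover have "cball 0 r \<subseteq> P C"
  proof
    fix w :: 'b assume w: "w \<in> cball 0 r"
    have "\<bar>l b w\<bar> \<le> r * K b" for b
    proof -
      have "norm w * K b \<le> r * K b" using w K(1)[of b] by (intro mult_right_mono) auto
      then show ?thesis using K(2)[where b = b and w = w] by simp
    qed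
    then show "w \<in> P C"
      unfolding P_def by (intro CollectI exI[of _ "\<lambda>b. l b w"] conjI C(3)) simp
  qed
  ultimately have "compact (cball (0::'b) r)"
    using compact_Int_closed[OF _ closed_cball] by (metis inf.absorb_iff2)
  then have "compact ((+) x ` cball 0 r)" by (rule compact_translation)
  then show ?thesis by simp
qed

section \<open>Smooth functions and bump functions\<close>

lemma smooth_on_cong:
  assumes "open S" "\<And>x. x \<in> S \<Longrightarrow> f x = g x" "smooth_on S f"
  shows "smooth_on S g"
  using assms k_smooth_on_cong unfolding smooth_on_def by blast

lemma smooth_on_subset: "smooth_on T f \<Longrightarrow> S \<subseteq> T \<Longrightarrow> smooth_on S f"
  using k_smooth_on_subset unfolding smooth_on_def by blast

lemma smooth_on_const: "smooth_on S (\<lambda>x. c)"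
  by (simp add: smooth_on_def k_smooth_on_const)

lemma smooth_on_add:
  assumes "open S" "smooth_on S f" "smooth_on S g"
  shows "smooth_on S (\<lambda>x. f x + g x)"
  using assms unfolding smooth_on_def by (simp add: k_smooth_on_add)

lemma smooth_on_mult:
  fixes f g :: "'a::real_normed_vector \<Rightarrow> real"
  assumes "open S" "smooth_on S f" "smooth_on S g"
  shows "smooth_on S (\<lambda>x. f x * g x)"
  using assms k_smooth_on_scaleR[of S _ f g] unfolding smooth_on_def by simp

lemma smooth_on_inner:
  fixes f :: "'a::real_normed_vector \<Rightarrow> 'b::real_inner"
  assumes fin: "\<exists>B::'b set. finite B \<and> span B = UNIV"
    and "open S" "smooth_on S f"
  shows "smooth_on S (\<lambda>x. f x \<bullet> f x)"
proof -
  obtain C :: "'b set" and l where C: "finite C" "\<And>b. bounded_linear (l b)"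
    "\<And>w. w = (\<Sum>b\<in>C. l b w *\<^sub>R b)"
    using fin finite_spanning_expansion by metis
  have eq: "f x \<bullet> f x = (\<Sum>b\<in>C. l b (f x) * (b \<bullet> f x))" for x
    by (subst C(3)[of "f x"], subst inner_sum_left) simp
  have "k_smooth_on k S (\<lambda>x. \<Sum>b\<in>C. l b (f x) *\<^sub>R (b \<bullet> f x))" for k
    by (intro k_smooth_on_sum k_smooth_on_scaleR k_smooth_on_bounded_linear[OF C(2)]
        k_smooth_on_bounded_linear[OF bounded_linear_inner_right] assms)
      (use assms(3) in \<open>auto simp: smooth_on_def\<close>)
  then show ?thesis by (simp add: smooth_on_def eq)
qed

lemma smooth_on_compose:
  fixes g :: "'a::real_normed_vector \<Rightarrow> 'b::real_inner" and f :: "'b \<Rightarrow> 'c::real_normed_vector"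
  assumes "\<exists>B::'b set. finite B \<and> span B = UNIV"
    "open S" "open T" "g ` S \<subseteq> T" "smooth_on T f" "smooth_on S g"
  shows "smooth_on S (\<lambda>x. f (g x))"
  using assms(5,6) k_smooth_on_compose[OF assms(1-4)] unfolding smooth_on_def by blast

lemma smooth_on_local:
  assumes "open S" "\<And>x. x \<in> S \<Longrightarrow> \<exists>T. open T \<and> x \<in> T \<and> smooth_on (S \<inter> T) f"
  shows "smooth_on S f"
  unfolding smooth_on_def
proof (intro allI k_smooth_on_local[OF assms(1)])
  fix k x assume "x \<in> S"
  then show "\<exists>T. open T \<and> x \<in> T \<and> k_smooth_on k (S \<inter> T) f"
    using assms(2)[of x] by (auto simp: smooth_on_def)
qed

lemma smooth_on_flat_exp: "smooth_on UNIV (flat_exp n)"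
  by (simp add: smooth_on_def k_smooth_on_flat_exp)

lemma smooth_on_inverse:
  fixes f :: "'a::real_normed_vector \<Rightarrow> real"
  assumes "open S" "smooth_on S f" "\<And>x. x \<in> S \<Longrightarrow> f x \<noteq> 0"
  shows "smooth_on S (\<lambda>x. inverse (f x))"
  by (rule smooth_on_compose[OF finite_spanning_real assms(1) _ _ _ assms(2), of "- {0}"])
    (use assms(3) k_smooth_on_inverse in \<open>auto simp: smooth_on_def\<close>)

section \<open>Charts, cutoffs and bump functions on a manifold\<close>

context
  fixes A :: "('m::{t2_space,second_countable_topology}, 'b::real_inner) atlas"
  assumes A: "smooth_manifold A"
begin

lemma fin_span: "\<exists>B::'b set. finite B \<and> span B = UNIV"
  using A by (simp add: smooth_manifold_def)

lemma chart_open: "(U, c) \<in> A \<Longrightarrow> open U"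
  using A by (auto simp: smooth_manifold_def)

lemma chart_homeomorphism: "(U, c) \<in> A \<Longrightarrow> homeomorphism U (c ` U) c (inv_into U c)"
  using A by (auto simp: smooth_manifold_def)

lemma chart_inv [simp]: "(U, c) \<in> A \<Longrightarrow> x \<in> U \<Longrightarrow> inv_into U c (c x) = x"
  using chart_homeomorphism homeomorphism_apply1 by metis

lemma chart_open_image:
  assumes "(U, c) \<in> A" "open W"
  shows "open (c ` (U \<inter> W))"
proof -
  have "openin (top_of_set U) (U \<inter> W)" using assms(2) by (simp add: openin_open_Int)
  then have "openin (top_of_set (c ` U)) (c ` (U \<inter> W))"
    using homeomorphism_imp_open_map[OF chart_homeomorphism[OF assms(1)]] by blast
  moreover have "open (c ` U)" using A assms(1) by (auto simp: smooth_manifold_def)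
  ultimately show ?thesis using openin_open_trans by blast
qed

lemma chart_exists: "\<exists>U c. (U, c) \<in> A \<and> x \<in> U"
proof -
  have "x \<in> (\<Union>(U, c)\<in>A. U)" using A by (simp add: smooth_manifold_def)
  then show ?thesis by auto
qed

lemma chart_transition:
  "(U, c) \<in> A \<Longrightarrow> (V, d) \<in> A \<Longrightarrow> smooth_on (c ` (U \<inter> V)) (\<lambda>y. d (inv_into U c y))"
  using A unfolding smooth_manifold_def comp_def by fast

lemma smooth_fun_onI:
  assumes "\<And>U c. (U, c) \<in> A \<Longrightarrow> smooth_on (c ` (U \<inter> W)) (\<lambda>y. f (inv_into U c y))"
  shows "smooth_fun_on A W f"
  using assms by (auto simp: smooth_fun_on_def comp_def)

lemma smooth_fun_onD:
  "smooth_fun_on A W f \<Longrightarrow> (U, c) \<in> A \<Longrightarrow> smooth_on (c ` (U \<inter> W)) (\<lambda>y. f (inv_into U c y))"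
  by (auto simp: smooth_fun_on_def comp_def)

lemma smooth_fun_on_const [simp]: "smooth_fun_on A W (\<lambda>x. c)"
  by (auto simp: smooth_fun_on_def comp_def smooth_on_const)

lemma smooth_fun_on_add:
  assumes "open W" "smooth_fun_on A W f" "smooth_fun_on A W g"
  shows "smooth_fun_on A W (\<lambda>x. f x + g x)"
  by (rule smooth_fun_onI, rule smooth_on_add)
    (use assms in \<open>auto intro: chart_open_image smooth_fun_onD\<close>)

lemma smooth_fun_on_mult:
  assumes "open W" "smooth_fun_on A W f" "smooth_fun_on A W g"
  shows "smooth_fun_on A W (\<lambda>x. f x * g x)"
  by (rule smooth_fun_onI, rule smooth_on_mult)
    (use assms in \<open>auto intro: chart_open_image smooth_fun_onD\<close>)

lemma smooth_fun_on_minus: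
  assumes "open W" "smooth_fun_on A W f"
  shows "smooth_fun_on A W (\<lambda>x. - f x)"
  using smooth_fun_on_mult[OF assms(1) smooth_fun_on_const[of W "-1"] assms(2)] by simp

lemma smooth_fun_on_diff:
  assumes "open W" "smooth_fun_on A W f" "smooth_fun_on A W g"
  shows "smooth_fun_on A W (\<lambda>x. f x - g x)"
  using smooth_fun_on_add[OF assms(1,2) smooth_fun_on_minus[OF assms(1,3)]] by simp

lemma smooth_fun_on_sum:
  assumes "open W" "\<And>i. i \<in> I \<Longrightarrow> smooth_fun_on A W (f i)"
  shows "smooth_fun_on A W (\<lambda>x. \<Sum>i\<in>I. f i x)"
  using assms(2)
  by (induction I rule: infinite_finite_induct) (auto intro: smooth_fun_on_add[OF assms(1)])

lemma smooth_fun_on_subset: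
  assumes "smooth_fun_on A W f" "W' \<subseteq> W"
  shows "smooth_fun_on A W' f"
  using assms by (intro smooth_fun_onI smooth_on_subset[OF smooth_fun_onD[OF assms(1)]]) auto

lemma smooth_fun_on_cong:
  assumes "open W" "\<And>x. x \<in> W \<Longrightarrow> f x = g x" "smooth_fun_on A W f"
  shows "smooth_fun_on A W g"
  using assms by (intro smooth_fun_onI smooth_on_cong[OF chart_open_image _ smooth_fun_onD[OF assms(3)]]) auto

lemma smooth_fun_on_local:
  assumes "open W" "\<And>x. x \<in> W \<Longrightarrow> \<exists>W'. open W' \<and> x \<in> W' \<and> smooth_fun_on A (W \<inter> W') f"
  shows "smooth_fun_on A W f"
proof (intro smooth_fun_onI smooth_on_local chart_open_image)
  fix U c y assume Uc: "(U, c) \<in> A" and "y \<in> c ` (U \<inter> W)"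
  then obtain x where x: "x \<in> U" "x \<in> W" "y = c x" by blast
  obtain W' where W': "open W'" "x \<in> W'" "smooth_fun_on A (W \<inter> W') f"
    using assms(2)[OF x(2)] by blast
  have "c ` (U \<inter> W) \<inter> c ` (U \<inter> W') \<subseteq> c ` (U \<inter> (W \<inter> W'))"
    using Uc by (auto dest: arg_cong[where f = "inv_into U c"])
  then have "smooth_on (c ` (U \<inter> W) \<inter> c ` (U \<inter> W')) (\<lambda>y. f (inv_into U c y))"
    using smooth_fun_onD[OF W'(3) Uc] smooth_on_subset by blast
  then show "\<exists>T. open T \<and> y \<in> T \<and> smooth_on (c ` (U \<inter> W) \<inter> T) (\<lambda>y. f (inv_into U c y))"
    using chart_open_image[OF Uc W'(1)] x W'(2) by blast
qed (use assms in auto)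

lemma smooth_fun_on_inverse:
  assumes "open W" "smooth_fun_on A W f" "\<And>x. x \<in> W \<Longrightarrow> f x \<noteq> 0"
  shows "smooth_fun_on A W (\<lambda>x. inverse (f x))"
proof (intro smooth_fun_onI smooth_on_inverse chart_open_image)
  fix U c y assume "(U, c) \<in> A" "y \<in> c ` (U \<inter> W)"
  then show "f (inv_into U c y) \<noteq> 0" using assms(3) by auto
qed (use assms smooth_fun_onD in auto)

lemma smooth_fun_on_imp_continuous_on:
  assumes "smooth_fun_on A UNIV f"
  shows "continuous_on UNIV f"
proof -
  have "isCont f x" for x
  proof -
    obtain U c where Uc: "(U, c) \<in> A" "x \<in> U" using chart_exists by blast
    have "continuous_on (c ` U) (\<lambda>y. f (inv_into U c y))"
      using smooth_fun_onD[OF assms Uc(1)] unfolding smooth_on_def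
      by (metis inf_top_right k_smooth_on.simps(1))
    moreover have "continuous_on U c"
      using chart_homeomorphism[OF Uc(1)] homeomorphism_cont1 by blast
    ultimately have "continuous_on U (\<lambda>x. f (inv_into U c (c x)))"
      by (rule continuous_on_compose2) auto
    then have "continuous_on U f"
      by (rule continuous_on_eq) (use Uc in auto)
    then show ?thesis using chart_open[OF Uc(1)] Uc(2) continuous_on_eq_continuous_at by blast
  qed
  then show ?thesis by (simp add: continuous_on_eq_continuous_at)
qed

text \<open>Recovers smoothness from expressions that carry a weight: near \<open>p\<close> the
  weight is nonzero and can be divided out.\<close>

lemma smooth_fun_on_cancel:
  assumes "open W"
    "\<And>p. p \<in> W \<Longrightarrow> \<exists>\<theta>\<in>smooth_funs A. \<theta> p \<noteq> 0 \<and> smooth_fun_on A W (\<lambda>x. \<theta> x * g x)"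
  shows "smooth_fun_on A W g"
proof (rule smooth_fun_on_local[OF assms(1)])
  fix p assume "p \<in> W"
  then obtain \<theta> where \<theta>: "smooth_fun_on A UNIV \<theta>" "\<theta> p \<noteq> 0" "smooth_fun_on A W (\<lambda>x. \<theta> x * g x)"
    using assms(2) by auto
  define W' where "W' = {x. \<theta> x \<noteq> 0}"
  have W': "open W'"
    unfolding W'_def using smooth_fun_on_imp_continuous_on[OF \<theta>(1)]
    by (intro open_Collect_neq continuous_on_const)
  have "smooth_fun_on A (W \<inter> W') (\<lambda>x. inverse (\<theta> x) * (\<theta> x * g x))"
    by (intro smooth_fun_on_mult smooth_fun_on_inverse open_Int assms W'
        smooth_fun_on_subset[OF \<theta>(1)] smooth_fun_on_subset[OF \<theta>(3)]) (auto simp: W'_def)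
  then have "smooth_fun_on A (W \<inter> W') g"
    by (rule smooth_fun_on_cong[rotated 2]) (use assms W' in \<open>auto simp: W'_def\<close>)
  then show "\<exists>W'. open W' \<and> p \<in> W' \<and> smooth_fun_on A (W \<inter> W') g"
    using W' \<theta>(2) by (auto simp: W'_def)
qed

text \<open>Extension by zero: \<open>U\<close> and the complement of \<open>K\<close> form an open
  cover, and on the latter the function vanishes identically.\<close>

lemma smooth_fun_on_bump_mult:
  assumes "open V" "open U" "closed K" "K \<subseteq> U" "\<And>x. x \<notin> K \<Longrightarrow> \<theta> x = 0"
    "smooth_fun_on A UNIV \<theta>" "smooth_fun_on A (U \<inter> V) g"
  shows "smooth_fun_on A V (\<lambda>x. if x \<in> U then \<theta> x * g x else 0)"
proof (rule smooth_fun_on_local[OF assms(1)])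
  fix x assume "x \<in> V"
  show "\<exists>W'. open W' \<and> x \<in> W' \<and> smooth_fun_on A (V \<inter> W') (\<lambda>x. if x \<in> U then \<theta> x * g x else 0)"
  proof (cases "x \<in> U")
    case True
    have "smooth_fun_on A (V \<inter> U) (\<lambda>x. \<theta> x * g x)"
      using assms by (intro smooth_fun_on_mult smooth_fun_on_subset[OF assms(6)]) (auto simp: Int_commute)
    then have "smooth_fun_on A (V \<inter> U) (\<lambda>x. if x \<in> U then \<theta> x * g x else 0)"
      by (rule smooth_fun_on_cong[rotated 2]) (use assms in auto)
    then show ?thesis using True assms(2) by blast
  next
    case False
    have "smooth_fun_on A (V \<inter> - K) (\<lambda>x. if x \<in> U then \<theta> x * g x else 0)"
      by (rule smooth_fun_on_cong[OF _ _ smooth_fun_on_const[of _ 0]]) (use assms in auto)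
    then show ?thesis using False assms(3,4) by (intro exI[of _ "- K"]) auto
  qed
qed

lemma bump_function:
  assumes "open W" "x \<in> W"
  obtains \<theta> K where "smooth_fun_on A UNIV \<theta>" "\<theta> x = 1" "closed K" "K \<subseteq> W"
    "\<And>y. y \<notin> K \<Longrightarrow> \<theta> y = 0"
proof -
  obtain U c where Uc: "(U, c) \<in> A" "x \<in> U" using chart_exists by blast
  have "open (c ` (U \<inter> W))" using chart_open_image[OF Uc(1) assms(1)] .
  then obtain r where r: "r > 0" "cball (c x) r \<subseteq> c ` (U \<inter> W)"
    using open_contains_cball Uc assms(2) by (metis IntI imageI)
  \<comment> \<open>Being compact in a Hausdorff space, \<open>K\<close> is closed in the whole
    manifold and not merely in the chart domain. This is what permits the extension by zero
    below.\<close>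
  define K where "K = inv_into U c ` cball (c x) r"
  have "continuous_on (c ` U) (inv_into U c)"
    using chart_homeomorphism[OF Uc(1)] homeomorphism_cont2 by blast
  then have "continuous_on (cball (c x) r) (inv_into U c)"
    by (rule continuous_on_subset) (use r(2) in auto)
  then have "compact K"
    unfolding K_def by (intro compact_continuous_image compact_cball_finite_span[OF fin_span])
  then have K: "closed K" "K \<subseteq> U \<inter> W"
    using compact_imp_closed r(2) Uc by (auto simp: K_def)
  \<comment> \<open>The argument of the numerator is positive exactly inside the ball of radius
    \<open>r\<close>; the denominator is the value at the centre and normalises it to 1.\<close>
  define \<beta> where "\<beta> y = flat_exp 0 (r\<^sup>2 - (y - c x) \<bullet> (y - c x)) / flat_exp 0 (r\<^sup>2)" for y
  define \<theta> where "\<theta> y = (if y \<in> U then \<beta> (c y) else 0)" for y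
  have "smooth_on UNIV (\<lambda>y::'b. y - c x)"
    using k_smooth_on_add[OF open_UNIV k_smooth_on_ident k_smooth_on_const[of _ _ "- c x"]]
    by (simp add: smooth_on_def)
  then have "smooth_on UNIV (\<lambda>y. r\<^sup>2 + (-1) * ((y - c x) \<bullet> (y - c x)))"
    by (intro smooth_on_add smooth_on_mult smooth_on_const smooth_on_inner fin_span) auto
  then have "smooth_on UNIV (\<lambda>y. flat_exp 0 (r\<^sup>2 - (y - c x) \<bullet> (y - c x)))"
    by (intro smooth_on_compose[OF finite_spanning_real _ _ _ smooth_on_flat_exp]) auto
  from smooth_on_mult[OF open_UNIV this smooth_on_const[of _ "1 / flat_exp 0 (r\<^sup>2)"]]
  have \<beta>: "smooth_on UNIV \<beta>" by (simp add: \<beta>_def[abs_def])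
  have zero: "\<theta> y = 0" if "y \<notin> K" for y
  proof (cases "y \<in> U")
    case True
    have "c y \<notin> cball (c x) r"
      using that True Uc(1) unfolding K_def by (metis chart_inv image_eqI)
    then have "r < norm (c y - c x)" by (simp add: dist_norm norm_minus_commute)
    then have "r\<^sup>2 < (norm (c y - c x))\<^sup>2" using r(1) by (intro power_strict_mono) auto
    then show ?thesis by (simp add: \<theta>_def \<beta>_def flat_exp_def power2_norm_eq_inner)
  qed (simp add: \<theta>_def)
  have "smooth_fun_on A UNIV \<theta>"
  proof (rule smooth_fun_on_local)
    fix y
    show "\<exists>W'. open W' \<and> y \<in> W' \<and> smooth_fun_on A (UNIV \<inter> W') \<theta>"
    proof (cases "y \<in> U")
      case True
      have "smooth_fun_on A U \<theta>"
      proof (rule smooth_fun_onI)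
        fix V d assume Vd: "(V, d) \<in> A"
        have "smooth_on (d ` (V \<inter> U)) (\<lambda>y. \<beta> (c (inv_into V d y)))"
          by (rule smooth_on_compose[OF fin_span _ open_UNIV _ \<beta> chart_transition[OF Vd Uc(1)]])
            (use chart_open_image[OF Vd chart_open[OF Uc(1)]] in auto)
        then show "smooth_on (d ` (V \<inter> U)) (\<lambda>y. \<theta> (inv_into V d y))"
          by (rule smooth_on_cong[rotated 2])
            (use chart_open_image[OF Vd chart_open[OF Uc(1)]] Vd in \<open>auto simp: \<theta>_def\<close>)
      qed
      then show ?thesis using True chart_open[OF Uc(1)] by auto
    next
      case False
      have "smooth_fun_on A (- K) \<theta>"
        by (rule smooth_fun_on_cong[OF _ _ smooth_fun_on_const[of _ 0]]) (use K zero in auto)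
      then show ?thesis using False K by (intro exI[of _ "- K"]) auto
    qed
  qed auto
  moreover have "\<theta> x = 1"
    using Uc r(1) by (simp add: \<theta>_def \<beta>_def flat_exp_def)
  ultimately show thesis using that[of \<theta> K] K zero by auto
qed

end

lemma smooth_fun_on_pullback:
  fixes AM :: "('m::{t2_space,second_countable_topology}, 'b::real_inner) atlas"
    and AN :: "('n::{t2_space,second_countable_topology}, 'c::real_inner) atlas"
  assumes AM: "smooth_manifold AM" and AN: "smooth_manifold AN" and \<phi>: "smooth_map AN AM \<phi>"
    and W: "open W" and h: "smooth_fun_on AM W h"
  shows "smooth_fun_on AN (\<phi> -` W) (\<lambda>p. h (\<phi> p))"
proof -
  have cont: "continuous_on UNIV \<phi>" using \<phi> by (simp add: smooth_map_def)
  then have op: "open (\<phi> -` X)" if "open X" for X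
    using that by (simp add: open_vimage)
  show ?thesis
  proof (rule smooth_fun_on_local[OF AN op[OF W]])
    fix p assume p: "p \<in> \<phi> -` W"
    obtain U c where Uc: "(U, c) \<in> AM" "\<phi> p \<in> U" using chart_exists[OF AM] by blast
    have opU: "open U" using chart_open[OF AM Uc(1)] .
    have "smooth_fun_on AN (\<phi> -` W \<inter> \<phi> -` U) (\<lambda>p. h (\<phi> p))"
    proof (rule smooth_fun_onI[OF AN])
      fix V d assume Vd: "(V, d) \<in> AN"
      let ?S = "d ` (V \<inter> (\<phi> -` W \<inter> \<phi> -` U))"
      have S: "open ?S" by (intro chart_open_image[OF AN Vd] open_Int op W opU)
      have "smooth_on (d ` (V \<inter> \<phi> -` U)) (\<lambda>y. c (\<phi> (inv_into V d y)))"
        using \<phi> Vd Uc(1) unfolding smooth_map_def comp_def by fast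
      then have g: "smooth_on ?S (\<lambda>y. c (\<phi> (inv_into V d y)))"
        by (rule smooth_on_subset) auto
      have "smooth_on ?S (\<lambda>y. h (inv_into U c (c (\<phi> (inv_into V d y)))))"
        by (rule smooth_on_compose[OF fin_span[OF AM] S _ _ smooth_fun_onD[OF AM h Uc(1)] g])
          (use chart_open_image[OF AM Uc(1) W] chart_inv[OF AN Vd] in auto)
      then show "smooth_on ?S (\<lambda>y. h (\<phi> (inv_into V d y)))"
        by (rule smooth_on_cong[OF S, rotated]) (use chart_inv[OF AN Vd] chart_inv[OF AM Uc(1)] in auto)
    qed
    then show "\<exists>W'. open W' \<and> p \<in> W' \<and> smooth_fun_on AN (\<phi> -` W \<inter> W') (\<lambda>p. h (\<phi> p))"
      using op[OF opU] Uc(2) by blast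
  qed
qed

section \<open>Frames and sections\<close>

lemma smooth_funs_imp_smooth_fun_on:
  "smooth_manifold A \<Longrightarrow> f \<in> smooth_funs A \<Longrightarrow> smooth_fun_on A W f"
  using smooth_fun_on_subset[of A UNIV f W] by simp

text \<open>Meaningful for \<open>i < n\<close> and for vectors in the span of a frame, where
  independence makes the choice unique; all other values are arbitrary.\<close>

definition frame_coord :: "nat \<Rightarrow> (nat \<Rightarrow> 'm \<Rightarrow> 'e::real_vector) \<Rightarrow> 'm \<Rightarrow> 'e \<Rightarrow> nat \<Rightarrow> real" where
  "frame_coord n s y v = (SOME c. v = (\<Sum>i<n. c i *\<^sub>R s i y))"

context
  fixes A :: "('m::{t2_space,second_countable_topology}, 'b::real_inner) atlas"
    and E :: "('m, 'e::real_vector) vbundle"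
  assumes A: "smooth_manifold A" and E: "vector_bundle A E"
begin

lemma fibre_subspace: "subspace (fibre E x)"
  using E by (simp add: vector_bundle_def)

lemma fibre_sum_scaleR:
  assumes "\<And>i. i \<in> I \<Longrightarrow> v i \<in> fibre E x"
  shows "(\<Sum>i\<in>I. c i *\<^sub>R v i) \<in> fibre E x"
  using assms fibre_subspace by (intro subspace_sum subspace_scale) auto

lemma frame_exists: "\<exists>U s. (U, s) \<in> frames E \<and> x \<in> U"
proof -
  have "x \<in> (\<Union>(U, s)\<in>frames E. U)" using E by (simp add: vector_bundle_def)
  then show ?thesis by auto
qed

lemma frame_open: "(U, s) \<in> frames E \<Longrightarrow> open U"
  using E by (auto simp: vector_bundle_def)

lemma frame_basis:
  assumes "(U, s) \<in> frames E" "x \<in> U"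
  shows "inj_on (\<lambda>i. s i x) {..<rank E}" "independent ((\<lambda>i. s i x) ` {..<rank E})"
    "span ((\<lambda>i. s i x) ` {..<rank E}) = fibre E x"
  using E assms unfolding vector_bundle_def by fast+

lemma frame_in_fibre:
  assumes "(U, s) \<in> frames E" "x \<in> U" "i < rank E"
  shows "s i x \<in> fibre E x"
  unfolding frame_basis(3)[OF assms(1,2), symmetric] by (rule span_base) (use assms(3) in auto)

lemma frame_coord_expand:
  assumes "(U, s) \<in> frames E" "x \<in> U" "v \<in> fibre E x"
  shows "(\<Sum>i<rank E. frame_coord (rank E) s x v i *\<^sub>R s i x) = v"
proof -
  have "v \<in> span ((\<lambda>i. s i x) ` {..<rank E})" using frame_basis(3)[OF assms(1,2)] assms(3) by simp
  then obtain u where "v = (\<Sum>w\<in>(\<lambda>i. s i x) ` {..<rank E}. u w *\<^sub>R w)"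
    by (auto simp: span_finite)
  then have "v = (\<Sum>i<rank E. u (s i x) *\<^sub>R s i x)"
    using sum.reindex[OF frame_basis(1)[OF assms(1,2)]] by simp
  then have "\<exists>c. v = (\<Sum>i<rank E. c i *\<^sub>R s i x)"
    by (intro exI[of _ "\<lambda>i. u (s i x)"])
  from someI_ex[OF this] show ?thesis unfolding frame_coord_def by simp
qed

lemma frame_coeff_unique:
  assumes "(U, s) \<in> frames E" "x \<in> U"
    "(\<Sum>i<rank E. c i *\<^sub>R s i x) = (\<Sum>i<rank E. d i *\<^sub>R s i x)" "i < rank E"
  shows "c i = d i"
proof -
  let ?f = "\<lambda>i. s i x" and ?I = "{..<rank E}"
  note inj = frame_basis(1)[OF assms(1,2)]
  \<comment> \<open>Independence is a statement about coefficients attached to vectors, so the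
    indexed coefficients are transported along the injective frame.\<close>
  define u where "u w = c (the_inv_into ?I ?f w) - d (the_inv_into ?I ?f w)" for w
  have u: "u (?f j) = c j - d j" if "j \<in> ?I" for j
    unfolding u_def by (simp add: the_inv_into_f_f[OF inj that])
  have "(\<Sum>w\<in>?f ` ?I. u w *\<^sub>R w) = (\<Sum>j<rank E. (c j - d j) *\<^sub>R s j x)"
    by (simp add: sum.reindex[OF inj] u)
  also have "\<dots> = 0" using assms(3) by (simp add: scaleR_diff_left sum_subtractf)
  finally have "u (?f i) = 0"
    using independentD[OF frame_basis(2)[OF assms(1,2)], of "?f ` ?I" u "?f i"] assms(4) by auto
  then show ?thesis using u assms(4) by simp
qed

lemma frame_coord_eqI:
  assumes "(U, s) \<in> frames E" "x \<in> U" "v = (\<Sum>i<rank E. c i *\<^sub>R s i x)" "i < rank E"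
  shows "frame_coord (rank E) s x v i = c i"
proof (rule frame_coeff_unique[OF assms(1,2) _ assms(4)])
  have "v \<in> fibre E x"
    unfolding assms(3) by (rule fibre_sum_scaleR) (use frame_in_fibre[OF assms(1,2)] in auto)
  then show "(\<Sum>i<rank E. frame_coord (rank E) s x v i *\<^sub>R s i x) = (\<Sum>i<rank E. c i *\<^sub>R s i x)"
    using frame_coord_expand[OF assms(1,2)] assms(3) by simp
qed

lemma frame_coord_add:
  assumes "(U, s) \<in> frames E" "x \<in> U" "v \<in> fibre E x" "w \<in> fibre E x" "i < rank E"
  shows "frame_coord (rank E) s x (v + w) i
    = frame_coord (rank E) s x v i + frame_coord (rank E) s x w i"
  by (rule frame_coord_eqI[OF assms(1,2) _ assms(5)])
    (simp add: scaleR_add_left sum.distrib frame_coord_expand[OF assms(1-3)]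
      frame_coord_expand[OF assms(1,2,4)])

lemma frame_coord_scaleR:
  assumes "(U, s) \<in> frames E" "x \<in> U" "v \<in> fibre E x" "i < rank E"
  shows "frame_coord (rank E) s x (r *\<^sub>R v) i = r * frame_coord (rank E) s x v i"
  by (rule frame_coord_eqI[OF assms(1,2) _ assms(4)])
    (simp add: frame_coord_expand[OF assms(1-3)] flip: scaleR_scaleR scaleR_sum_right)

lemma smooth_frame_coord_frame:
  assumes "(U, s) \<in> frames E" "(V, t) \<in> frames E" "i < rank E" "j < rank E"
  shows "smooth_fun_on A (U \<inter> V) (\<lambda>x. frame_coord (rank E) s x (t j x) i)"
proof -
  have "\<forall>(U, s)\<in>frames E. \<forall>(V, t)\<in>frames E. \<exists>g.
      (\<forall>i<rank E. \<forall>j<rank E. smooth_fun_on A (U \<inter> V) (g i j)) \<and>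
      (\<forall>x\<in>U \<inter> V. \<forall>j<rank E. t j x = (\<Sum>i<rank E. g i j x *\<^sub>R s i x))"
    using E unfolding vector_bundle_def by (elim conjE)
  from bspec[OF bspec[OF this assms(1), unfolded prod.case] assms(2), unfolded prod.case]
  obtain g where G: "\<forall>i<rank E. \<forall>j<rank E. smooth_fun_on A (U \<inter> V) (g i j)"
    "\<forall>x\<in>U \<inter> V. \<forall>j<rank E. t j x = (\<Sum>i<rank E. g i j x *\<^sub>R s i x)"
    by (elim exE conjE)
  have g: "smooth_fun_on A (U \<inter> V) (g i j)"
    "\<And>x. x \<in> U \<inter> V \<Longrightarrow> t j x = (\<Sum>i<rank E. g i j x *\<^sub>R s i x)"
    using G assms(3,4) by simp_all
  have "g i j x = frame_coord (rank E) s x (t j x) i" if "x \<in> U \<inter> V" for x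
    using frame_coord_eqI[OF assms(1) _ g(2)[OF that] assms(3)] that by simp
  then show ?thesis
    by (rule smooth_fun_on_cong[OF A _ _ g(1), rotated]) (use frame_open assms in auto)
qed

text \<open>Trades the existentially quantified coefficient functions of \<open>sections\<close> for
  canonical ones, which can be added and multiplied without new choices.\<close>

lemma sections_iff_frame_coord:
  "\<sigma> \<in> sections A E \<longleftrightarrow> (\<forall>x. \<sigma> x \<in> fibre E x) \<and>
    (\<forall>(U, s)\<in>frames E. \<forall>i<rank E. smooth_fun_on A U (\<lambda>x. frame_coord (rank E) s x (\<sigma> x) i))"
    (is "_ \<longleftrightarrow> ?L")
proof
  assume \<sigma>: "\<sigma> \<in> sections A E"
  have "smooth_fun_on A U (\<lambda>x. frame_coord (rank E) s x (\<sigma> x) i)"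
    if Us: "(U, s) \<in> frames E" and i: "i < rank E" for U s i
  proof -
    have "\<forall>(U, s)\<in>frames E. \<exists>a. (\<forall>i<rank E. smooth_fun_on A U (a i)) \<and>
        (\<forall>x\<in>U. \<sigma> x = (\<Sum>i<rank E. a i x *\<^sub>R s i x))"
      using \<sigma> by (simp add: sections_def)
    from bspec[OF this Us, unfolded prod.case]
    obtain a where a': "\<forall>i<rank E. smooth_fun_on A U (a i)"
      "\<forall>x\<in>U. \<sigma> x = (\<Sum>i<rank E. a i x *\<^sub>R s i x)" by (elim exE conjE)
    have a: "smooth_fun_on A U (a i)" "\<And>x. x \<in> U \<Longrightarrow> \<sigma> x = (\<Sum>i<rank E. a i x *\<^sub>R s i x)"
      using a' i by simp_all
    have "a i x = frame_coord (rank E) s x (\<sigma> x) i" if "x \<in> U" for x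
      using frame_coord_eqI[OF Us that a(2)[OF that] i] by simp
    then show ?thesis
      by (rule smooth_fun_on_cong[OF A _ _ a(1), rotated]) (use frame_open Us in auto)
  qed
  then show ?L using \<sigma> by (auto simp: sections_def)
next
  assume L: ?L
  have "\<exists>a. (\<forall>i<rank E. smooth_fun_on A U (a i)) \<and> (\<forall>x\<in>U. \<sigma> x = (\<Sum>i<rank E. a i x *\<^sub>R s i x))"
    if Us: "(U, s) \<in> frames E" for U s
    by (rule exI[of _ "\<lambda>i x. frame_coord (rank E) s x (\<sigma> x) i"])
      (use L Us frame_coord_expand[OF Us] in auto)
  then show "\<sigma> \<in> sections A E" using L by (auto simp: sections_def)
qed

lemma section_in_fibre: "\<sigma> \<in> sections A E \<Longrightarrow> \<sigma> x \<in> fibre E x"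
  by (simp add: sections_def)

lemma section_add:
  assumes "\<sigma> \<in> sections A E" "\<tau> \<in> sections A E"
  shows "(\<lambda>x. \<sigma> x + \<tau> x) \<in> sections A E"
  unfolding sections_iff_frame_coord
proof (intro conjI allI ballI, goal_cases)
  case (1 x)
  show ?case by (intro subspace_add[OF fibre_subspace] section_in_fibre assms)
next
  case (2 Us)
  have "smooth_fun_on A U (\<lambda>x. frame_coord (rank E) s x (\<sigma> x + \<tau> x) i)"
    if Us: "(U, s) \<in> frames E" and i: "i < rank E" for U s i
  proof (rule smooth_fun_on_cong[OF A frame_open[OF Us]])
    show "smooth_fun_on A U
        (\<lambda>x. frame_coord (rank E) s x (\<sigma> x) i + frame_coord (rank E) s x (\<tau> x) i)"
      using assms Us i frame_open unfolding sections_iff_frame_coord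
      by (intro smooth_fun_on_add[OF A]) auto
  qed (use assms Us i frame_coord_add section_in_fibre in auto)
  with 2 show ?case by auto
qed

lemma section_scaleR:
  assumes "f \<in> smooth_funs A" "\<sigma> \<in> sections A E"
  shows "(\<lambda>x. f x *\<^sub>R \<sigma> x) \<in> sections A E"
  unfolding sections_iff_frame_coord
proof (intro conjI allI ballI, goal_cases)
  case (1 x)
  show ?case by (intro subspace_scale[OF fibre_subspace] section_in_fibre assms)
next
  case (2 Us)
  have "smooth_fun_on A U (\<lambda>x. frame_coord (rank E) s x (f x *\<^sub>R \<sigma> x) i)"
    if Us: "(U, s) \<in> frames E" and i: "i < rank E" for U s i
  proof (rule smooth_fun_on_cong[OF A frame_open[OF Us]])
    show "smooth_fun_on A U (\<lambda>x. f x * frame_coord (rank E) s x (\<sigma> x) i)"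
      using assms Us i frame_open unfolding sections_iff_frame_coord
      by (intro smooth_fun_on_mult[OF A] smooth_funs_imp_smooth_fun_on[OF A assms(1)]) auto
  qed (use assms Us i frame_coord_scaleR section_in_fibre in auto)
  with 2 show ?case by auto
qed

lemma section_zero: "(\<lambda>x. 0) \<in> sections A E"
  unfolding sections_def using fibre_subspace A
  by (auto simp: subspace_0 intro!: exI[of _ "\<lambda>i x. 0"])

lemma section_sum_scaleR:
  assumes "\<And>i. i \<in> I \<Longrightarrow> f i \<in> smooth_funs A" "\<And>i. i \<in> I \<Longrightarrow> \<sigma> i \<in> sections A E"
  shows "(\<lambda>x. \<Sum>i\<in>I. f i x *\<^sub>R \<sigma> i x) \<in> sections A E"
  using assms
proof (induction I rule: infinite_finite_induct)
  case (insert i I)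
  then show ?case using section_add[OF section_scaleR] by simp
qed (auto simp: section_zero)

section \<open>Dual sections and local frames made global\<close>

lemma dual_section_zero: "\<mu> \<in> dual_sections A E \<Longrightarrow> v \<notin> fibre E x \<Longrightarrow> \<mu> x v = 0"
  by (simp add: dual_sections_def)

lemma dual_section_add:
  "\<mu> \<in> dual_sections A E \<Longrightarrow> v \<in> fibre E x \<Longrightarrow> w \<in> fibre E x \<Longrightarrow> \<mu> x (v + w) = \<mu> x v + \<mu> x w"
  by (simp add: dual_sections_def)

lemma dual_section_scaleR:
  "\<mu> \<in> dual_sections A E \<Longrightarrow> v \<in> fibre E x \<Longrightarrow> \<mu> x (r *\<^sub>R v) = r * \<mu> x v"
  by (simp add: dual_sections_def)

lemma dual_section_sum:
  assumes "\<mu> \<in> dual_sections A E" "\<And>i. i \<in> I \<Longrightarrow> v i \<in> fibre E x"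
  shows "\<mu> x (\<Sum>i\<in>I. c i *\<^sub>R v i) = (\<Sum>i\<in>I. c i * \<mu> x (v i))"
proof -
  have z: "\<mu> x 0 = 0"
    using dual_section_scaleR[OF assms(1), of 0 x 0] subspace_0[OF fibre_subspace] by simp
  show ?thesis
    using assms(2)
    by (induction I rule: infinite_finite_induct)
      (auto simp: z dual_section_add[OF assms(1)] dual_section_scaleR[OF assms(1)]
        fibre_sum_scaleR subspace_scale[OF fibre_subspace])
qed

lemma smooth_pairing:
  assumes \<mu>: "\<mu> \<in> dual_sections A E" and \<sigma>: "\<sigma> \<in> sections A E"
  shows "(\<lambda>x. \<mu> x (\<sigma> x)) \<in> smooth_funs A"
proof -
  have "smooth_fun_on A UNIV (\<lambda>x. \<mu> x (\<sigma> x))"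
  proof (rule smooth_fun_on_local[OF A])
    fix x
    obtain U s where Us: "(U, s) \<in> frames E" "x \<in> U" using frame_exists by blast
    have "smooth_fun_on A U (\<lambda>x. \<Sum>i<rank E. frame_coord (rank E) s x (\<sigma> x) i * \<mu> x (s i x))"
      using \<mu> \<sigma> Us frame_open unfolding sections_iff_frame_coord
      by (intro smooth_fun_on_sum[OF A] smooth_fun_on_mult[OF A]) (auto simp: dual_sections_def)
    moreover have "(\<Sum>i<rank E. frame_coord (rank E) s y (\<sigma> y) i * \<mu> y (s i y)) = \<mu> y (\<sigma> y)"
      if "y \<in> U" for y
    proof -
      have "(\<Sum>i<rank E. frame_coord (rank E) s y (\<sigma> y) i * \<mu> y (s i y))
        = \<mu> y (\<Sum>i<rank E. frame_coord (rank E) s y (\<sigma> y) i *\<^sub>R s i y)"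
        by (rule dual_section_sum[OF \<mu>, symmetric]) (use frame_in_fibre Us that in auto)
      then show ?thesis using frame_coord_expand[OF Us(1) that] section_in_fibre[OF \<sigma>] by simp
    qed
    ultimately have "smooth_fun_on A U (\<lambda>x. \<mu> x (\<sigma> x))"
      by (rule smooth_fun_on_cong[OF A frame_open[OF Us(1)], rotated])
    then show "\<exists>W'. open W' \<and> x \<in> W' \<and> smooth_fun_on A (UNIV \<inter> W') (\<lambda>x. \<mu> x (\<sigma> x))"
      using Us frame_open by auto
  qed auto
  then show ?thesis by simp
qed

lemma dual_section_scale:
  assumes "f \<in> smooth_funs A" "\<mu> \<in> dual_sections A E"
  shows "(\<lambda>x v. f x * \<mu> x v) \<in> dual_sections A E"
proof -
  have "smooth_fun_on A U (\<lambda>x. f x * \<mu> x (s i x))" if "(U, s) \<in> frames E" "i < rank E" for U s i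
    using assms that frame_open
    by (intro smooth_fun_on_mult[OF A] smooth_funs_imp_smooth_fun_on[OF A assms(1)]) (auto simp: dual_sections_def)
  then show ?thesis using assms(2) by (auto simp: dual_sections_def algebra_simps)
qed

lemma dual_section_plus:
  assumes "\<nu> \<in> dual_sections A E" "\<mu> \<in> dual_sections A E"
  shows "(\<lambda>x v. \<nu> x v + \<mu> x v) \<in> dual_sections A E"
proof -
  have "smooth_fun_on A U (\<lambda>x. \<nu> x (s i x) + \<mu> x (s i x))" if "(U, s) \<in> frames E" "i < rank E" for U s i
    using assms that frame_open by (intro smooth_fun_on_add[OF A]) (auto simp: dual_sections_def)
  then show ?thesis using assms by (auto simp: dual_sections_def algebra_simps)
qed

lemma dual_section_sum_scale:
  assumes "\<And>i. i \<in> I \<Longrightarrow> f i \<in> smooth_funs A" "\<And>i. i \<in> I \<Longrightarrow> \<mu> i \<in> dual_sections A E"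
  shows "(\<lambda>x v. \<Sum>i\<in>I. f i x * \<mu> i x v) \<in> dual_sections A E"
  using assms
proof (induction I rule: infinite_finite_induct)
  case (insert i I)
  then show ?case using dual_section_plus[OF dual_section_scale] by simp
qed (auto simp: dual_sections_def A)

text \<open>A frame and its coordinate functionals become global when cut off by the same bump
  function. Each contributes one factor \<open>\<theta>\<close>, hence the square in the expansion.
  The last clause gives access to the original coordinates wherever \<open>\<theta>\<close> is
  nonzero.\<close>

lemma local_dual_frame:
  assumes Us: "(U, s) \<in> frames E" and x: "x \<in> U"
  shows "\<exists>\<theta> e \<mu>. \<theta> \<in> smooth_funs A \<and> \<theta> x = 1 \<and>
    (\<forall>i<rank E. e i \<in> sections A E) \<and> (\<forall>i<rank E. \<mu> i \<in> dual_sections A E) \<and>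
    (\<forall>y. \<forall>v\<in>fibre E y. (\<theta> y)\<^sup>2 *\<^sub>R v = (\<Sum>i<rank E. \<mu> i y v *\<^sub>R e i y)) \<and>
    (\<forall>i<rank E. \<forall>y\<in>U. \<forall>v\<in>fibre E y. \<mu> i y v = \<theta> y * frame_coord (rank E) s y v i)"
proof -
  have opU: "open U" using frame_open[OF Us] .
  obtain \<theta> K where \<theta>: "smooth_fun_on A UNIV \<theta>" "\<theta> x = 1" "closed K" "K \<subseteq> U"
    "\<And>y. y \<notin> K \<Longrightarrow> \<theta> y = 0"
    using bump_function[OF A opU x] by metis
  define e where "e i y = (if y \<in> U then \<theta> y *\<^sub>R s i y else 0)" for i y
  define \<mu> where "\<mu> i y v = (if y \<in> U \<and> v \<in> fibre E y then \<theta> y * frame_coord (rank E) s y v i else 0)"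
    for i y v
  have s: "s i y \<in> fibre E y" if "i < rank E" "y \<in> U" for i y
    using frame_in_fibre Us that by blast
  have e: "e i \<in> sections A E" if i: "i < rank E" for i
    unfolding sections_iff_frame_coord
  proof (intro conjI allI ballI, goal_cases)
    case (1 y)
    show ?case using s[OF i] fibre_subspace by (auto simp: e_def subspace_0 subspace_scale)
  next
    case (2 Vt)
    have "smooth_fun_on A V (\<lambda>y. frame_coord (rank E) t y (e i y) j)"
      if Vt: "(V, t) \<in> frames E" and j: "j < rank E" for V t j
    proof (rule smooth_fun_on_cong[OF A frame_open[OF Vt]])
      show "smooth_fun_on A V
          (\<lambda>y. if y \<in> U then \<theta> y * frame_coord (rank E) t y (s i y) j else 0)"
        by (rule smooth_fun_on_bump_mult[OF A frame_open[OF Vt] opU \<theta>(3-5,1)])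
          (use smooth_frame_coord_frame[OF Vt Us j i] in \<open>auto simp: Int_commute\<close>)
      show "(if y \<in> U then \<theta> y * frame_coord (rank E) t y (s i y) j else 0)
          = frame_coord (rank E) t y (e i y) j" if "y \<in> V" for y
      proof (cases "y \<in> U")
        case True
        then show ?thesis using frame_coord_scaleR[OF Vt that s[OF i True] j] by (simp add: e_def)
      next
        case False
        then show ?thesis using frame_coord_eqI[OF Vt that _ j, of 0 "\<lambda>_. 0"] by (simp add: e_def)
      qed
    qed
    with 2 show ?case by auto
  qed
  have \<mu>: "\<mu> i \<in> dual_sections A E" if i: "i < rank E" for i
  proof -
    have "smooth_fun_on A V (\<lambda>y. \<mu> i y (t j y))"
      if Vt: "(V, t) \<in> frames E" and j: "j < rank E" for V t j
    proof (rule smooth_fun_on_cong[OF A frame_open[OF Vt]])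
      show "smooth_fun_on A V
          (\<lambda>y. if y \<in> U then \<theta> y * frame_coord (rank E) s y (t j y) i else 0)"
        by (rule smooth_fun_on_bump_mult[OF A frame_open[OF Vt] opU \<theta>(3-5,1)])
          (use smooth_frame_coord_frame[OF Us Vt i j] in auto)
    qed (use frame_in_fibre[OF Vt _ j] in \<open>auto simp: \<mu>_def\<close>)
    moreover have "\<mu> i y (v + w) = \<mu> i y v + \<mu> i y w" if "v \<in> fibre E y" "w \<in> fibre E y" for y v w
      using that subspace_add[OF fibre_subspace that] frame_coord_add[OF Us _ that i]
      by (auto simp: \<mu>_def algebra_simps)
    moreover have "\<mu> i y (r *\<^sub>R v) = r * \<mu> i y v" if "v \<in> fibre E y" for y v r
      using that subspace_scale[OF fibre_subspace that] frame_coord_scaleR[OF Us _ that i]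
      by (auto simp: \<mu>_def algebra_simps)
    ultimately show ?thesis by (auto simp: dual_sections_def \<mu>_def)
  qed
  have "(\<theta> y)\<^sup>2 *\<^sub>R v = (\<Sum>i<rank E. \<mu> i y v *\<^sub>R e i y)" if v: "v \<in> fibre E y" for y v
  proof (cases "y \<in> U")
    case True
    have "(\<Sum>i<rank E. \<mu> i y v *\<^sub>R e i y)
      = (\<Sum>i<rank E. (\<theta> y)\<^sup>2 *\<^sub>R (frame_coord (rank E) s y v i *\<^sub>R s i y))"
      using True v by (intro sum.cong) (auto simp: \<mu>_def e_def power2_eq_square)
    then show ?thesis
      by (simp only: scaleR_sum_right[symmetric] frame_coord_expand[OF Us True v])
  next
    case False
    then show ?thesis using \<theta>(4,5) by (auto simp: e_def)
  qed
  then show ?thesis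
    using \<theta>(1,2) e \<mu> by (intro exI[of _ \<theta>] exI[of _ e] exI[of _ \<mu>]) (auto simp: \<mu>_def)
qed

text \<open>
  The polynomial \<open>3t\<^sup>2 - 2t\<^sup>3\<close> is critical at \<open>t = 1\<close>, so every derivation at a point over \<open>x\<close>
  kills the weight on the left-hand side.
\<close>

lemma critical_dual_frame:
  "\<exists>\<theta> e \<mu>. \<theta> \<in> smooth_funs A \<and> \<theta> x = 1 \<and>
    (\<forall>i<rank E. e i \<in> sections A E) \<and> (\<forall>i<rank E. \<mu> i \<in> dual_sections A E) \<and>
    (\<forall>y. \<forall>v\<in>fibre E y. (3 * (\<theta> y)\<^sup>2 - 2 * (\<theta> y) ^ 3) *\<^sub>R v = (\<Sum>i<rank E. \<mu> i y v *\<^sub>R e i y))"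
proof -
  obtain U s where Us: "(U, s) \<in> frames E" "x \<in> U" using frame_exists by blast
  from local_dual_frame[OF Us]
  obtain \<theta> e \<mu> where \<theta>: "\<theta> \<in> smooth_funs A" "\<theta> x = 1"
    "\<forall>i<rank E. e i \<in> sections A E" "\<forall>i<rank E. \<mu> i \<in> dual_sections A E"
    "\<forall>y. \<forall>v\<in>fibre E y. (\<theta> y)\<^sup>2 *\<^sub>R v = (\<Sum>i<rank E. \<mu> i y v *\<^sub>R e i y)"
    by (elim exE conjE)
  \<comment> \<open>The expansion at hand has weight \<open>\<theta>\<^sup>2\<close>. With
    \<open>\<theta>' = \<theta>\<^sup>2\<close> the desired polynomial in \<open>\<theta>'\<close>
    factors as \<open>h\<close> times \<open>\<theta>\<^sup>2\<close>, and \<open>h\<close> can be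
    absorbed into the functionals.\<close>
  define \<theta>' where "\<theta>' y = \<theta> y * \<theta> y" for y
  define h where "h y = 3 * \<theta>' y - 2 * (\<theta>' y * \<theta>' y)" for y
  have \<theta>': "\<theta>' \<in> smooth_funs A"
    unfolding \<theta>'_def using \<theta>(1) by (auto intro: smooth_fun_on_mult[OF A])
  then have h: "h \<in> smooth_funs A"
    unfolding h_def by (auto intro!: smooth_fun_on_mult[OF A] smooth_fun_on_diff[OF A] smooth_fun_on_const[OF A])
  have "(3 * (\<theta>' y)\<^sup>2 - 2 * (\<theta>' y) ^ 3) *\<^sub>R v = (\<Sum>i<rank E. (h y * \<mu> i y v) *\<^sub>R e i y)"
    if "v \<in> fibre E y" for y v
  proof -
    have "3 * (\<theta>' y)\<^sup>2 - 2 * (\<theta>' y) ^ 3 = h y * (\<theta> y)\<^sup>2"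
      by (simp add: h_def \<theta>'_def power2_eq_square power3_eq_cube algebra_simps)
    then show ?thesis
      using \<theta>(5) that by (simp add: scaleR_sum_right flip: scaleR_scaleR)
  qed
  then show ?thesis
    using \<theta>' \<theta>(2,3) dual_section_scale[OF h] \<theta>(4)
    by (intro exI[of _ \<theta>'] exI[of _ e] exI[of _ "\<lambda>i y v. h y * \<mu> i y v"]) (auto simp: \<theta>'_def)
qed

end

section \<open>Pullback of bundles, sections and functionals\<close>

context
  fixes AM :: "('m::{t2_space,second_countable_topology}, 'b::real_inner) atlas"
    and E :: "('m, 'e::real_vector) vbundle"
    and AN :: "('n::{t2_space,second_countable_topology}, 'c::real_inner) atlas"
    and \<phi> :: "'n \<Rightarrow> 'm"
  assumes AM: "smooth_manifold AM" and E: "vector_bundle AM E"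
    and AN: "smooth_manifold AN" and \<phi>: "smooth_map AN AM \<phi>"
begin

lemma pullback_simps [simp]:
  "fibre (pullback_bundle \<phi> E) p = fibre E (\<phi> p)" "rank (pullback_bundle \<phi> E) = rank E"
  by (simp_all add: pullback_bundle_def)

lemma open_phi_vimage: "open X \<Longrightarrow> open (\<phi> -` X)"
  using \<phi> by (simp add: open_vimage smooth_map_def)

lemma vector_bundle_pullback: "vector_bundle AN (pullback_bundle \<phi> E)"
proof -
  have "\<exists>g. (\<forall>i<rank E. \<forall>j<rank E. smooth_fun_on AN (\<phi> -` U \<inter> \<phi> -` V) (g i j)) \<and>
      (\<forall>x\<in>\<phi> -` U \<inter> \<phi> -` V. \<forall>j<rank E. t j (\<phi> x) = (\<Sum>i<rank E. g i j x *\<^sub>R s i (\<phi> x)))"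
    if Us: "(U, s) \<in> frames E" and Vt: "(V, t) \<in> frames E" for U s V t
  proof -
    have "smooth_fun_on AN (\<phi> -` U \<inter> \<phi> -` V) (\<lambda>p. frame_coord (rank E) s (\<phi> p) (t j (\<phi> p)) i)"
      if "i < rank E" "j < rank E" for i j
      using smooth_fun_on_pullback[OF AM AN \<phi> _ smooth_frame_coord_frame[OF AM E Us Vt that]]
        frame_open[OF AM E] Us Vt by auto
    then show ?thesis
      using frame_coord_expand[OF AM E Us _ frame_in_fibre[OF AM E Vt]]
      by (intro exI[of _ "\<lambda>i j p. frame_coord (rank E) s (\<phi> p) (t j (\<phi> p)) i"]) auto
  qed
  note transition = this
  have frames: "X \<in> frames (pullback_bundle \<phi> E) \<longleftrightarrow>
      (\<exists>U s. X = (\<phi> -` U, \<lambda>i p. s i (\<phi> p)) \<and> (U, s) \<in> frames E)" for X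
    unfolding pullback_bundle_def vbundle.select_convs image_iff Bex_def split_paired_Ex prod.case
    by blast
  have "p \<in> (\<Union>(U, s)\<in>frames (pullback_bundle \<phi> E). U)" for p
  proof -
    obtain U s where "(U, s) \<in> frames E" "\<phi> p \<in> U" using frame_exists[OF AM E] by blast
    then show ?thesis
      by (intro UN_I[of "(\<phi> -` U, \<lambda>i p. s i (\<phi> p))"]) (auto simp: frames)
  qed
  then show ?thesis
    unfolding vector_bundle_def
  proof (intro conjI ballI allI, goal_cases)
    case (3 X)
    then obtain U s where X: "X = (\<phi> -` U, \<lambda>i p. s i (\<phi> p))" and Us: "(U, s) \<in> frames E"
      unfolding frames by (elim exE conjE)
    show ?case
      using open_phi_vimage[OF frame_open[OF AM E Us]] frame_basis[OF AM E Us] by (auto simp: X)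
  next
    case (4 X)
    then obtain U s where X: "X = (\<phi> -` U, \<lambda>i p. s i (\<phi> p))" and Us: "(U, s) \<in> frames E"
      unfolding frames by (elim exE conjE)
    show ?case
      unfolding X prod.case
    proof (intro ballI)
      fix Y assume "Y \<in> frames (pullback_bundle \<phi> E)"
      then obtain V t where Y: "Y = (\<phi> -` V, \<lambda>i p. t i (\<phi> p))" and Vt: "(V, t) \<in> frames E"
        unfolding frames by (elim exE conjE)
      show "case Y of (V, t) \<Rightarrow> \<exists>g. (\<forall>i<rank (pullback_bundle \<phi> E). \<forall>j<rank (pullback_bundle \<phi> E).
            smooth_fun_on AN (\<phi> -` U \<inter> V) (g i j)) \<and>
          (\<forall>x\<in>\<phi> -` U \<inter> V. \<forall>j<rank (pullback_bundle \<phi> E).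
            t j x = (\<Sum>i<rank (pullback_bundle \<phi> E). g i j x *\<^sub>R s i (\<phi> x)))"
        using transition[OF Us Vt] unfolding Y by simp
    qed
  qed (use fibre_subspace[OF AM E] in auto)
qed

lemma pullback_smooth_fun: "h \<in> smooth_funs AM \<Longrightarrow> (\<lambda>p. h (\<phi> p)) \<in> smooth_funs AN"
  using smooth_fun_on_pullback[OF AM AN \<phi> open_UNIV] by auto

lemma pullback_section:
  assumes "e \<in> sections AM E"
  shows "(\<lambda>p. e (\<phi> p)) \<in> sections AN (pullback_bundle \<phi> E)"
proof -
  have "\<exists>a. (\<forall>i<rank E. smooth_fun_on AN (\<phi> -` U) (a i)) \<and>
      (\<forall>p\<in>\<phi> -` U. e (\<phi> p) = (\<Sum>i<rank E. a i p *\<^sub>R s i (\<phi> p)))"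
    if "(U, s) \<in> frames E" for U s
  proof -
    have "\<forall>(U, s)\<in>frames E. \<exists>a. (\<forall>i<rank E. smooth_fun_on AM U (a i)) \<and>
        (\<forall>x\<in>U. e x = (\<Sum>i<rank E. a i x *\<^sub>R s i x))"
      using assms by (simp add: sections_def)
    from bspec[OF this that, unfolded prod.case]
    obtain a where "\<forall>i<rank E. smooth_fun_on AM U (a i)"
      "\<forall>x\<in>U. e x = (\<Sum>i<rank E. a i x *\<^sub>R s i x)" by (elim exE conjE)
    then show ?thesis
      using smooth_fun_on_pullback[OF AM AN \<phi> frame_open[OF AM E that]]
      by (intro exI[of _ "\<lambda>i p. a i (\<phi> p)"]) auto
  qed
  then show ?thesis
    using assms by (auto simp: sections_def pullback_bundle_def)
qed

lemma pullback_dual_section: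
  assumes "\<mu> \<in> dual_sections AM E"
  shows "(\<lambda>p. \<mu> (\<phi> p)) \<in> dual_sections AN (pullback_bundle \<phi> E)"
proof -
  have "smooth_fun_on AN (\<phi> -` U) (\<lambda>p. \<mu> (\<phi> p) (s i (\<phi> p)))"
    if "(U, s) \<in> frames E" "i < rank E" for U s i
    using smooth_fun_on_pullback[OF AM AN \<phi> frame_open[OF AM E that(1)], of "\<lambda>x. \<mu> x (s i x)"] assms that
    by (auto simp: dual_sections_def)
  then show ?thesis
    using assms by (auto simp: dual_sections_def pullback_bundle_def)
qed

text \<open>Functionals coming from \<open>M\<close> detect smoothness over \<open>N\<close>: over
  \<open>U\<close>, a functional of \<open>local_dual_frame\<close> is a coordinate times a weight,
  and the pulled-back weight is cancelled near the given point.\<close>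

lemma pullback_sectionI:
  assumes "\<And>p. \<sigma> p \<in> fibre E (\<phi> p)"
    "\<And>\<mu>. \<mu> \<in> dual_sections AM E \<Longrightarrow> (\<lambda>p. \<mu> (\<phi> p) (\<sigma> p)) \<in> smooth_funs AN"
  shows "\<sigma> \<in> sections AN (pullback_bundle \<phi> E)"
proof -
  have "smooth_fun_on AN (\<phi> -` U) (\<lambda>p. frame_coord (rank E) s (\<phi> p) (\<sigma> p) i)"
    if Us: "(U, s) \<in> frames E" and i: "i < rank E" for U s i
  proof (rule smooth_fun_on_cancel[OF AN])
    show op: "open (\<phi> -` U)" using open_phi_vimage frame_open[OF AM E Us] .
    fix p assume "p \<in> \<phi> -` U"
    then have p: "\<phi> p \<in> U" by simp
    from local_dual_frame[OF AM E Us p]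
    obtain \<theta> \<mu> where \<theta>: "\<theta> \<in> smooth_funs AM" "\<theta> (\<phi> p) = 1" and
      \<mu>: "\<forall>i<rank E. \<mu> i \<in> dual_sections AM E" and
      coord: "\<forall>i<rank E. \<forall>y\<in>U. \<forall>v\<in>fibre E y. \<mu> i y v = \<theta> y * frame_coord (rank E) s y v i"
      by (elim exE conjE)
    have "smooth_fun_on AN (\<phi> -` U) (\<lambda>p. \<mu> i (\<phi> p) (\<sigma> p))"
      using \<mu> i by (intro smooth_funs_imp_smooth_fun_on[OF AN assms(2)]) simp
    then have "smooth_fun_on AN (\<phi> -` U) (\<lambda>p. \<theta> (\<phi> p) * frame_coord (rank E) s (\<phi> p) (\<sigma> p) i)"
      by (rule smooth_fun_on_cong[OF AN op, rotated]) (use coord i assms(1) in auto)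
    then show "\<exists>\<theta>\<in>smooth_funs AN. \<theta> p \<noteq> 0 \<and>
        smooth_fun_on AN (\<phi> -` U) (\<lambda>x. \<theta> x * frame_coord (rank E) s (\<phi> x) (\<sigma> x) i)"
      using pullback_smooth_fun[OF \<theta>(1)] \<theta>(2) by (intro bexI[of _ "\<lambda>p. \<theta> (\<phi> p)"]) auto
  qed
  then have "\<exists>a. (\<forall>i<rank E. smooth_fun_on AN (\<phi> -` U) (a i)) \<and>
      (\<forall>p\<in>\<phi> -` U. \<sigma> p = (\<Sum>i<rank E. a i p *\<^sub>R s i (\<phi> p)))" if "(U, s) \<in> frames E" for U s
    using that frame_coord_expand[OF AM E that] assms(1)
    by (intro exI[of _ "\<lambda>i p. frame_coord (rank E) s (\<phi> p) (\<sigma> p) i"]) auto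
  then show ?thesis
    using assms(1) by (auto simp: sections_def pullback_bundle_def)
qed

end

section \<open>The Jacobi identity from generators\<close>

definition smul :: "('n \<Rightarrow> real) \<Rightarrow> ('n \<Rightarrow> 'e) \<Rightarrow> 'n \<Rightarrow> 'e::real_vector" (infixr "\<bullet>\<^sub>s" 75) where
  "f \<bullet>\<^sub>s \<sigma> = (\<lambda>p. f p *\<^sub>R \<sigma> p)"

lemma smul_apply: "(f \<bullet>\<^sub>s \<sigma>) p = f p *\<^sub>R \<sigma> p"
  by (simp add: smul_def)

lemmas pointwise = fun_eq_iff smul_apply plus_fun_apply minus_apply times_fun_apply zero_fun_apply
  scaleR_add_left scaleR_add_right scaleR_diff_left scaleR_diff_right

text \<open>The algebra of the problem without geometry: \<open>r \<sigma> f\<close> stands for the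
  anchor of \<open>\<sigma>\<close> applied to \<open>f\<close>, and
  \<open>a f \<sigma> \<tau>\<close> for the section a(df (x)
  \<open>\<sigma>\<close>)(\<open>\<tau>\<close>). Generation by \<open>G\<close> is demanded one
  point at a time, after multiplication by a weight that is 1 there.\<close>

locale loday_generators =
  fixes R :: "('n \<Rightarrow> real) set" and \<Gamma> G :: "('n \<Rightarrow> 'e::real_vector) set"
    and B :: "('n \<Rightarrow> 'e) \<Rightarrow> ('n \<Rightarrow> 'e) \<Rightarrow> 'n \<Rightarrow> 'e"
    and r :: "('n \<Rightarrow> 'e) \<Rightarrow> ('n \<Rightarrow> real) \<Rightarrow> 'n \<Rightarrow> real"
    and a :: "('n \<Rightarrow> real) \<Rightarrow> ('n \<Rightarrow> 'e) \<Rightarrow> ('n \<Rightarrow> 'e) \<Rightarrow> 'n \<Rightarrow> 'e"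
  assumes R_add [simp]: "\<lbrakk>f \<in> R; g \<in> R\<rbrakk> \<Longrightarrow> f + g \<in> R"
    and R_mult [simp]: "\<lbrakk>f \<in> R; g \<in> R\<rbrakk> \<Longrightarrow> f * g \<in> R"
    and \<Gamma>_add [simp]: "\<lbrakk>\<sigma> \<in> \<Gamma>; \<tau> \<in> \<Gamma>\<rbrakk> \<Longrightarrow> \<sigma> + \<tau> \<in> \<Gamma>"
    and \<Gamma>_diff [simp]: "\<lbrakk>\<sigma> \<in> \<Gamma>; \<tau> \<in> \<Gamma>\<rbrakk> \<Longrightarrow> \<sigma> - \<tau> \<in> \<Gamma>"
    and \<Gamma>_smul [simp]: "\<lbrakk>f \<in> R; \<sigma> \<in> \<Gamma>\<rbrakk> \<Longrightarrow> f \<bullet>\<^sub>s \<sigma> \<in> \<Gamma>"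
    and G_subset: "G \<subseteq> \<Gamma>"
    and G_generate: "\<sigma> \<in> \<Gamma> \<Longrightarrow> \<exists>\<psi>\<in>R. \<psi> p = 1 \<and>
      (\<exists>n c e. (\<forall>i<n. c i \<in> R) \<and> (\<forall>i<n. e i \<in> G) \<and> \<psi> \<bullet>\<^sub>s \<sigma> = (\<Sum>i<(n::nat). c i \<bullet>\<^sub>s e i))"
    and B_closed [simp]: "\<lbrakk>\<sigma> \<in> \<Gamma>; \<tau> \<in> \<Gamma>\<rbrakk> \<Longrightarrow> B \<sigma> \<tau> \<in> \<Gamma>"
    and r_closed [simp]: "\<lbrakk>\<sigma> \<in> \<Gamma>; f \<in> R\<rbrakk> \<Longrightarrow> r \<sigma> f \<in> R"
    and a_closed [simp]: "\<lbrakk>f \<in> R; \<sigma> \<in> \<Gamma>; \<tau> \<in> \<Gamma>\<rbrakk> \<Longrightarrow> a f \<sigma> \<tau> \<in> \<Gamma>"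
    and B_add_left [simp]: "\<lbrakk>\<sigma> \<in> \<Gamma>; \<sigma>' \<in> \<Gamma>; \<tau> \<in> \<Gamma>\<rbrakk> \<Longrightarrow> B (\<sigma> + \<sigma>') \<tau> = B \<sigma> \<tau> + B \<sigma>' \<tau>"
    and B_add_right [simp]: "\<lbrakk>\<sigma> \<in> \<Gamma>; \<tau> \<in> \<Gamma>; \<tau>' \<in> \<Gamma>\<rbrakk> \<Longrightarrow> B \<sigma> (\<tau> + \<tau>') = B \<sigma> \<tau> + B \<sigma> \<tau>'"
    and B_smul_right [simp]: "\<lbrakk>f \<in> R; \<sigma> \<in> \<Gamma>; \<tau> \<in> \<Gamma>\<rbrakk> \<Longrightarrow> B \<sigma> (f \<bullet>\<^sub>s \<tau>) = f \<bullet>\<^sub>s B \<sigma> \<tau> + r \<sigma> f \<bullet>\<^sub>s \<tau>"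
    and B_smul_left [simp]: "\<lbrakk>f \<in> R; \<sigma> \<in> \<Gamma>; \<tau> \<in> \<Gamma>\<rbrakk> \<Longrightarrow>
      B (f \<bullet>\<^sub>s \<sigma>) \<tau> = f \<bullet>\<^sub>s B \<sigma> \<tau> - r \<tau> f \<bullet>\<^sub>s \<sigma> + a f \<sigma> \<tau>"
    and r_add_left [simp]: "\<lbrakk>\<sigma> \<in> \<Gamma>; \<tau> \<in> \<Gamma>; f \<in> R\<rbrakk> \<Longrightarrow> r (\<sigma> + \<tau>) f = r \<sigma> f + r \<tau> f"
    and r_smul_left [simp]: "\<lbrakk>\<sigma> \<in> \<Gamma>; f \<in> R; g \<in> R\<rbrakk> \<Longrightarrow> r (g \<bullet>\<^sub>s \<sigma>) f = g * r \<sigma> f"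
    and r_add_right [simp]: "\<lbrakk>\<sigma> \<in> \<Gamma>; f \<in> R; g \<in> R\<rbrakk> \<Longrightarrow> r \<sigma> (f + g) = r \<sigma> f + r \<sigma> g"
    and r_mult_right [simp]: "\<lbrakk>\<sigma> \<in> \<Gamma>; f \<in> R; g \<in> R\<rbrakk> \<Longrightarrow> r \<sigma> (f * g) = f * r \<sigma> g + g * r \<sigma> f"
    and a_add1 [simp]: "\<lbrakk>f \<in> R; g \<in> R; \<sigma> \<in> \<Gamma>; \<tau> \<in> \<Gamma>\<rbrakk> \<Longrightarrow> a (f + g) \<sigma> \<tau> = a f \<sigma> \<tau> + a g \<sigma> \<tau>"
    and a_mult1 [simp]: "\<lbrakk>f \<in> R; g \<in> R; \<sigma> \<in> \<Gamma>; \<tau> \<in> \<Gamma>\<rbrakk> \<Longrightarrow>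
      a (f * g) \<sigma> \<tau> = f \<bullet>\<^sub>s a g \<sigma> \<tau> + g \<bullet>\<^sub>s a f \<sigma> \<tau>"
    and a_add2 [simp]: "\<lbrakk>f \<in> R; \<sigma> \<in> \<Gamma>; \<sigma>' \<in> \<Gamma>; \<tau> \<in> \<Gamma>\<rbrakk> \<Longrightarrow> a f (\<sigma> + \<sigma>') \<tau> = a f \<sigma> \<tau> + a f \<sigma>' \<tau>"
    and a_smul2 [simp]: "\<lbrakk>f \<in> R; g \<in> R; \<sigma> \<in> \<Gamma>; \<tau> \<in> \<Gamma>\<rbrakk> \<Longrightarrow> a f (g \<bullet>\<^sub>s \<sigma>) \<tau> = g \<bullet>\<^sub>s a f \<sigma> \<tau>"
    and a_add3 [simp]: "\<lbrakk>f \<in> R; \<sigma> \<in> \<Gamma>; \<tau> \<in> \<Gamma>; \<tau>' \<in> \<Gamma>\<rbrakk> \<Longrightarrow> a f \<sigma> (\<tau> + \<tau>') = a f \<sigma> \<tau> + a f \<sigma> \<tau>'"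
    and a_smul3 [simp]: "\<lbrakk>f \<in> R; g \<in> R; \<sigma> \<in> \<Gamma>; \<tau> \<in> \<Gamma>\<rbrakk> \<Longrightarrow> a f \<sigma> (g \<bullet>\<^sub>s \<tau>) = g \<bullet>\<^sub>s a f \<sigma> \<tau>"
    and jacobi_G: "\<lbrakk>e1 \<in> G; e2 \<in> G; e3 \<in> G\<rbrakk> \<Longrightarrow> B e1 (B e2 e3) = B (B e1 e2) e3 + B e2 (B e1 e3)"
    and r_B_G: "\<lbrakk>e1 \<in> G; e2 \<in> G; f \<in> R\<rbrakk> \<Longrightarrow> r (B e1 e2) f = r e1 (r e2 f) - r e2 (r e1 f)"
    and r_a_G: "\<lbrakk>e1 \<in> G; e2 \<in> G; f \<in> R; g \<in> R\<rbrakk> \<Longrightarrow> r (a f e1 e2) g = 0"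
    and compat1_G: "\<lbrakk>e1 \<in> G; e2 \<in> G; e3 \<in> G; f \<in> R\<rbrakk> \<Longrightarrow>
      a f e1 (B e2 e3) - B (a f e1 e2) e3 - B e2 (a f e1 e3) =
        a f (B e1 e2) e3 - a (r e2 f) e1 e3 - r e3 f \<bullet>\<^sub>s (B e1 e2 + B e2 e1)"
    and compat2_G: "\<lbrakk>e1 \<in> G; e2 \<in> G; e3 \<in> G; g \<in> R\<rbrakk> \<Longrightarrow>
      B e1 (a g e2 e3) = a g (B e1 e2) e3 + a (r e1 g) e2 e3 + a g e2 (B e1 e3)"
    and compat3_G: "\<lbrakk>e1 \<in> G; e2 \<in> G; e3 \<in> G; f \<in> R; g \<in> R\<rbrakk> \<Longrightarrow>
      a f e1 (a g e2 e3) - a g e2 (a f e1 e3) =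
        a g (a f e1 e2) e3 + r e1 g \<bullet>\<^sub>s a f e2 e3 - r e2 f \<bullet>\<^sub>s a g e1 e3 - r e3 f \<bullet>\<^sub>s a g e2 e1"
begin

section \<open>Extension of identities from generators to all sections\<close>

lemma G_in_\<Gamma> [simp]: "e \<in> G \<Longrightarrow> e \<in> \<Gamma>"
  using G_subset by blast

lemma \<Gamma>_zero: "\<sigma> \<in> \<Gamma> \<Longrightarrow> 0 \<in> \<Gamma>"
  using \<Gamma>_diff[of \<sigma> \<sigma>] by simp

text \<open>A multiple of \<open>\<sigma>\<close> by \<open>\<psi>\<close> is a combination of
  generators, so \<open>\<psi> \<bullet>\<^sub>s D \<sigma> = 0\<close>; evaluating where
  \<open>\<psi>\<close> is 1 gives the claim. Identities are extended by applying this to the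
  difference of their sides, one argument at a time.\<close>

lemma tensorial_zero:
  assumes add: "\<And>\<sigma> \<tau>. \<lbrakk>\<sigma> \<in> \<Gamma>; \<tau> \<in> \<Gamma>\<rbrakk> \<Longrightarrow> D (\<sigma> + \<tau>) = D \<sigma> + D \<tau>"
    and smul: "\<And>f \<sigma>. \<lbrakk>f \<in> R; \<sigma> \<in> \<Gamma>\<rbrakk> \<Longrightarrow> D (f \<bullet>\<^sub>s \<sigma>) = f \<bullet>\<^sub>s D \<sigma>"
    and G: "\<And>e. e \<in> G \<Longrightarrow> D e = 0"
    and \<sigma>: "\<sigma> \<in> \<Gamma>"
  shows "D \<sigma> = (0 :: 'n \<Rightarrow> 'v::real_vector)"
proof
  fix p
  obtain \<psi> n c e where \<psi>: "\<psi> \<in> R" "\<psi> p = 1" and c: "\<forall>i<n. c i \<in> R" and e: "\<forall>i<n. e i \<in> G"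
    and eq: "\<psi> \<bullet>\<^sub>s \<sigma> = (\<Sum>i<(n::nat). c i \<bullet>\<^sub>s e i)"
    using G_generate[OF \<sigma>, of p] by (elim bexE exE conjE)
  have D0: "D 0 = 0" using add[OF \<Gamma>_zero[OF \<sigma>] \<Gamma>_zero[OF \<sigma>]] by simp
  have "(\<Sum>i<m. c i \<bullet>\<^sub>s e i) \<in> \<Gamma> \<and> D (\<Sum>i<m. c i \<bullet>\<^sub>s e i) = 0" if "m \<le> n" for m
    using that
  proof (induction m)
    case (Suc m)
    have "c m \<bullet>\<^sub>s e m \<in> \<Gamma>" using Suc.prems c e by simp
    moreover have "D (c m \<bullet>\<^sub>s e m) = 0"
      using Suc.prems c e by (simp add: smul G) (simp add: pointwise)
    ultimately show ?case
      using Suc.IH[OF Suc_leD[OF Suc.prems]] by (auto simp only: sum.lessThan_Suc add \<Gamma>_add add_0_left)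
  qed (use D0 \<Gamma>_zero[OF \<sigma>] in simp)
  then have "D (\<psi> \<bullet>\<^sub>s \<sigma>) = 0" unfolding eq by blast
  then have "\<psi> \<bullet>\<^sub>s D \<sigma> = 0" using smul[OF \<psi>(1) \<sigma>] by simp
  then show "D \<sigma> p = 0 p" using \<psi>(2) by (metis scaleR_one smul_apply zero_fun_apply)
qed

lemma additive_diff:
  assumes "\<And>\<sigma> \<tau>. \<lbrakk>\<sigma> \<in> \<Gamma>; \<tau> \<in> \<Gamma>\<rbrakk> \<Longrightarrow> D (\<sigma> + \<tau>) = D \<sigma> + D \<tau>" "\<sigma> \<in> \<Gamma>" "\<tau> \<in> \<Gamma>"
  shows "D (\<sigma> - \<tau>) = (D \<sigma> - D \<tau> :: 'n \<Rightarrow> 'v::real_vector)"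
proof -
  have "D (\<sigma> - \<tau> + \<tau>) = D (\<sigma> - \<tau>) + D \<tau>" by (rule assms(1)) (use assms in auto)
  then show ?thesis by simp
qed

lemma diff_rules [simp]:
  assumes "\<sigma> \<in> \<Gamma>" "\<sigma>' \<in> \<Gamma>" "\<tau> \<in> \<Gamma>"
  shows "B (\<sigma> - \<sigma>') \<tau> = B \<sigma> \<tau> - B \<sigma>' \<tau>" "B \<tau> (\<sigma> - \<sigma>') = B \<tau> \<sigma> - B \<tau> \<sigma>'"
    "f \<in> R \<Longrightarrow> r (\<sigma> - \<sigma>') f = r \<sigma> f - r \<sigma>' f"
    "f \<in> R \<Longrightarrow> a f (\<sigma> - \<sigma>') \<tau> = a f \<sigma> \<tau> - a f \<sigma>' \<tau>"
    "f \<in> R \<Longrightarrow> a f \<tau> (\<sigma> - \<sigma>') = a f \<tau> \<sigma> - a f \<tau> \<sigma>'"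
  using assms additive_diff[of "\<lambda>\<sigma>. B \<sigma> \<tau>"] additive_diff[of "\<lambda>\<sigma>. B \<tau> \<sigma>"]
    additive_diff[of "\<lambda>\<sigma>. r \<sigma> f"] additive_diff[of "\<lambda>\<sigma>. a f \<sigma> \<tau>"] additive_diff[of "\<lambda>\<sigma>. a f \<tau> \<sigma>"]
  by simp_all

lemma r_a [simp]:
  assumes "\<sigma> \<in> \<Gamma>" "\<tau> \<in> \<Gamma>" "f \<in> R" "g \<in> R"
  shows "r (a f \<sigma> \<tau>) g = 0"
proof -
  have 1: "r (a f e \<tau>) g = 0" if "e \<in> G" for e
    by (rule tensorial_zero[of "\<lambda>\<tau>. r (a f e \<tau>) g"])
      (use assms that r_a_G in \<open>auto simp: pointwise\<close>)
  show ?thesis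
    by (rule tensorial_zero[of "\<lambda>\<sigma>. r (a f \<sigma> \<tau>) g", OF _ _ 1])
      (use assms in \<open>auto simp: pointwise\<close>)
qed

text \<open>In the first argument the Leibniz rule leaves \<open>r (a h \<sigma> \<tau>) f\<close>,
  which \<open>r_a\<close> kills; the remaining derivatives of \<open>h\<close> agree on both
  sides.\<close>

lemma r_B:
  assumes "\<sigma> \<in> \<Gamma>" "\<tau> \<in> \<Gamma>" "f \<in> R"
  shows "r (B \<sigma> \<tau>) f = r \<sigma> (r \<tau> f) - r \<tau> (r \<sigma> f)"
proof -
  define D where "D \<sigma> \<tau> = r (B \<sigma> \<tau>) f - (r \<sigma> (r \<tau> f) - r \<tau> (r \<sigma> f))" for \<sigma> \<tau>
  have 1: "D e \<tau> = 0" if "e \<in> G" for e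
    by (rule tensorial_zero[of "\<lambda>\<tau>. D e \<tau>"])
      (use assms that r_B_G in \<open>auto simp: D_def pointwise algebra_simps\<close>)
  have "D \<sigma> \<tau> = 0"
    by (rule tensorial_zero[of "\<lambda>\<sigma>. D \<sigma> \<tau>", OF _ _ 1])
      (use assms in \<open>auto simp: D_def pointwise algebra_simps\<close>)
  then show ?thesis by (simp add: D_def)
qed

lemma compat3:
  assumes "\<sigma> \<in> \<Gamma>" "\<tau> \<in> \<Gamma>" "\<omega> \<in> \<Gamma>" "f \<in> R" "g \<in> R"
  shows "a f \<sigma> (a g \<tau> \<omega>) - a g \<tau> (a f \<sigma> \<omega>) =
    a g (a f \<sigma> \<tau>) \<omega> + r \<sigma> g \<bullet>\<^sub>s a f \<tau> \<omega> - r \<tau> f \<bullet>\<^sub>s a g \<sigma> \<omega> - r \<omega> f \<bullet>\<^sub>s a g \<tau> \<sigma>"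
proof -
  define D where "D \<sigma> \<tau> \<omega> = a f \<sigma> (a g \<tau> \<omega>) - a g \<tau> (a f \<sigma> \<omega>) -
    (a g (a f \<sigma> \<tau>) \<omega> + r \<sigma> g \<bullet>\<^sub>s a f \<tau> \<omega> - r \<tau> f \<bullet>\<^sub>s a g \<sigma> \<omega> - r \<omega> f \<bullet>\<^sub>s a g \<tau> \<sigma>)" for \<sigma> \<tau> \<omega>
  have 0: "D e1 e2 e3 = 0" if e: "e1 \<in> G" "e2 \<in> G" "e3 \<in> G" for e1 e2 e3
    unfolding D_def compat3_G[OF e assms(4,5)] by simp
  have 1: "D e1 e2 \<omega> = 0" if "e1 \<in> G" "e2 \<in> G" for e1 e2
    by (rule tensorial_zero[of "\<lambda>\<omega>. D e1 e2 \<omega>", OF _ _ 0[OF that]])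
      (use assms that in \<open>auto simp: D_def pointwise algebra_simps\<close>)
  have 2: "D e1 \<tau> \<omega> = 0" if "e1 \<in> G" for e1
    by (rule tensorial_zero[of "\<lambda>\<tau>. D e1 \<tau> \<omega>", OF _ _ 1[OF that]])
      (use assms that in \<open>auto simp: D_def pointwise algebra_simps\<close>)
  have "D \<sigma> \<tau> \<omega> = 0"
    by (rule tensorial_zero[of "\<lambda>\<sigma>. D \<sigma> \<tau> \<omega>", OF _ _ 2])
      (use assms in \<open>auto simp: D_def pointwise algebra_simps\<close>)
  then show ?thesis by (simp add: D_def)
qed

text \<open>The left-hand side of \<open>compat3\<close> is a commutator. Adding the instance with
  \<open>(\<sigma>, f)\<close> and \<open>(\<tau>, g)\<close> exchanged cancels it together with the
  terms in \<open>r \<sigma> g\<close> and \<open>r \<tau> f\<close>.\<close>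

lemma a_a_swap:
  assumes "\<sigma> \<in> \<Gamma>" "\<tau> \<in> \<Gamma>" "\<omega> \<in> \<Gamma>" "f \<in> R" "g \<in> R"
  shows "a g (a f \<sigma> \<tau>) \<omega> + a f (a g \<tau> \<sigma>) \<omega> = r \<omega> f \<bullet>\<^sub>s a g \<tau> \<sigma> + r \<omega> g \<bullet>\<^sub>s a f \<sigma> \<tau>"
proof -
  have "(a f \<sigma> (a g \<tau> \<omega>) - a g \<tau> (a f \<sigma> \<omega>)) + (a g \<tau> (a f \<sigma> \<omega>) - a f \<sigma> (a g \<tau> \<omega>)) = 0"
    by simp
  then show ?thesis
    unfolding compat3[OF assms] compat3[OF assms(2,1,3,5,4)] by (simp add: algebra_simps)
qed

lemma compat2:
  assumes "\<sigma> \<in> \<Gamma>" "\<tau> \<in> \<Gamma>" "\<omega> \<in> \<Gamma>" "g \<in> R"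
  shows "B \<sigma> (a g \<tau> \<omega>) = a g (B \<sigma> \<tau>) \<omega> + a (r \<sigma> g) \<tau> \<omega> + a g \<tau> (B \<sigma> \<omega>)"
proof -
  define D where "D \<sigma> \<tau> \<omega> = B \<sigma> (a g \<tau> \<omega>)
    - (a g (B \<sigma> \<tau>) \<omega> + a (r \<sigma> g) \<tau> \<omega> + a g \<tau> (B \<sigma> \<omega>))" for \<sigma> \<tau> \<omega>
  have 1: "D e1 e2 \<omega> = 0" if "e1 \<in> G" "e2 \<in> G" for e1 e2
    by (rule tensorial_zero[of "\<lambda>\<omega>. D e1 e2 \<omega>"])
      (use assms that compat2_G in \<open>auto simp: D_def pointwise algebra_simps\<close>)
  have 2: "D e1 \<tau> \<omega> = 0" if "e1 \<in> G" for e1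
    by (rule tensorial_zero[of "\<lambda>\<tau>. D e1 \<tau> \<omega>", OF _ _ 1[OF that]])
      (use assms that in \<open>auto simp: D_def pointwise algebra_simps\<close>)
  have "D \<sigma> \<tau> \<omega> = 0"
  proof (rule tensorial_zero[of "\<lambda>\<sigma>. D \<sigma> \<tau> \<omega>", OF _ _ 2])
    fix h \<sigma> assume h: "h \<in> R" "\<sigma> \<in> \<Gamma>"
    \<comment> \<open>The terms in which \<open>h\<close> is differentiated are those of the third
      condition with \<open>f = h\<close>, up to \<open>r (a g \<tau> \<omega>) h\<close>, which is
      zero by \<open>r_a\<close>.\<close>
    show "D (h \<bullet>\<^sub>s \<sigma>) \<tau> \<omega> = h \<bullet>\<^sub>s D \<sigma> \<tau> \<omega>"
      using compat3[OF h(2) assms(2,3) h(1) assms(4)] assms h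
      by (simp add: D_def) (simp add: pointwise algebra_simps)
  qed (use assms in \<open>auto simp: D_def pointwise algebra_simps\<close>)
  then show ?thesis by (simp add: D_def)
qed

text \<open>
  Given the second compatibility condition, the first one is equivalent to the following identity,
  which is symmetric in \<open>e1\<close> and \<open>e2\<close> on the right-hand side.
\<close>

lemma B_a_G:
  assumes "e1 \<in> G" "e2 \<in> G" "e3 \<in> G" "f \<in> R"
  shows "B (a f e1 e2) e3 = r e3 f \<bullet>\<^sub>s (B e1 e2 + B e2 e1) - a f (B e1 e2 + B e2 e1) e3"
  using compat1_G[OF assms] compat2_G[OF assms(2,1,3,4)] assms
  by (simp add: pointwise algebra_simps)

text \<open>Obtained by comparing both sides of the previous identity on a product \<open>f h\<close>.\<close>

lemma a_a_symmetric:
  assumes "\<sigma> \<in> \<Gamma>" "\<tau> \<in> \<Gamma>" "\<omega> \<in> \<Gamma>" "f \<in> R" "h \<in> R"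
  shows "a f (a h \<sigma> \<tau>) \<omega> + a h (a f \<sigma> \<tau>) \<omega> = r \<omega> f \<bullet>\<^sub>s a h \<sigma> \<tau> + r \<omega> h \<bullet>\<^sub>s a f \<sigma> \<tau>"
proof -
  define D where "D \<sigma> \<tau> \<omega> = a f (a h \<sigma> \<tau>) \<omega> + a h (a f \<sigma> \<tau>) \<omega>
    - (r \<omega> f \<bullet>\<^sub>s a h \<sigma> \<tau> + r \<omega> h \<bullet>\<^sub>s a f \<sigma> \<tau>)" for \<sigma> \<tau> \<omega>
  have 0: "D e1 e2 e3 = 0" if e: "e1 \<in> G" "e2 \<in> G" "e3 \<in> G" for e1 e2 e3
  proof -
    have "B (a (f * h) e1 e2) e3 = f \<bullet>\<^sub>s B (a h e1 e2) e3 - r e3 f \<bullet>\<^sub>s a h e1 e2 + a f (a h e1 e2) e3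
      + (h \<bullet>\<^sub>s B (a f e1 e2) e3 - r e3 h \<bullet>\<^sub>s a f e1 e2 + a h (a f e1 e2) e3)"
      using assms e by simp
    then show ?thesis
      unfolding B_a_G[OF e R_mult[OF assms(4,5)]] B_a_G[OF e assms(4)] B_a_G[OF e assms(5)]
      using assms e by (simp add: D_def) (simp add: pointwise algebra_simps)
  qed
  have 1: "D e1 e2 \<omega> = 0" if "e1 \<in> G" "e2 \<in> G" for e1 e2
    by (rule tensorial_zero[of "\<lambda>\<omega>. D e1 e2 \<omega>", OF _ _ 0[OF that]])
      (use assms that in \<open>auto simp: D_def pointwise algebra_simps\<close>)
  have 2: "D e1 \<tau> \<omega> = 0" if "e1 \<in> G" for e1
    by (rule tensorial_zero[of "\<lambda>\<tau>. D e1 \<tau> \<omega>", OF _ _ 1[OF that]])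
      (use assms that in \<open>auto simp: D_def pointwise algebra_simps\<close>)
  have "D \<sigma> \<tau> \<omega> = 0"
    by (rule tensorial_zero[of "\<lambda>\<sigma>. D \<sigma> \<tau> \<omega>", OF _ _ 2])
      (use assms in \<open>auto simp: D_def pointwise algebra_simps\<close>)
  then show ?thesis by (simp add: D_def)
qed

text \<open>Anchor terms cancel in the symmetrised bracket: besides the factor \<open>h\<close> it
  acquires only \<open>a h \<sigma> \<tau>\<close> when \<open>\<sigma>\<close> is multiplied by
  \<open>h\<close>, and only \<open>a h \<tau> \<sigma>\<close> when \<open>\<tau>\<close> is. The
  defect of homogeneity is then \<open>a_a_symmetric\<close> in the first argument and
  \<open>a_a_swap\<close> in the second.\<close>

lemma B_a:
  assumes "\<sigma> \<in> \<Gamma>" "\<tau> \<in> \<Gamma>" "\<omega> \<in> \<Gamma>" "f \<in> R"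
  shows "B (a f \<sigma> \<tau>) \<omega> = r \<omega> f \<bullet>\<^sub>s (B \<sigma> \<tau> + B \<tau> \<sigma>) - a f (B \<sigma> \<tau> + B \<tau> \<sigma>) \<omega>"
proof -
  define D where "D \<sigma> \<tau> \<omega> = B (a f \<sigma> \<tau>) \<omega>
    - (r \<omega> f \<bullet>\<^sub>s (B \<sigma> \<tau> + B \<tau> \<sigma>) - a f (B \<sigma> \<tau> + B \<tau> \<sigma>) \<omega>)" for \<sigma> \<tau> \<omega>
  have 0: "D e1 e2 e3 = 0" if e: "e1 \<in> G" "e2 \<in> G" "e3 \<in> G" for e1 e2 e3
    unfolding D_def B_a_G[OF e assms(4)] by simp
  have 1: "D e1 e2 \<omega> = 0" if "e1 \<in> G" "e2 \<in> G" for e1 e2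
    by (rule tensorial_zero[of "\<lambda>\<omega>. D e1 e2 \<omega>", OF _ _ 0[OF that]])
      (use assms that in \<open>auto simp: D_def pointwise algebra_simps\<close>)
  have 2: "D e1 \<tau> \<omega> = 0" if e1: "e1 \<in> G" for e1
  proof (rule tensorial_zero[of "\<lambda>\<tau>. D e1 \<tau> \<omega>", OF _ _ 1[OF e1]])
    fix h \<tau> assume h: "h \<in> R" "\<tau> \<in> \<Gamma>"
    show "D e1 (h \<bullet>\<^sub>s \<tau>) \<omega> = h \<bullet>\<^sub>s D e1 \<tau> \<omega>"
      using a_a_swap[OF G_in_\<Gamma>[OF e1] h(2) assms(3,4) h(1)] assms h e1
      by (simp add: D_def) (simp add: pointwise algebra_simps)
  qed (use assms e1 in \<open>auto simp: D_def pointwise algebra_simps\<close>)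
  have "D \<sigma> \<tau> \<omega> = 0"
  proof (rule tensorial_zero[of "\<lambda>\<sigma>. D \<sigma> \<tau> \<omega>", OF _ _ 2])
    fix h \<sigma> assume h: "h \<in> R" "\<sigma> \<in> \<Gamma>"
    show "D (h \<bullet>\<^sub>s \<sigma>) \<tau> \<omega> = h \<bullet>\<^sub>s D \<sigma> \<tau> \<omega>"
      using a_a_symmetric[OF h(2) assms(2,3,4) h(1)] assms h
      by (simp add: D_def) (simp add: pointwise algebra_simps)
  qed (use assms in \<open>auto simp: D_def pointwise algebra_simps\<close>)
  then show ?thesis by (simp add: D_def)
qed

lemma B_symmetric_part:
  assumes "\<sigma> \<in> \<Gamma>" "\<tau> \<in> \<Gamma>" "\<omega> \<in> \<Gamma>"
  shows "B (B \<sigma> \<tau> + B \<tau> \<sigma>) \<omega> = 0"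
proof -
  define D where "D \<sigma> \<tau> \<omega> = B (B \<sigma> \<tau> + B \<tau> \<sigma>) \<omega>" for \<sigma> \<tau> \<omega>
  have sym: "D \<sigma> \<tau> \<omega> = D \<tau> \<sigma> \<omega>" for \<sigma> \<tau> \<omega> by (simp add: D_def add.commute)
  \<comment> \<open>Symmetrising \<open>h \<bullet>\<^sub>s \<sigma>\<close> and
    \<open>\<tau>\<close> gives \<open>h\<close> times the symmetrised bracket plus
    \<open>a h \<sigma> \<tau>\<close>. By \<open>B_a\<close> the bracket of the latter with
    \<open>\<omega>\<close> cancels the Leibniz terms of the former.\<close>
  have smul: "D (h \<bullet>\<^sub>s \<sigma>) \<tau> \<omega> = h \<bullet>\<^sub>s D \<sigma> \<tau> \<omega>"
    if "h \<in> R" "\<sigma> \<in> \<Gamma>" "\<tau> \<in> \<Gamma>" "\<omega> \<in> \<Gamma>" for h \<sigma> \<tau> \<omega>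
    using B_a[OF that(2-4,1)] that by (simp add: D_def) (simp add: pointwise algebra_simps)
  have add: "D (\<sigma> + \<sigma>') \<tau> \<omega> = D \<sigma> \<tau> \<omega> + D \<sigma>' \<tau> \<omega>"
    if "\<sigma> \<in> \<Gamma>" "\<sigma>' \<in> \<Gamma>" "\<tau> \<in> \<Gamma>" "\<omega> \<in> \<Gamma>" for \<sigma> \<sigma>' \<tau> \<omega>
    using that by (simp add: D_def algebra_simps)
  \<comment> \<open>The Jacobi identities for \<open>(e1, e2, e3)\<close> and
    \<open>(e2, e1, e3)\<close> contain the same nested terms on opposite sides; adding them leaves
    the bracket with the symmetric part.\<close>
  have 0: "D e1 e2 e3 = 0" if e: "e1 \<in> G" "e2 \<in> G" "e3 \<in> G" for e1 e2 e3
    using jacobi_G[OF e] jacobi_G[OF e(2,1,3)] e by (simp add: D_def)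
  \<comment> \<open>By \<open>r_B\<close> the anchor of a symmetrised bracket vanishes, so the right
    Leibniz rule contributes no extra term.\<close>
  have 1: "D e1 e2 \<omega> = 0" if "e1 \<in> G" "e2 \<in> G" for e1 e2
    by (rule tensorial_zero[of "\<lambda>\<omega>. D e1 e2 \<omega>", OF _ _ 0[OF that]])
      (use assms that in \<open>auto simp: D_def r_B pointwise algebra_simps\<close>)
  have 2: "D e1 \<tau> \<omega> = 0" if e1: "e1 \<in> G" for e1
    by (rule tensorial_zero[of "\<lambda>\<tau>. D e1 \<tau> \<omega>", OF _ _ 1[OF e1]])
      (use assms e1 in \<open>auto simp: sym[of e1] smul add\<close>)
  have "D \<sigma> \<tau> \<omega> = 0"
    by (rule tensorial_zero[of "\<lambda>\<sigma>. D \<sigma> \<tau> \<omega>", OF _ _ 2]) (use assms in \<open>auto simp: smul add\<close>)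
  then show ?thesis by (simp add: D_def)
qed

lemma jacobi:
  assumes "\<sigma> \<in> \<Gamma>" "\<tau> \<in> \<Gamma>" "\<omega> \<in> \<Gamma>"
  shows "B \<sigma> (B \<tau> \<omega>) = B (B \<sigma> \<tau>) \<omega> + B \<tau> (B \<sigma> \<omega>)"
proof -
  define D where "D \<sigma> \<tau> \<omega> = B \<sigma> (B \<tau> \<omega>) - (B (B \<sigma> \<tau>) \<omega> + B \<tau> (B \<sigma> \<omega>))" for \<sigma> \<tau> \<omega>
  have skew: "D \<sigma> \<tau> \<omega> = - D \<tau> \<sigma> \<omega>" if "\<sigma> \<in> \<Gamma>" "\<tau> \<in> \<Gamma>" "\<omega> \<in> \<Gamma>" for \<sigma> \<tau> \<omega>
    using B_symmetric_part[OF that] that by (simp add: D_def) (simp add: neg_eq_iff_add_eq_0 algebra_simps)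
  \<comment> \<open>The four extra terms containing \<open>a\<close> cancel by
    \<open>compat2\<close> with \<open>g = h\<close>, and the anchor terms by
    \<open>r_B\<close>.\<close>
  have smul2: "D \<sigma> (h \<bullet>\<^sub>s \<tau>) \<omega> = h \<bullet>\<^sub>s D \<sigma> \<tau> \<omega>"
    if "h \<in> R" "\<sigma> \<in> \<Gamma>" "\<tau> \<in> \<Gamma>" "\<omega> \<in> \<Gamma>" for h \<sigma> \<tau> \<omega>
    using that by (simp add: D_def compat2 r_B) (simp add: pointwise algebra_simps)
  have add2: "D \<sigma> (\<tau> + \<tau>') \<omega> = D \<sigma> \<tau> \<omega> + D \<sigma> \<tau>' \<omega>"
    if "\<sigma> \<in> \<Gamma>" "\<tau> \<in> \<Gamma>" "\<tau>' \<in> \<Gamma>" "\<omega> \<in> \<Gamma>" for \<sigma> \<tau> \<tau>' \<omega>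
    using that by (simp add: D_def algebra_simps)
  have 0: "D e1 e2 e3 = 0" if e: "e1 \<in> G" "e2 \<in> G" "e3 \<in> G" for e1 e2 e3
    using jacobi_G[OF e] by (simp add: D_def)
  have 1: "D e1 e2 \<omega> = 0" if "e1 \<in> G" "e2 \<in> G" for e1 e2
    by (rule tensorial_zero[of "\<lambda>\<omega>. D e1 e2 \<omega>", OF _ _ 0[OF that]])
      (use assms that in \<open>auto simp: D_def r_B pointwise algebra_simps\<close>)
  have 2: "D e1 \<tau> \<omega> = 0" if e1: "e1 \<in> G" for e1
    by (rule tensorial_zero[of "\<lambda>\<tau>. D e1 \<tau> \<omega>", OF _ _ 1[OF e1]])
      (use assms e1 in \<open>auto simp: smul2 add2\<close>)
  \<comment> \<open>Homogeneity in the first argument is borrowed from the second through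
    skewness.\<close>
  have smul1: "D (h \<bullet>\<^sub>s \<sigma>) \<tau> \<omega> = h \<bullet>\<^sub>s D \<sigma> \<tau> \<omega>" if "h \<in> R" "\<sigma> \<in> \<Gamma>" for h \<sigma>
    using skew[of "h \<bullet>\<^sub>s \<sigma>" \<tau> \<omega>] skew[of \<sigma> \<tau> \<omega>] smul2[of h \<tau> \<sigma> \<omega>] that assms by (simp add: pointwise)
  have "D \<sigma> \<tau> \<omega> = 0"
  proof (rule tensorial_zero[of "\<lambda>\<sigma>. D \<sigma> \<tau> \<omega>", OF _ smul1 2])
    show "D (\<sigma> + \<sigma>') \<tau> \<omega> = D \<sigma> \<tau> \<omega> + D \<sigma>' \<tau> \<omega>" if "\<sigma> \<in> \<Gamma>" "\<sigma>' \<in> \<Gamma>" for \<sigma> \<sigma>'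
      using that assms by (simp add: D_def algebra_simps)
  qed (use assms in auto)
  then show ?thesis by (simp add: D_def)
qed

end

section \<open>Tangent vectors\<close>

lemma tangent_add:
  "v \<in> tangent_space A x \<Longrightarrow> smooth_fun_on A UNIV f \<Longrightarrow> smooth_fun_on A UNIV g \<Longrightarrow>
    v (\<lambda>y. f y + g y) = v f + v g"
  by (simp add: tangent_space_def)

lemma tangent_mult:
  "v \<in> tangent_space A x \<Longrightarrow> smooth_fun_on A UNIV f \<Longrightarrow> smooth_fun_on A UNIV g \<Longrightarrow>
    v (\<lambda>y. f y * g y) = f x * v g + g x * v f"
  by (simp add: tangent_space_def)

lemma tangent_scale:
  "v \<in> tangent_space A x \<Longrightarrow> smooth_fun_on A UNIV f \<Longrightarrow> v (\<lambda>y. c * f y) = c * v f"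
  by (simp add: tangent_space_def)

lemma tangent_not_smooth: "v \<in> tangent_space A x \<Longrightarrow> \<not> smooth_fun_on A UNIV f \<Longrightarrow> v f = 0"
  by (simp add: tangent_space_def)

lemma tangent_const:
  assumes "smooth_manifold A" "v \<in> tangent_space A x"
  shows "v (\<lambda>y. c) = 0"
proof -
  have "v (\<lambda>y. 1 * 1) = 1 * v (\<lambda>y. 1) + 1 * v (\<lambda>y. 1)"
    by (rule tangent_mult[OF assms(2)]) (simp_all add: assms(1))
  then have "v (\<lambda>y. 1) = 0" by simp
  then show ?thesis
    using tangent_scale[OF assms(2) smooth_fun_on_const[OF assms(1), of _ 1], of c] by simp
qed

lemma tangent_space_add:
  "v \<in> tangent_space A x \<Longrightarrow> w \<in> tangent_space A x \<Longrightarrow> (\<lambda>f. v f + w f) \<in> tangent_space A x"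
  by (simp add: tangent_space_def algebra_simps)

lemma tangent_space_scale:
  "v \<in> tangent_space A x \<Longrightarrow> (\<lambda>f. r * v f) \<in> tangent_space A x"
  by (simp add: tangent_space_def algebra_simps)

lemma tangent_space_zero: "(\<lambda>f. 0) \<in> tangent_space A x"
  by (simp add: tangent_space_def)

lemma tangent_space_sum:
  assumes "\<And>i. i \<in> I \<Longrightarrow> v i \<in> tangent_space A x"
  shows "(\<lambda>f. \<Sum>i\<in>I. c i * v i f) \<in> tangent_space A x"
  using assms
proof (induction I rule: infinite_finite_induct)
  case (insert i I)
  have "(\<lambda>f. c i * v i f + (\<Sum>i\<in>I. c i * v i f)) \<in> tangent_space A x"
    using insert by (intro tangent_space_add tangent_space_scale) auto
  then show ?case using insert by simp
qed (simp_all add: tangent_space_zero)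

lemma cotangent_add:
  "\<eta> \<in> cotangent_space A x \<Longrightarrow> v \<in> tangent_space A x \<Longrightarrow> w \<in> tangent_space A x \<Longrightarrow>
    \<eta> (\<lambda>f. v f + w f) = \<eta> v + \<eta> w"
  by (simp add: cotangent_space_def)

lemma cotangent_scale:
  "\<eta> \<in> cotangent_space A x \<Longrightarrow> v \<in> tangent_space A x \<Longrightarrow> \<eta> (\<lambda>f. r * v f) = r * \<eta> v"
  by (simp add: cotangent_space_def)

lemma cotangent_sum:
  assumes \<eta>: "\<eta> \<in> cotangent_space A x" and "\<And>i. i \<in> I \<Longrightarrow> v i \<in> tangent_space A x"
  shows "\<eta> (\<lambda>f. \<Sum>i\<in>I. c i * v i f) = (\<Sum>i\<in>I. c i * \<eta> (v i))"
proof -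
  have z: "\<eta> (\<lambda>f. 0) = 0"
    using cotangent_scale[OF \<eta> tangent_space_zero, of 0] by simp
  show ?thesis using assms(2)
  proof (induction I rule: infinite_finite_induct)
    case (insert i I)
    have "\<eta> (\<lambda>f. c i * v i f + (\<Sum>i\<in>I. c i * v i f))
        = \<eta> (\<lambda>f. c i * v i f) + \<eta> (\<lambda>f. \<Sum>i\<in>I. c i * v i f)"
      using insert.prems
      by (intro cotangent_add[OF \<eta>] tangent_space_scale tangent_space_sum) auto
    then show ?case using insert cotangent_scale[OF \<eta>] by simp
  qed (simp_all add: z)
qed

lemma cotangent_space_add:
  "\<eta> \<in> cotangent_space A x \<Longrightarrow> \<zeta> \<in> cotangent_space A x \<Longrightarrow> (\<lambda>v. \<eta> v + \<zeta> v) \<in> cotangent_space A x"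
  by (simp add: cotangent_space_def algebra_simps)

lemma cotangent_space_scale:
  "\<eta> \<in> cotangent_space A x \<Longrightarrow> (\<lambda>v. r * \<eta> v) \<in> cotangent_space A x"
  by (simp add: cotangent_space_def algebra_simps)

lemma differential_cotangent: "differential A f x \<in> cotangent_space A x"
  by (auto simp: cotangent_space_def differential_def tangent_space_add tangent_space_scale)

lemma differential_apply: "v \<in> tangent_space A x \<Longrightarrow> differential A f x v = v f"
  by (simp add: differential_def)

lemma vector_field_tangent: "X \<in> vector_fields A \<Longrightarrow> X p \<in> tangent_space A p"
  by (simp add: vector_fields_def)

lemma vector_field_smooth:
  "X \<in> vector_fields A \<Longrightarrow> smooth_fun_on A UNIV f \<Longrightarrow> smooth_fun_on A UNIV (\<lambda>p. X p f)"
  by (simp add: vector_fields_def)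

lemma differential_one_form:
  assumes "smooth_fun_on A UNIV f"
  shows "differential A f \<in> one_forms A"
proof -
  have "(\<lambda>x. differential A f x (X x)) = (\<lambda>x. X x f)" if "X \<in> vector_fields A" for X
    using differential_apply[OF vector_field_tangent[OF that]] by auto
  then show ?thesis
    by (simp add: one_forms_def differential_cotangent vector_field_smooth assms)
qed

section \<open>The algebroid of an action\<close>

locale action =
  fixes AM :: "('m::{t2_space,second_countable_topology}, 'b::real_inner) atlas"
    and E :: "('m, 'e::real_vector) vbundle"
    and br :: "('m \<Rightarrow> 'e) \<Rightarrow> ('m \<Rightarrow> 'e) \<Rightarrow> 'm \<Rightarrow> 'e"
    and \<rho> :: "'m \<Rightarrow> 'e \<Rightarrow> 'm tvec"
    and \<alpha> :: "'m \<Rightarrow> 'm covec \<Rightarrow> 'e \<Rightarrow> 'e \<Rightarrow> 'e"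
    and AN :: "('n::{t2_space,second_countable_topology}, 'c::real_inner) atlas"
    and \<phi> :: "'n \<Rightarrow> 'm"
    and \<rho>' :: "('m \<Rightarrow> 'e) \<Rightarrow> 'n \<Rightarrow> 'n tvec"
    and aT :: "('m \<Rightarrow> 'e) \<Rightarrow> ('m \<Rightarrow> 'e) \<Rightarrow> ('m \<Rightarrow> 'e \<Rightarrow> real) \<Rightarrow> 'n \<Rightarrow> 'n tvec"
  assumes algebroid: "loday_algebroid AM E br \<rho> \<alpha>"
    and AN: "smooth_manifold AN"
    and \<phi>: "smooth_map AN AM \<phi>"
    and action: "loday_action AM E br \<rho> \<alpha> AN \<phi> \<rho>' aT"
begin

abbreviation "FM \<equiv> smooth_fun_on AM UNIV"
abbreviation "FN \<equiv> smooth_fun_on AN UNIV"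
abbreviation "S \<equiv> sections AM E"
abbreviation "S' \<equiv> dual_sections AM E"
abbreviation "\<Gamma> \<equiv> sections AN (pullback_bundle \<phi> E)"
abbreviation "rk \<equiv> rank E"

lemmas algebroid_conds = algebroid[unfolded loday_algebroid_def]

lemmas AM = algebroid_conds[THEN conjunct1]
lemmas E = algebroid_conds[THEN conjunct2, THEN conjunct1]
lemmas bilinear = algebroid_conds[THEN conjunct2, THEN conjunct2, THEN conjunct1]
lemmas right = algebroid_conds[THEN conjunct2, THEN conjunct2, THEN conjunct2, THEN conjunct2, THEN conjunct1]

lemma br_jacobi: "\<lbrakk>e1 \<in> S; e2 \<in> S; e3 \<in> S\<rbrakk> \<Longrightarrow>
    br e1 (br e2 e3) = (\<lambda>x. br (br e1 e2) e3 x + br e2 (br e1 e3) x)"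
  by (rule algebroid_conds[THEN conjunct2, THEN conjunct2, THEN conjunct2, THEN conjunct2, THEN conjunct2, THEN conjunct1, rule_format])

lemma br_scale_right: "\<lbrakk>e1 \<in> S; e2 \<in> S; FM f\<rbrakk> \<Longrightarrow>
    br e1 (\<lambda>x. f x *\<^sub>R e2 x) = (\<lambda>x. f x *\<^sub>R br e1 e2 x + \<rho> x (e1 x) f *\<^sub>R e2 x)"
  by (rule algebroid_conds[THEN conjunct2, THEN conjunct2, THEN conjunct2, THEN conjunct2, THEN conjunct2, THEN conjunct2, THEN conjunct1, rule_format]; simp)

lemma br_scale_left: "\<lbrakk>e1 \<in> S; e2 \<in> S; FM f\<rbrakk> \<Longrightarrow>
    br (\<lambda>x. f x *\<^sub>R e1 x) e2 =
      (\<lambda>x. f x *\<^sub>R br e1 e2 x - \<rho> x (e2 x) f *\<^sub>R e1 x + \<alpha> x (differential AM f x) (e1 x) (e2 x))"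
  by (rule algebroid_conds[THEN conjunct2, THEN conjunct2, THEN conjunct2, THEN conjunct2, THEN conjunct2, THEN conjunct2, THEN conjunct2, rule_format]; simp)

lemmas br_conds = bilinear[unfolded bilinear_bracket_def, THEN bspec, THEN bspec]

lemma br_section [simp]: "e1 \<in> S \<Longrightarrow> e2 \<in> S \<Longrightarrow> br e1 e2 \<in> S"
  by (rule br_conds[THEN conjunct1])

lemma br_add_left: "e1 \<in> S \<Longrightarrow> e2 \<in> S \<Longrightarrow> e \<in> S \<Longrightarrow>
    br (\<lambda>x. e1 x + e x) e2 = (\<lambda>x. br e1 e2 x + br e e2 x)"
  by (rule br_conds[THEN conjunct2, THEN conjunct1, THEN bspec])

lemma br_add_right: "e1 \<in> S \<Longrightarrow> e2 \<in> S \<Longrightarrow> e \<in> S \<Longrightarrow>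
    br e1 (\<lambda>x. e2 x + e x) = (\<lambda>x. br e1 e2 x + br e1 e x)"
  by (rule br_conds[THEN conjunct2, THEN conjunct2, THEN conjunct1, THEN bspec])

lemmas action_conds = action[unfolded loday_action_def]
lemmas rho_conds = action_conds[THEN conjunct1, THEN bspec]

lemma rho_vector_field: "e \<in> S \<Longrightarrow> \<rho>' e \<in> vector_fields AN"
  by (rule rho_conds[THEN conjunct1])

lemma rho_add: "e \<in> S \<Longrightarrow> e2 \<in> S \<Longrightarrow> \<rho>' (\<lambda>x. e x + e2 x) = (\<lambda>p f. \<rho>' e p f + \<rho>' e2 p f)"
  by (rule rho_conds[THEN conjunct2, THEN conjunct1, THEN bspec])

lemma rho_scale: "e \<in> S \<Longrightarrow> FM h \<Longrightarrow> \<rho>' (\<lambda>x. h x *\<^sub>R e x) = (\<lambda>p f. h (\<phi> p) * \<rho>' e p f)"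
  by (rule rho_conds[THEN conjunct2, THEN conjunct2, THEN conjunct1, THEN bspec]; simp)

lemma rho_br: "e \<in> S \<Longrightarrow> e2 \<in> S \<Longrightarrow> \<rho>' (br e e2) = lie_bracket (\<rho>' e) (\<rho>' e2)"
  by (rule rho_conds[THEN conjunct2, THEN conjunct2, THEN conjunct2, THEN conjunct1, THEN bspec])

lemma rho_related: "e \<in> S \<Longrightarrow> tangent_map AM \<phi> (\<rho>' e p) = \<rho> (\<phi> p) (e (\<phi> p))"
  by (rule rho_conds[THEN conjunct2, THEN conjunct2, THEN conjunct2, THEN conjunct2, THEN spec])

lemma aT: "tensor_map AM E AN \<phi> aT"
  by (rule action_conds[THEN conjunct2, THEN conjunct1])

lemma aT_related: "e \<in> S \<Longrightarrow> e2 \<in> S \<Longrightarrow> \<mu> \<in> S' \<Longrightarrow>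
    tangent_map AM \<phi> (aT e e2 \<mu> p) = alpha_transpose AM \<alpha> e e2 \<mu> (\<phi> p)"
  by (rule action_conds[THEN conjunct2, THEN conjunct2, THEN conjunct1, rule_format])

lemmas aT_conds = aT[unfolded tensor_map_def, THEN bspec, THEN bspec, THEN bspec]

lemma aT_vector_field: "e1 \<in> S \<Longrightarrow> e2 \<in> S \<Longrightarrow> \<mu> \<in> S' \<Longrightarrow> aT e1 e2 \<mu> \<in> vector_fields AN"
  by (rule aT_conds[THEN conjunct1])

lemma aT_add1: "e1 \<in> S \<Longrightarrow> e2 \<in> S \<Longrightarrow> \<mu> \<in> S' \<Longrightarrow> e \<in> S \<Longrightarrow>
    aT (\<lambda>x. e1 x + e x) e2 \<mu> = (\<lambda>p f. aT e1 e2 \<mu> p f + aT e e2 \<mu> p f)"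
  by (rule aT_conds[THEN conjunct2, THEN conjunct1, THEN bspec])

lemma aT_add2: "e1 \<in> S \<Longrightarrow> e2 \<in> S \<Longrightarrow> \<mu> \<in> S' \<Longrightarrow> e \<in> S \<Longrightarrow>
    aT e1 (\<lambda>x. e2 x + e x) \<mu> = (\<lambda>p f. aT e1 e2 \<mu> p f + aT e1 e \<mu> p f)"
  by (rule aT_conds[THEN conjunct2, THEN conjunct2, THEN conjunct1, THEN bspec])

lemma aT_add3: "e1 \<in> S \<Longrightarrow> e2 \<in> S \<Longrightarrow> \<mu> \<in> S' \<Longrightarrow> \<nu> \<in> S' \<Longrightarrow>
    aT e1 e2 (\<lambda>x v. \<mu> x v + \<nu> x v) = (\<lambda>p f. aT e1 e2 \<mu> p f + aT e1 e2 \<nu> p f)"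
  by (rule aT_conds[THEN conjunct2, THEN conjunct2, THEN conjunct2, THEN conjunct1, THEN bspec])

lemmas aT_scale_conds = aT_conds[THEN conjunct2, THEN conjunct2, THEN conjunct2, THEN conjunct2, THEN bspec]

lemma aT_scale1: "e1 \<in> S \<Longrightarrow> e2 \<in> S \<Longrightarrow> \<mu> \<in> S' \<Longrightarrow> FM h \<Longrightarrow>
    aT (\<lambda>x. h x *\<^sub>R e1 x) e2 \<mu> = (\<lambda>p f. h (\<phi> p) * aT e1 e2 \<mu> p f)"
  by (rule aT_scale_conds[THEN conjunct1]; simp)

lemma aT_scale2: "e1 \<in> S \<Longrightarrow> e2 \<in> S \<Longrightarrow> \<mu> \<in> S' \<Longrightarrow> FM h \<Longrightarrow>
    aT e1 (\<lambda>x. h x *\<^sub>R e2 x) \<mu> = (\<lambda>p f. h (\<phi> p) * aT e1 e2 \<mu> p f)"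
  by (rule aT_scale_conds[THEN conjunct2, THEN conjunct1]; simp)

lemma aT_scale3: "e1 \<in> S \<Longrightarrow> e2 \<in> S \<Longrightarrow> \<mu> \<in> S' \<Longrightarrow> FM h \<Longrightarrow>
    aT e1 e2 (\<lambda>x v. h x * \<mu> x v) = (\<lambda>p f. h (\<phi> p) * aT e1 e2 \<mu> p f)"
  by (rule aT_scale_conds[THEN conjunct2, THEN conjunct2]; simp)

lemmas smooth_N [simp] = smooth_fun_on_const[OF AN] smooth_fun_on_add[OF AN open_UNIV]
  smooth_fun_on_mult[OF AN open_UNIV] smooth_fun_on_minus[OF AN open_UNIV]
  smooth_fun_on_diff[OF AN open_UNIV]
lemmas smooth_M [simp] = smooth_fun_on_const[OF AM] smooth_fun_on_add[OF AM open_UNIV]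
  smooth_fun_on_mult[OF AM open_UNIV] smooth_fun_on_minus[OF AM open_UNIV]
  smooth_fun_on_diff[OF AM open_UNIV]

lemma smooth_pull [simp]: "FM h \<Longrightarrow> FN (\<lambda>p. h (\<phi> p))"
  using pullback_smooth_fun[OF AM E AN \<phi>] by simp

lemma S_fibre [simp]: "e \<in> S \<Longrightarrow> e x \<in> fibre E x"
  using section_in_fibre[OF AM E] .

lemma S_add [simp]: "e \<in> S \<Longrightarrow> e' \<in> S \<Longrightarrow> (\<lambda>x. e x + e' x) \<in> S"
  by (rule section_add[OF AM E])

lemma S_scale [simp]: "FM h \<Longrightarrow> e \<in> S \<Longrightarrow> (\<lambda>x. h x *\<^sub>R e x) \<in> S"
  by (rule section_scaleR[OF AM E]) simp_all

lemma S_sum [simp]: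
  "(\<And>i. i \<in> I \<Longrightarrow> FM (g i)) \<Longrightarrow> (\<And>i. i \<in> I \<Longrightarrow> es i \<in> S) \<Longrightarrow> (\<lambda>x. \<Sum>i\<in>I. g i x *\<^sub>R es i x) \<in> S"
  by (rule section_sum_scaleR[OF AM E]) simp_all

lemma S_zero [simp]: "(\<lambda>x. 0) \<in> S"
  by (rule section_zero[OF AM E])

lemma \<Gamma>_bundle: "vector_bundle AN (pullback_bundle \<phi> E)"
  using vector_bundle_pullback[OF AM E AN \<phi>] .

lemma \<Gamma>_fibre [simp]: "\<sigma> \<in> \<Gamma> \<Longrightarrow> \<sigma> p \<in> fibre E (\<phi> p)"
  using section_in_fibre[OF AN \<Gamma>_bundle] pullback_simps[OF AM E AN \<phi>] by metis

lemma \<Gamma>_add [simp]: "\<sigma> \<in> \<Gamma> \<Longrightarrow> \<tau> \<in> \<Gamma> \<Longrightarrow> (\<lambda>x. \<sigma> x + \<tau> x) \<in> \<Gamma>"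
  by (rule section_add[OF AN \<Gamma>_bundle])

lemma \<Gamma>_scale [simp]: "FN h \<Longrightarrow> \<sigma> \<in> \<Gamma> \<Longrightarrow> (\<lambda>x. h x *\<^sub>R \<sigma> x) \<in> \<Gamma>"
  by (rule section_scaleR[OF AN \<Gamma>_bundle]) simp_all

lemma \<Gamma>_sum [simp]:
  "(\<And>i. i \<in> I \<Longrightarrow> FN (g i)) \<Longrightarrow> (\<And>i. i \<in> I \<Longrightarrow> \<sigma>s i \<in> \<Gamma>) \<Longrightarrow> (\<lambda>x. \<Sum>i\<in>I. g i x *\<^sub>R \<sigma>s i x) \<in> \<Gamma>"
  by (rule section_sum_scaleR[OF AN \<Gamma>_bundle]) simp_all

lemma \<Gamma>_zero [simp]: "(\<lambda>x. 0) \<in> \<Gamma>"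
  by (rule section_zero[OF AN \<Gamma>_bundle])

lemma \<Gamma>_diff [simp]: "\<sigma> \<in> \<Gamma> \<Longrightarrow> \<tau> \<in> \<Gamma> \<Longrightarrow> (\<lambda>x. \<sigma> x - \<tau> x) \<in> \<Gamma>"
  using \<Gamma>_add[of \<sigma> "\<lambda>x. (-1) *\<^sub>R \<tau> x"] \<Gamma>_scale[of "\<lambda>_. -1" \<tau>] by simp

lemma S_pull [simp]: "e \<in> S \<Longrightarrow> (\<lambda>p. e (\<phi> p)) \<in> \<Gamma>"
  using pullback_section[OF AM E AN \<phi>] .

lemma fibre_closed [simp]:
  "u \<in> fibre E x \<Longrightarrow> v \<in> fibre E x \<Longrightarrow> u + v \<in> fibre E x"
  "u \<in> fibre E x \<Longrightarrow> v \<in> fibre E x \<Longrightarrow> u - v \<in> fibre E x"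
  "u \<in> fibre E x \<Longrightarrow> c *\<^sub>R u \<in> fibre E x" "0 \<in> fibre E x"
  using fibre_subspace[OF AM E] by (auto intro: subspace_add subspace_diff subspace_scale subspace_0)

lemma fibre_sum [simp]: "(\<And>i. i \<in> I \<Longrightarrow> us i \<in> fibre E x) \<Longrightarrow> (\<Sum>i\<in>I. us i) \<in> fibre E x"
  using fibre_subspace[OF AM E] by (rule subspace_sum)

lemmas S'_add = dual_section_add[OF AM E] and S'_scale = dual_section_scaleR[OF AM E]
  and S'_sum = dual_section_sum[OF AM E]

lemma S'_diff: "\<mu> \<in> S' \<Longrightarrow> v \<in> fibre E x \<Longrightarrow> w \<in> fibre E x \<Longrightarrow> \<mu> x (v - w) = \<mu> x v - \<mu> x w"
  using S'_add[of \<mu> "v - w" x w] by simp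

lemma pairing_\<Gamma> [simp]: "\<mu> \<in> S' \<Longrightarrow> \<sigma> \<in> \<Gamma> \<Longrightarrow> FN (\<lambda>p. \<mu> (\<phi> p) (\<sigma> p))"
  using smooth_pairing[OF AN \<Gamma>_bundle pullback_dual_section[OF AM E AN \<phi>]] by simp

lemma pairing_S [simp]: "\<mu> \<in> S' \<Longrightarrow> e \<in> S \<Longrightarrow> FM (\<lambda>x. \<mu> x (e x))"
  using smooth_pairing[OF AM E] by simp

lemma \<Gamma>I:
  assumes "\<And>p. \<sigma> p \<in> fibre E (\<phi> p)" "\<And>\<mu>. \<mu> \<in> S' \<Longrightarrow> FN (\<lambda>p. \<mu> (\<phi> p) (\<sigma> p))"
  shows "\<sigma> \<in> \<Gamma>"
  using pullback_sectionI[OF AM E AN \<phi>] assms by simp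

section \<open>Critical frames and values of tensorial maps\<close>

definition is_critical_frame :: "'m \<Rightarrow> ('m \<Rightarrow> real) \<times> (nat \<Rightarrow> 'm \<Rightarrow> 'e) \<times> (nat \<Rightarrow> 'm \<Rightarrow> 'e \<Rightarrow> real) \<Rightarrow> bool"
  where "is_critical_frame x = (\<lambda>(\<theta>, e, \<mu>). FM \<theta> \<and> \<theta> x = 1 \<and>
    (\<forall>i<rk. e i \<in> S) \<and> (\<forall>i<rk. \<mu> i \<in> S') \<and>
    (\<forall>y. \<forall>v\<in>fibre E y. (3 * (\<theta> y)\<^sup>2 - 2 * (\<theta> y) ^ 3) *\<^sub>R v = (\<Sum>i<rk. \<mu> i y v *\<^sub>R e i y)))"

text \<open>One choice per point selects weight, sections and functionals together, since the
  expansion relates all three.\<close>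

definition "critical_frame x = (SOME t. is_critical_frame x t)"

definition "bump x = fst (critical_frame x)"
definition "fe x = fst (snd (critical_frame x))"
definition "fm x = snd (snd (critical_frame x))"
definition "\<psi> x y = 3 * (bump x y)\<^sup>2 - 2 * (bump x y) ^ 3"

lemma critical_frame: "is_critical_frame x (bump x, fe x, fm x)"
proof -
  have "\<exists>t. is_critical_frame x t"
    using critical_dual_frame[OF AM E, of x] by (simp add: is_critical_frame_def)
  then have "is_critical_frame x (critical_frame x)"
    unfolding critical_frame_def by (rule someI_ex)
  then show ?thesis by (simp add: bump_def fe_def fm_def)
qed

lemma bump: "FM (bump x)" "bump x x = 1"
  and fe [simp]: "i < rk \<Longrightarrow> fe x i \<in> S"
  and fm [simp]: "i < rk \<Longrightarrow> fm x i \<in> S'"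
  and frame_expand: "v \<in> fibre E y \<Longrightarrow> \<psi> x y *\<^sub>R v = (\<Sum>i<rk. fm x i y v *\<^sub>R fe x i y)"
  using critical_frame[of x] by (simp_all add: is_critical_frame_def \<psi>_def)

lemma \<psi>_eq: "\<psi> x = (\<lambda>y. 3 * (bump x y * bump x y) - 2 * (bump x y * (bump x y * bump x y)))"
  by (simp add: fun_eq_iff \<psi>_def power2_eq_square power3_eq_cube algebra_simps)

lemma \<psi>_smooth [simp]: "FM (\<psi> x)"
  unfolding \<psi>_eq using bump(1)[of x] by simp

lemma \<psi>_self [simp]: "\<psi> x x = 1"
  by (simp add: \<psi>_eq bump)

lemma frame_expand_self: "v \<in> fibre E x \<Longrightarrow> (\<Sum>i<rk. fm x i x v *\<^sub>R fe x i x) = v"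
  using frame_expand[of v x x] by simp

text \<open>The bump function is 1 at the point, so the derivation gives a square the factor 2 and a
  cube the factor 3; the total is \<open>3 * 2 - 2 * 3\<close>.\<close>

lemma \<psi>_critical:
  assumes v: "v \<in> tangent_space AN p"
  shows "v (\<lambda>q. \<psi> (\<phi> p) (\<phi> q)) = 0"
proof -
  let ?b = "\<lambda>q. bump (\<phi> p) (\<phi> q)"
  have b: "FN ?b" using bump(1) by simp
  have v2: "v (\<lambda>q. ?b q * ?b q) = 2 * v ?b"
    using tangent_mult[OF v b b] by (simp add: bump)
  have v3: "v (\<lambda>q. ?b q * (?b q * ?b q)) = 3 * v ?b"
    using tangent_mult[OF v b smooth_N(3)[OF b b]] v2 by (simp add: bump)
  have "v (\<lambda>q. 3 * (?b q * ?b q) + (-2) * (?b q * (?b q * ?b q)))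
      = v (\<lambda>q. 3 * (?b q * ?b q)) + v (\<lambda>q. (-2) * (?b q * (?b q * ?b q)))"
    by (rule tangent_add[OF v]) (intro smooth_N b)+
  also have "\<dots> = 0"
    unfolding tangent_scale[OF v smooth_N(3)[OF b b]]
      tangent_scale[OF v smooth_N(3)[OF b smooth_N(3)[OF b b]]] v2 v3 by simp
  finally show ?thesis by (simp add: \<psi>_eq)
qed

text \<open>Extends a fibre vector to a global section by freezing its coefficients at
  \<open>x\<close>. Fibrewise maps are evaluated through such extensions.\<close>

definition "const_section x u = (\<lambda>y. \<Sum>i<rk. fm x i x u *\<^sub>R fe x i y)"

lemma const_section [simp]: "const_section x u \<in> S" "u \<in> fibre E x \<Longrightarrow> const_section x u x = u"
  using S_sum[of "{..<rk}" "\<lambda>i _. fm x i x u" "fe x"]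
  by (simp_all add: const_section_def frame_expand_self)

lemma fibre_eqI:
  assumes "v \<in> fibre E x" "w \<in> fibre E x" "\<And>\<mu>. \<mu> \<in> S' \<Longrightarrow> \<mu> x v = \<mu> x w"
  shows "v = w"
proof -
  have "(\<Sum>i<rk. fm x i x v *\<^sub>R fe x i x) = (\<Sum>i<rk. fm x i x w *\<^sub>R fe x i x)"
    by (intro sum.cong) (use assms(3) in auto)
  then show ?thesis by (simp add: frame_expand_self assms(1,2))
qed

text \<open>Applied to the expansion of \<open>\<psi> x\<close> times \<open>e\<close>, whose weight
  is 1 at \<open>x\<close>, linearity over functions expresses \<open>T e\<close> through the values
  \<open>e x\<close> alone.\<close>

lemma tensorial_value:
  fixes T :: "('m \<Rightarrow> 'e) \<Rightarrow> real"
  assumes add: "\<And>e e'. e \<in> S \<Longrightarrow> e' \<in> S \<Longrightarrow> T (\<lambda>y. e y + e' y) = T e + T e'"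
    and scale: "\<And>h e. FM h \<Longrightarrow> e \<in> S \<Longrightarrow> T (\<lambda>y. h y *\<^sub>R e y) = h x * T e"
    and e: "e \<in> S"
  shows "T e = (\<Sum>i<rk. fm x i x (e x) * T (fe x i))"
proof -
  have 0: "T (\<lambda>y. 0) = 0" using scale[of "\<lambda>_. 0" "\<lambda>_. 0"] by simp
  have "n \<le> rk \<Longrightarrow> T (\<lambda>y. \<Sum>i<n. fm x i y (e y) *\<^sub>R fe x i y) = (\<Sum>i<n. fm x i x (e x) * T (fe x i))" for n
  proof (induction n)
    case (Suc n)
    have "T (\<lambda>y. (\<Sum>i<n. fm x i y (e y) *\<^sub>R fe x i y) + fm x n y (e y) *\<^sub>R fe x n y)
        = T (\<lambda>y. \<Sum>i<n. fm x i y (e y) *\<^sub>R fe x i y) + T (\<lambda>y. fm x n y (e y) *\<^sub>R fe x n y)"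
      using Suc.prems e by (intro add S_sum S_scale pairing_S fm fe) auto
    then show ?case using Suc e scale by simp
  qed (simp add: 0)
  then have "T (\<lambda>y. \<psi> x y *\<^sub>R e y) = (\<Sum>i<rk. fm x i x (e x) * T (fe x i))"
    using e by (simp add: frame_expand)
  then show ?thesis using scale[OF \<psi>_smooth e] by simp
qed

lemma tensorial_cong:
  fixes T :: "('m \<Rightarrow> 'e) \<Rightarrow> real"
  assumes "\<And>e e'. e \<in> S \<Longrightarrow> e' \<in> S \<Longrightarrow> T (\<lambda>y. e y + e' y) = T e + T e'"
    "\<And>h e. FM h \<Longrightarrow> e \<in> S \<Longrightarrow> T (\<lambda>y. h y *\<^sub>R e y) = h x * T e"
    "e \<in> S" "e' \<in> S" "e x = e' x"
  shows "T e = T e'"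
  by (simp only: tensorial_value[OF assms(1,2,3)] tensorial_value[OF assms(1,2,4)] assms(5))

text \<open>The counterpart for functionals rests on the transposed expansion, in which the sections
  \<open>fe\<close> supply the coefficients of the functionals \<open>fm\<close>.\<close>

lemma dual_tensorial_value:
  fixes T :: "('m \<Rightarrow> 'e \<Rightarrow> real) \<Rightarrow> real"
  assumes add: "\<And>\<mu> \<nu>. \<mu> \<in> S' \<Longrightarrow> \<nu> \<in> S' \<Longrightarrow> T (\<lambda>y v. \<mu> y v + \<nu> y v) = T \<mu> + T \<nu>"
    and scale: "\<And>h \<mu>. FM h \<Longrightarrow> \<mu> \<in> S' \<Longrightarrow> T (\<lambda>y v. h y * \<mu> y v) = h x * T \<mu>"
    and \<mu>: "\<mu> \<in> S'"
  shows "T \<mu> = (\<Sum>i<rk. \<mu> x (fe x i x) * T (fm x i))"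
proof -
  have zero: "(\<lambda>y v. 0) \<in> S'" using dual_section_sum_scale[OF AM E, of "{}"] by simp
  have 0: "T (\<lambda>y v. 0) = 0" using scale[of "\<lambda>_. 0", OF _ zero] by simp
  have sums: "n \<le> rk \<Longrightarrow> T (\<lambda>y v. \<Sum>i<n. \<mu> y (fe x i y) * fm x i y v) = (\<Sum>i<n. \<mu> x (fe x i x) * T (fm x i))" for n
  proof (induction n)
    case (Suc n)
    have 1: "(\<lambda>y v. \<Sum>i<n. \<mu> y (fe x i y) * fm x i y v) \<in> S'"
      using Suc.prems \<mu> by (intro dual_section_sum_scale[OF AM E]) auto
    have 2: "(\<lambda>y v. \<mu> y (fe x n y) * fm x n y v) \<in> S'"
      using Suc.prems \<mu> by (intro dual_section_scale[OF AM E]) auto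
    show ?case using add[OF 1 2] Suc \<mu> scale by simp
  qed (simp add: 0)
  \<comment> \<open>Outside the fibre both sides vanish by the normalisation of dual sections, so
    the identity holds for every \<open>v\<close>, as equality in HOL requires.\<close>
  have weight: "(\<Sum>i<rk. \<mu> y (fe x i y) * fm x i y v) = \<psi> x y * \<mu> y v" for y v
  proof (cases "v \<in> fibre E y")
    case True
    have "\<psi> x y * \<mu> y v = \<mu> y (\<psi> x y *\<^sub>R v)" using S'_scale[OF \<mu> True] by simp
    also have "\<dots> = (\<Sum>i<rk. fm x i y v * \<mu> y (fe x i y))"
      unfolding frame_expand[OF True] by (rule S'_sum[OF \<mu>]) auto
    finally show ?thesis by (simp add: mult.commute)
  next
    case False
    then have z: "\<nu> y v = 0" if "\<nu> \<in> S'" for \<nu>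
      using dual_section_zero[OF AM E that] by simp
    have "(\<Sum>i<rk. \<mu> y (fe x i y) * fm x i y v) = 0"
      by (rule sum.neutral) (use z[OF fm] in auto)
    then show ?thesis using z[OF \<mu>] by simp
  qed
  have "T (\<lambda>y v. \<psi> x y * \<mu> y v) = (\<Sum>i<rk. \<mu> x (fe x i x) * T (fm x i))"
    using sums[OF order.refl] unfolding weight .
  then show ?thesis using scale[OF \<psi>_smooth \<mu>] by simp
qed

lemma FN_cancel:
  assumes "\<And>x. FN (\<lambda>q. \<psi> x (\<phi> q) * g q)"
  shows "FN g"
proof (rule smooth_fun_on_cancel[OF AN open_UNIV])
  fix p
  show "\<exists>\<theta>\<in>smooth_funs AN. \<theta> p \<noteq> 0 \<and> FN (\<lambda>x. \<theta> x * g x)"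
    by (rule bexI[of _ "\<lambda>q. \<psi> (\<phi> p) (\<phi> q)"]) (use assms in auto)
qed

text \<open>A weighted section of the pullback bundle is a finite combination of pulled-back
  sections with smooth coefficients, so testing on pullbacks suffices; the weight is removed by
  \<open>FN_cancel\<close>.\<close>

lemma smooth_fibrewise_linear:
  fixes T :: "'n \<Rightarrow> 'e \<Rightarrow> real"
  assumes add: "\<And>q u v. u \<in> fibre E (\<phi> q) \<Longrightarrow> v \<in> fibre E (\<phi> q) \<Longrightarrow> T q (u + v) = T q u + T q v"
    and scale: "\<And>q r u. u \<in> fibre E (\<phi> q) \<Longrightarrow> T q (r *\<^sub>R u) = r * T q u"
    and S: "\<And>e. e \<in> S \<Longrightarrow> FN (\<lambda>q. T q (e (\<phi> q)))"
    and \<sigma>: "\<sigma> \<in> \<Gamma>"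
  shows "FN (\<lambda>q. T q (\<sigma> q))"
proof (rule FN_cancel)
  fix x
  have 0: "T q 0 = 0" for q using scale[of 0 q 0] by simp
  have "n \<le> rk \<Longrightarrow> T q (\<Sum>i<n. c i *\<^sub>R fe x i (\<phi> q)) = (\<Sum>i<n. c i * T q (fe x i (\<phi> q)))" for n q c
  proof (induction n)
    case (Suc n)
    then have "(\<Sum>i<n. c i *\<^sub>R fe x i (\<phi> q)) \<in> fibre E (\<phi> q)"
      by (intro fibre_sum fibre_closed S_fibre fe) auto
    then show ?case using Suc by (simp add: add scale)
  qed (simp add: 0)
  then have expand: "\<psi> x (\<phi> q) * T q (\<sigma> q) = (\<Sum>i<rk. fm x i (\<phi> q) (\<sigma> q) * T q (fe x i (\<phi> q)))" for q
    using frame_expand[of "\<sigma> q" "\<phi> q" x] scale[of "\<sigma> q" q "\<psi> x (\<phi> q)"] \<sigma> by simp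
  then show "FN (\<lambda>q. \<psi> x (\<phi> q) * T q (\<sigma> q))"
    unfolding expand
    by (intro smooth_fun_on_sum[OF AN open_UNIV] smooth_N(3) pairing_\<Gamma> S fm fe) (use \<sigma> in auto)
qed

section \<open>The fibrewise maps induced by the action\<close>

abbreviation "\<rho>N \<equiv> induced_anchor AM E \<phi> \<rho>'"
abbreviation "aN \<equiv> induced_transpose AM E \<phi> aT"
abbreviation "T p \<equiv> tangent_space AN p"
abbreviation "T' p \<equiv> cotangent_space AN p"

lemma rho_tangent [simp]: "e \<in> S \<Longrightarrow> \<rho>' e p \<in> T p"
  using rho_vector_field vector_field_tangent by blast

lemma aT_tangent [simp]: "e1 \<in> S \<Longrightarrow> e2 \<in> S \<Longrightarrow> \<mu> \<in> S' \<Longrightarrow> aT e1 e2 \<mu> p \<in> T p"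
  using aT_vector_field vector_field_tangent by blast

text \<open>Independence of the extending section is what makes the description in
  \<open>induced_anchor\<close> well defined.\<close>

lemma rho_cong:
  assumes "e \<in> S" "e' \<in> S" "e (\<phi> p) = e' (\<phi> p)"
  shows "\<rho>' e p = \<rho>' e' p"
proof
  fix f
  show "\<rho>' e p f = \<rho>' e' p f"
    by (rule tensorial_cong[of "\<lambda>e. \<rho>' e p f" "\<phi> p"]) (simp_all add: rho_add rho_scale assms)
qed

lemma \<rho>N_eq [simp]:
  assumes "e \<in> S"
  shows "\<rho>N p (e (\<phi> p)) = \<rho>' e p"
  unfolding induced_anchor_def
proof (rule the_equality)
  show "\<forall>e'\<in>S. e' (\<phi> p) = e (\<phi> p) \<longrightarrow> \<rho>' e' p = \<rho>' e p"
    using rho_cong assms by blast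
  fix X assume "\<forall>e'\<in>S. e' (\<phi> p) = e (\<phi> p) \<longrightarrow> \<rho>' e' p = X"
  then show "X = \<rho>' e p" using assms by simp
qed

lemma \<rho>N_const_section: "u \<in> fibre E (\<phi> p) \<Longrightarrow> \<rho>N p u = \<rho>' (const_section (\<phi> p) u) p"
  using \<rho>N_eq[of "const_section (\<phi> p) u" p] by simp

lemma \<rho>N_tangent [simp]: "u \<in> fibre E (\<phi> p) \<Longrightarrow> \<rho>N p u \<in> T p"
  by (simp add: \<rho>N_const_section)

lemma \<rho>N_add: "u \<in> fibre E (\<phi> p) \<Longrightarrow> v \<in> fibre E (\<phi> p) \<Longrightarrow> \<rho>N p (u + v) = (\<lambda>f. \<rho>N p u f + \<rho>N p v f)"
  using \<rho>N_eq[of "\<lambda>x. const_section (\<phi> p) u x + const_section (\<phi> p) v x" p]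
  by (simp add: rho_add \<rho>N_const_section)

lemma \<rho>N_scale: "u \<in> fibre E (\<phi> p) \<Longrightarrow> \<rho>N p (r *\<^sub>R u) = (\<lambda>f. r * \<rho>N p u f)"
  using \<rho>N_eq[of "\<lambda>x. r *\<^sub>R const_section (\<phi> p) u x" p]
    rho_scale[of "const_section (\<phi> p) u" "\<lambda>_. r"]
  by (simp add: \<rho>N_const_section)

lemma aT_cong:
  assumes "e1 \<in> S" "e2 \<in> S" "e1' \<in> S" "e2' \<in> S" "\<mu> \<in> S'"
    "e1 (\<phi> p) = e1' (\<phi> p)" "e2 (\<phi> p) = e2' (\<phi> p)"
  shows "aT e1 e2 \<mu> p = aT e1' e2' \<mu> p"
proof
  fix f
  have "aT e1 e2 \<mu> p f = aT e1' e2 \<mu> p f"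
    by (rule tensorial_cong[of "\<lambda>e. aT e e2 \<mu> p f" "\<phi> p"]) (simp_all add: aT_add1 aT_scale1 assms)
  also have "\<dots> = aT e1' e2' \<mu> p f"
    by (rule tensorial_cong[of "\<lambda>e. aT e1' e \<mu> p f" "\<phi> p"]) (simp_all add: aT_add2 aT_scale2 assms)
  finally show "aT e1 e2 \<mu> p f = aT e1' e2' \<mu> p f" .
qed

text \<open>The vector is prescribed by its pairings with the dual frame at \<open>\<phi> p\<close>;
  \<open>dual_tensorial_value\<close> extends the pairing formula to every functional, and
  functionals separate fibre vectors. This justifies the description in
  \<open>induced_transpose\<close>.\<close>

lemma aN_ex:
  assumes \<eta>: "\<eta> \<in> T' p" and e: "e1 \<in> S" "e2 \<in> S"
  shows "\<exists>!w. w \<in> fibre E (\<phi> p) \<and>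
        (\<forall>e1'\<in>S. \<forall>e2'\<in>S. \<forall>\<mu>\<in>S'.
           e1' (\<phi> p) = e1 (\<phi> p) \<longrightarrow> e2' (\<phi> p) = e2 (\<phi> p) \<longrightarrow> \<mu> (\<phi> p) w = \<eta> (aT e1' e2' \<mu> p))"
proof -
  let ?x = "\<phi> p"
  define w where "w = (\<Sum>k<rk. \<eta> (aT e1 e2 (fm ?x k) p) *\<^sub>R fe ?x k ?x)"
  have w: "w \<in> fibre E ?x" unfolding w_def by (intro fibre_sum fibre_closed S_fibre fe) auto
  have "\<mu> ?x w = \<eta> (aT e1' e2' \<mu> p)"
    if e': "e1' \<in> S" "e2' \<in> S" and \<mu>: "\<mu> \<in> S'" and eq: "e1' ?x = e1 ?x" "e2' ?x = e2 ?x" for e1' e2' \<mu>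
  proof -
    have "aT e1 e2 \<mu> p f = (\<Sum>k<rk. \<mu> ?x (fe ?x k ?x) * aT e1 e2 (fm ?x k) p f)" for f
      by (rule dual_tensorial_value[of "\<lambda>\<mu>. aT e1 e2 \<mu> p f" ?x]) (simp_all add: aT_add3 aT_scale3 e \<mu>)
    then have "aT e1 e2 \<mu> p = (\<lambda>f. \<Sum>k<rk. \<mu> ?x (fe ?x k ?x) * aT e1 e2 (fm ?x k) p f)" by blast
    then have "\<eta> (aT e1 e2 \<mu> p) = (\<Sum>k<rk. \<mu> ?x (fe ?x k ?x) * \<eta> (aT e1 e2 (fm ?x k) p))"
      using cotangent_sum[OF \<eta>, of "{..<rk}" "\<lambda>k. aT e1 e2 (fm ?x k) p"] e by simp
    also have "\<dots> = \<mu> ?x w"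
      unfolding w_def by (subst S'_sum[OF \<mu>]) (auto simp: mult.commute)
    finally show ?thesis using aT_cong[OF e' e \<mu> eq] by simp
  qed
  note pair = this
  show ?thesis
  proof (rule ex1I[of _ w])
    fix w' assume w': "w' \<in> fibre E ?x \<and> (\<forall>e1'\<in>S. \<forall>e2'\<in>S. \<forall>\<mu>\<in>S'.
           e1' ?x = e1 ?x \<longrightarrow> e2' ?x = e2 ?x \<longrightarrow> \<mu> ?x w' = \<eta> (aT e1' e2' \<mu> p))"
    show "w' = w"
      by (rule fibre_eqI[of _ "\<phi> p"]) (use w' w pair e in auto)
  qed (use w pair in auto)
qed

lemma
  assumes "\<eta> \<in> T' p" "e1 \<in> S" "e2 \<in> S"
  shows aN_fibre_S: "aN p \<eta> (e1 (\<phi> p)) (e2 (\<phi> p)) \<in> fibre E (\<phi> p)"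
    and aN_pairing: "\<mu> \<in> S' \<Longrightarrow> \<mu> (\<phi> p) (aN p \<eta> (e1 (\<phi> p)) (e2 (\<phi> p))) = \<eta> (aT e1 e2 \<mu> p)"
  using theI'[OF aN_ex[OF assms]] assms unfolding induced_transpose_def by auto

lemma aN_fibre [simp]:
  assumes "\<eta> \<in> T' p" "u \<in> fibre E (\<phi> p)" "v \<in> fibre E (\<phi> p)"
  shows "aN p \<eta> u v \<in> fibre E (\<phi> p)"
  using aN_fibre_S[OF assms(1) const_section(1) const_section(1), of "\<phi> p" u "\<phi> p" v] assms by simp

lemma aN_pair:
  assumes "\<eta> \<in> T' p" "u \<in> fibre E (\<phi> p)" "v \<in> fibre E (\<phi> p)" "\<mu> \<in> S'"
  shows "\<mu> (\<phi> p) (aN p \<eta> u v) = \<eta> (aT (const_section (\<phi> p) u) (const_section (\<phi> p) v) \<mu> p)"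
  using aN_pairing[OF assms(1) const_section(1) const_section(1) assms(4), of "\<phi> p" u "\<phi> p" v] assms
  by simp

lemma aN_add1:
  assumes "\<eta> \<in> T' p" "\<zeta> \<in> T' p" "u \<in> fibre E (\<phi> p)" "v \<in> fibre E (\<phi> p)"
  shows "aN p (\<lambda>X. \<eta> X + \<zeta> X) u v = aN p \<eta> u v + aN p \<zeta> u v"
  by (rule fibre_eqI[of _ "\<phi> p"])
    (use assms in \<open>simp_all add: cotangent_space_add aN_pair S'_add\<close>)

lemma aN_scale1:
  assumes "\<eta> \<in> T' p" "u \<in> fibre E (\<phi> p)" "v \<in> fibre E (\<phi> p)"
  shows "aN p (\<lambda>X. r * \<eta> X) u v = r *\<^sub>R aN p \<eta> u v"
  by (rule fibre_eqI[of _ "\<phi> p"])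
    (use assms in \<open>simp_all add: cotangent_space_scale aN_pair S'_scale\<close>)

lemma aN_add2:
  assumes \<eta>: "\<eta> \<in> T' p" and "u \<in> fibre E (\<phi> p)" "w \<in> fibre E (\<phi> p)" "v \<in> fibre E (\<phi> p)"
  shows "aN p \<eta> (u + w) v = aN p \<eta> u v + aN p \<eta> w v"
proof (rule fibre_eqI[of _ "\<phi> p"])
  fix \<mu> assume \<mu>: "\<mu> \<in> S'"
  have "\<mu> (\<phi> p) (aN p \<eta> (u + w) v) =
      \<eta> (aT (\<lambda>x. const_section (\<phi> p) u x + const_section (\<phi> p) w x) (const_section (\<phi> p) v) \<mu> p)"
    using aN_pairing[OF \<eta> S_add[OF const_section(1) const_section(1)] const_section(1) \<mu>,
        of "\<phi> p" u "\<phi> p" w "\<phi> p" v] assms by simp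
  then show "\<mu> (\<phi> p) (aN p \<eta> (u + w) v) = \<mu> (\<phi> p) (aN p \<eta> u v + aN p \<eta> w v)"
    using assms \<mu> by (simp add: aT_add1 cotangent_add[OF \<eta>] S'_add aN_pair)
qed (use assms in auto)

lemma aN_add3:
  assumes \<eta>: "\<eta> \<in> T' p" and "u \<in> fibre E (\<phi> p)" "w \<in> fibre E (\<phi> p)" "v \<in> fibre E (\<phi> p)"
  shows "aN p \<eta> v (u + w) = aN p \<eta> v u + aN p \<eta> v w"
proof (rule fibre_eqI[of _ "\<phi> p"])
  fix \<mu> assume \<mu>: "\<mu> \<in> S'"
  have "\<mu> (\<phi> p) (aN p \<eta> v (u + w)) =
      \<eta> (aT (const_section (\<phi> p) v) (\<lambda>x. const_section (\<phi> p) u x + const_section (\<phi> p) w x) \<mu> p)"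
    using aN_pairing[OF \<eta> const_section(1) S_add[OF const_section(1) const_section(1)] \<mu>,
        of "\<phi> p" v "\<phi> p" u "\<phi> p" w] assms by simp
  then show "\<mu> (\<phi> p) (aN p \<eta> v (u + w)) = \<mu> (\<phi> p) (aN p \<eta> v u + aN p \<eta> v w)"
    using assms \<mu> by (simp add: aT_add2 cotangent_add[OF \<eta>] S'_add aN_pair)
qed (use assms in auto)

lemma aN_scale2:
  assumes \<eta>: "\<eta> \<in> T' p" and "u \<in> fibre E (\<phi> p)" "v \<in> fibre E (\<phi> p)"
  shows "aN p \<eta> (r *\<^sub>R u) v = r *\<^sub>R aN p \<eta> u v"
proof (rule fibre_eqI[of _ "\<phi> p"])
  fix \<mu> assume \<mu>: "\<mu> \<in> S'"
  have "\<mu> (\<phi> p) (aN p \<eta> (r *\<^sub>R u) v) =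
      \<eta> (aT (\<lambda>x. r *\<^sub>R const_section (\<phi> p) u x) (const_section (\<phi> p) v) \<mu> p)"
    using aN_pairing[OF \<eta> S_scale[OF smooth_M(1) const_section(1)] const_section(1) \<mu>,
        of r "\<phi> p" u "\<phi> p" v] assms by simp
  then show "\<mu> (\<phi> p) (aN p \<eta> (r *\<^sub>R u) v) = \<mu> (\<phi> p) (r *\<^sub>R aN p \<eta> u v)"
    using assms \<mu> aT_scale1[of _ _ \<mu> "\<lambda>_. r"] by (simp add: cotangent_scale[OF \<eta>] S'_scale aN_pair)
qed (use assms in auto)

lemma aN_scale3:
  assumes \<eta>: "\<eta> \<in> T' p" and "u \<in> fibre E (\<phi> p)" "v \<in> fibre E (\<phi> p)"
  shows "aN p \<eta> v (r *\<^sub>R u) = r *\<^sub>R aN p \<eta> v u"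
proof (rule fibre_eqI[of _ "\<phi> p"])
  fix \<mu> assume \<mu>: "\<mu> \<in> S'"
  have "\<mu> (\<phi> p) (aN p \<eta> v (r *\<^sub>R u)) =
      \<eta> (aT (const_section (\<phi> p) v) (\<lambda>x. r *\<^sub>R const_section (\<phi> p) u x) \<mu> p)"
    using aN_pairing[OF \<eta> const_section(1) S_scale[OF smooth_M(1) const_section(1)] \<mu>,
        of "\<phi> p" v r "\<phi> p" u] assms by simp
  then show "\<mu> (\<phi> p) (aN p \<eta> v (r *\<^sub>R u)) = \<mu> (\<phi> p) (r *\<^sub>R aN p \<eta> v u)"
    using assms \<mu> aT_scale2[of _ _ \<mu> "\<lambda>_. r"] by (simp add: cotangent_scale[OF \<eta>] S'_scale aN_pair)
qed (use assms in auto)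

lemma \<rho>N_smooth [simp]:
  assumes "\<sigma> \<in> \<Gamma>" "FN f"
  shows "FN (\<lambda>p. \<rho>N p (\<sigma> p) f)"
proof (rule smooth_fibrewise_linear[OF _ _ _ assms(1), of "\<lambda>p u. \<rho>N p u f"])
  fix e assume "e \<in> S"
  then show "FN (\<lambda>q. \<rho>N q (e (\<phi> q)) f)"
    using vector_field_smooth[OF rho_vector_field assms(2)] by simp
qed (simp_all add: \<rho>N_add \<rho>N_scale)

lemma one_form_cotangent: "\<eta> \<in> one_forms AN \<Longrightarrow> \<eta> p \<in> T' p"
  by (simp add: one_forms_def)

text \<open>If both arguments are pullbacks, the pairing is the one-form evaluated on a vector field
  from \<open>aT\<close>, hence smooth. Then \<open>smooth_fibrewise_linear\<close> frees one
  argument at a time.\<close>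

lemma aN_section:
  assumes \<eta>: "\<eta> \<in> one_forms AN" and \<sigma>: "\<sigma> \<in> \<Gamma>" and \<tau>: "\<tau> \<in> \<Gamma>"
  shows "(\<lambda>p. aN p (\<eta> p) (\<sigma> p) (\<tau> p)) \<in> \<Gamma>"
proof (rule \<Gamma>I)
  note c = one_form_cotangent[OF \<eta>]
  show "aN p (\<eta> p) (\<sigma> p) (\<tau> p) \<in> fibre E (\<phi> p)" for p using c \<sigma> \<tau> by simp
  fix \<mu> assume \<mu>: "\<mu> \<in> S'"
  have "FN (\<lambda>q. \<mu> (\<phi> q) (aN q (\<eta> q) (e1 (\<phi> q)) (e2 (\<phi> q))))" if e: "e1 \<in> S" "e2 \<in> S" for e1 e2
    using \<eta> aT_vector_field[OF e \<mu>] by (simp add: aN_pairing[OF c e \<mu>] one_forms_def)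
  then have "FN (\<lambda>q. \<mu> (\<phi> q) (aN q (\<eta> q) (e1 (\<phi> q)) (\<tau> q)))" if e: "e1 \<in> S" for e1
    by (intro smooth_fibrewise_linear[OF _ _ _ \<tau>, of "\<lambda>q u. \<mu> (\<phi> q) (aN q (\<eta> q) (e1 (\<phi> q)) u)"])
      (simp_all add: e c \<mu> aN_add3 aN_scale3 S'_add S'_scale)
  then show "FN (\<lambda>q. \<mu> (\<phi> q) (aN q (\<eta> q) (\<sigma> q) (\<tau> q)))"
    by (intro smooth_fibrewise_linear[OF _ _ _ \<sigma>, of "\<lambda>q u. \<mu> (\<phi> q) (aN q (\<eta> q) u (\<tau> q))"])
      (simp_all add: \<tau> c \<mu> aN_add2 aN_scale2 S'_add S'_scale)
qed

lemma left_anchor_N: "left_anchor AN (pullback_bundle \<phi> E) \<rho>N"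
proof -
  have "(\<lambda>x. \<rho>N x (\<sigma> x)) \<in> vector_fields AN" if "\<sigma> \<in> \<Gamma>" for \<sigma>
    using that by (simp add: vector_fields_def)
  then show ?thesis
    by (simp add: left_anchor_def pullback_simps[OF AM E AN \<phi>] \<rho>N_add \<rho>N_scale)
qed

lemma right_anchor_N: "right_anchor_control AN (pullback_bundle \<phi> E) aN"
  using aN_section
  by (simp add: right_anchor_control_def pullback_simps[OF AM E AN \<phi>]
      aN_add1 aN_add2 aN_add3 aN_scale1 aN_scale2 aN_scale3)

abbreviation "d f p \<equiv> differential AN f p"

lemma d_cotangent [simp]: "d f p \<in> T' p"
  by (rule differential_cotangent)

lemma d_section [simp]:
  assumes "FN f" "\<sigma> \<in> \<Gamma>" "\<tau> \<in> \<Gamma>"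
  shows "(\<lambda>p. aN p (d f p) (\<sigma> p) (\<tau> p)) \<in> \<Gamma>"
  using aN_section[OF differential_one_form[OF assms(1)]] assms by simp

lemma d_add: "FN f \<Longrightarrow> FN g \<Longrightarrow> d (\<lambda>q. f q + g q) p = (\<lambda>v. d f p v + d g p v)"
  by (auto simp: differential_def tangent_add)

lemma d_mult: "FN f \<Longrightarrow> FN g \<Longrightarrow> d (\<lambda>q. f q * g q) p = (\<lambda>v. f p * d g p v + g p * d f p v)"
  by (auto simp: differential_def tangent_mult)

lemma d_const: "d (\<lambda>q. c) p = (\<lambda>v. 0)"
  by (auto simp: differential_def tangent_const[OF AN])

lemma aN_d_add:
  assumes "FN f" "FN g" "u \<in> fibre E (\<phi> p)" "v \<in> fibre E (\<phi> p)"
  shows "aN p (d (\<lambda>q. f q + g q) p) u v = aN p (d f p) u v + aN p (d g p) u v"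
  using assms by (simp add: d_add aN_add1)

lemma aN_d_mult:
  assumes "FN f" "FN g" "u \<in> fibre E (\<phi> p)" "v \<in> fibre E (\<phi> p)"
  shows "aN p (d (\<lambda>q. f q * g q) p) u v = f p *\<^sub>R aN p (d g p) u v + g p *\<^sub>R aN p (d f p) u v"
proof -
  have "aN p (\<lambda>v. f p * d g p v + g p * d f p v) u v
      = aN p (\<lambda>v. f p * d g p v) u v + aN p (\<lambda>v. g p * d f p v) u v"
    using assms by (intro aN_add1 cotangent_space_scale) auto
  then show ?thesis using assms by (simp add: d_mult aN_scale1)
qed

lemma aN_d_const:
  assumes "u \<in> fibre E (\<phi> p)" "v \<in> fibre E (\<phi> p)"
  shows "aN p (d (\<lambda>q. c) p) u v = 0"
  using aN_scale1[OF d_cotangent assms, of 0 "\<lambda>q. c"] by (simp add: d_const)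

text \<open>Relatedness of the anchors, read on functions pulled back from \<open>M\<close>.
  Together with \<open>\<alpha>_pull\<close> it is what makes the bracket formula balanced.\<close>

lemma \<rho>_pull:
  assumes "e \<in> S" "FM h"
  shows "\<rho>' e p (\<lambda>q. h (\<phi> q)) = \<rho> (\<phi> p) (e (\<phi> p)) h"
proof -
  have "tangent_map AM \<phi> (\<rho>' e p) h = \<rho> (\<phi> p) (e (\<phi> p)) h"
    using rho_related[OF assms(1)] by simp
  then show ?thesis using assms(2) by (simp add: tangent_map_def comp_def)
qed

lemma \<alpha>_pull:
  assumes e: "e1 \<in> S" "e2 \<in> S" and h: "FM h"
  shows "aN p (d (\<lambda>q. h (\<phi> q)) p) (e1 (\<phi> p)) (e2 (\<phi> p))
    = \<alpha> (\<phi> p) (differential AM h (\<phi> p)) (e1 (\<phi> p)) (e2 (\<phi> p))"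
proof (rule fibre_eqI[of _ "\<phi> p"])
  have "\<forall>\<eta>\<in>cotangent_space AM (\<phi> p). \<forall>u\<in>fibre E (\<phi> p). \<forall>v\<in>fibre E (\<phi> p). \<alpha> (\<phi> p) \<eta> u v \<in> fibre E (\<phi> p)"
    using right unfolding right_anchor_control_def by blast
  then show "\<alpha> (\<phi> p) (differential AM h (\<phi> p)) (e1 (\<phi> p)) (e2 (\<phi> p)) \<in> fibre E (\<phi> p)"
    using e differential_cotangent[of AM h "\<phi> p"] by simp
  fix \<mu> assume \<mu>: "\<mu> \<in> S'"
  have "tangent_map AM \<phi> (aT e1 e2 \<mu> p) h = alpha_transpose AM \<alpha> e1 e2 \<mu> (\<phi> p) h"
    using aT_related[OF e \<mu>] by simp
  then show "\<mu> (\<phi> p) (aN p (d (\<lambda>q. h (\<phi> q)) p) (e1 (\<phi> p)) (e2 (\<phi> p)))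
      = \<mu> (\<phi> p) (\<alpha> (\<phi> p) (differential AM h (\<phi> p)) (e1 (\<phi> p)) (e2 (\<phi> p)))"
    using h by (simp add: aN_pairing[OF d_cotangent e \<mu>] differential_apply e \<mu> tangent_map_def
        alpha_transpose_def comp_def)
qed (use e in simp)

lemma pairing_S_pull [simp]: "\<mu> \<in> S' \<Longrightarrow> e \<in> S \<Longrightarrow> FN (\<lambda>q. \<mu> (\<phi> q) (e (\<phi> q)))"
  by (rule pairing_\<Gamma>[OF _ S_pull])

section \<open>The Leibniz formula on generators and its balancedness\<close>

abbreviation "gen \<equiv> bracket_on_generators AN br \<phi> \<rho>N aN"

lemma gen_eq:
  assumes "e1 \<in> S" "e2 \<in> S"
  shows "gen f1 e1 f2 e2 p = (f1 p * f2 p) *\<^sub>R br e1 e2 (\<phi> p) + (f1 p * \<rho>' e1 p f2) *\<^sub>R e2 (\<phi> p)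
    - (f2 p * \<rho>' e2 p f1) *\<^sub>R e1 (\<phi> p) + f2 p *\<^sub>R aN p (d f1 p) (e1 (\<phi> p)) (e2 (\<phi> p))"
  using assms by (simp add: bracket_on_generators_def)

lemma rho_tangent_add: "e \<in> S \<Longrightarrow> FN f \<Longrightarrow> FN g \<Longrightarrow> \<rho>' e p (\<lambda>q. f q + g q) = \<rho>' e p f + \<rho>' e p g"
  using tangent_add[OF rho_tangent] by simp

lemma rho_tangent_mult: "e \<in> S \<Longrightarrow> FN f \<Longrightarrow> FN g \<Longrightarrow>
    \<rho>' e p (\<lambda>q. f q * g q) = f p * \<rho>' e p g + g p * \<rho>' e p f"
  using tangent_mult[OF rho_tangent] by simp

lemma rho_smooth [simp]: "e \<in> S \<Longrightarrow> FN f \<Longrightarrow> FN (\<lambda>p. \<rho>' e p f)"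
  using vector_field_smooth[OF rho_vector_field] by simp

lemma gen_section [simp]:
  assumes "e1 \<in> S" "e2 \<in> S" "FN f1" "FN f2"
  shows "gen f1 e1 f2 e2 \<in> \<Gamma>"
proof -
  have "(\<lambda>p. (f1 p * f2 p) *\<^sub>R br e1 e2 (\<phi> p) + (f1 p * \<rho>' e1 p f2) *\<^sub>R e2 (\<phi> p)
    - (f2 p * \<rho>' e2 p f1) *\<^sub>R e1 (\<phi> p) + f2 p *\<^sub>R aN p (d f1 p) (e1 (\<phi> p)) (e2 (\<phi> p))) \<in> \<Gamma>"
    by (intro \<Gamma>_add \<Gamma>_diff \<Gamma>_scale S_pull d_section smooth_N(3) br_section rho_smooth assms)
  then show ?thesis using gen_eq[OF assms(1,2)] by presburger
qed

lemma gen_add_f1: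
  assumes "e1 \<in> S" "e2 \<in> S" "FN f" "FN g" "FN f2"
  shows "gen (\<lambda>q. f q + g q) e1 f2 e2 p = gen f e1 f2 e2 p + gen g e1 f2 e2 p"
  using assms by (simp add: gen_eq rho_tangent_add aN_d_add algebra_simps)

lemma gen_add_f2:
  assumes "e1 \<in> S" "e2 \<in> S" "FN f" "FN g" "FN f1"
  shows "gen f1 e1 (\<lambda>q. f q + g q) e2 p = gen f1 e1 f e2 p + gen f1 e1 g e2 p"
  using assms by (simp add: gen_eq rho_tangent_add algebra_simps)

lemma gen_add_e1:
  assumes "e \<in> S" "e1 \<in> S" "e2 \<in> S" "FN f1" "FN f2"
  shows "gen f1 (\<lambda>y. e1 y + e y) f2 e2 p = gen f1 e1 f2 e2 p + gen f1 e f2 e2 p"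
  using assms by (simp add: gen_eq rho_add br_add_left aN_add2 algebra_simps)

lemma gen_add_e2:
  assumes "e \<in> S" "e1 \<in> S" "e2 \<in> S" "FN f1" "FN f2"
  shows "gen f1 e1 f2 (\<lambda>y. e2 y + e y) p = gen f1 e1 f2 e2 p + gen f1 e1 f2 e p"
  using assms by (simp add: gen_eq rho_add br_add_right aN_add3 algebra_simps)

lemma gen_mult_f1:
  assumes "e1 \<in> S" "e2 \<in> S" "FN f" "FN f1" "FN f2"
  shows "gen (\<lambda>q. f q * f1 q) e1 f2 e2 p = f p *\<^sub>R gen f1 e1 f2 e2 p
    - (f1 p * f2 p * \<rho>' e2 p f) *\<^sub>R e1 (\<phi> p) + (f1 p * f2 p) *\<^sub>R aN p (d f p) (e1 (\<phi> p)) (e2 (\<phi> p))"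
  using assms by (simp add: gen_eq rho_tangent_mult aN_d_mult algebra_simps)

lemma gen_mult_f2:
  assumes "e1 \<in> S" "e2 \<in> S" "FN f" "FN f1" "FN f2"
  shows "gen f1 e1 (\<lambda>q. f q * f2 q) e2 p = f p *\<^sub>R gen f1 e1 f2 e2 p
    + (f1 p * f2 p * \<rho>' e1 p f) *\<^sub>R e2 (\<phi> p)"
  using assms by (simp add: gen_eq rho_tangent_mult algebra_simps)

text \<open>Differentiating \<open>h \<circ> \<phi>\<close> on \<open>N\<close> and applying the
  left Leibniz rule of \<open>br\<close> to \<open>h\<close> on \<open>M\<close> produce the same
  anchor term by \<open>\<rho>_pull\<close> and the same right-anchor term by
  \<open>\<alpha>_pull\<close>.\<close>

lemma gen_balanced1:
  assumes "e1 \<in> S" "e2 \<in> S" "FN f" "FM h" "FN f2"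
  shows "gen (\<lambda>q. f q * h (\<phi> q)) e1 f2 e2 p = gen f (\<lambda>y. h y *\<^sub>R e1 y) f2 e2 p"
  using assms by (simp add: gen_eq rho_tangent_mult aN_d_mult aN_scale2 \<rho>_pull \<alpha>_pull rho_scale
      br_scale_left algebra_simps)

lemma gen_balanced2:
  assumes "e1 \<in> S" "e2 \<in> S" "FN f" "FM h" "FN f1"
  shows "gen f1 e1 (\<lambda>q. f q * h (\<phi> q)) e2 p = gen f1 e1 f (\<lambda>y. h y *\<^sub>R e2 y) p"
  using assms by (simp add: gen_eq rho_tangent_mult aN_scale3 \<rho>_pull rho_scale
      br_scale_right algebra_simps)

lemma gen_sum1:
  assumes "e2 \<in> S" "FN f1" "FN f2" "\<And>i. i < (n::nat) \<Longrightarrow> FM (h i)" "\<And>i. i < n \<Longrightarrow> es i \<in> S"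
  shows "gen f1 (\<lambda>y. \<Sum>i<n. h i y *\<^sub>R es i y) f2 e2 p = (\<Sum>i<n. gen (\<lambda>q. f1 q * h i (\<phi> q)) (es i) f2 e2 p)"
  using assms(4,5)
proof (induction n)
  case 0
  have "gen f1 (\<lambda>y. 0 + 0) f2 e2 p = gen f1 (\<lambda>y. 0) f2 e2 p + gen f1 (\<lambda>y. 0) f2 e2 p"
    by (rule gen_add_e1) (simp_all add: assms)
  then show ?case by simp
next
  case (Suc n)
  have "gen f1 (\<lambda>y. (\<Sum>i<n. h i y *\<^sub>R es i y) + h n y *\<^sub>R es n y) f2 e2 p
      = gen f1 (\<lambda>y. \<Sum>i<n. h i y *\<^sub>R es i y) f2 e2 p + gen f1 (\<lambda>y. h n y *\<^sub>R es n y) f2 e2 p"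
    by (intro gen_add_e1 S_sum S_scale) (simp_all add: assms Suc.prems)
  then show ?case using Suc assms by (simp add: gen_balanced1)
qed

lemma gen_sum2:
  assumes "e1 \<in> S" "FN f1" "FN f2" "\<And>i. i < (n::nat) \<Longrightarrow> FM (h i)" "\<And>i. i < n \<Longrightarrow> es i \<in> S"
  shows "gen f1 e1 f2 (\<lambda>y. \<Sum>i<n. h i y *\<^sub>R es i y) p = (\<Sum>i<n. gen f1 e1 (\<lambda>q. f2 q * h i (\<phi> q)) (es i) p)"
  using assms(4,5)
proof (induction n)
  case 0
  have "gen f1 e1 f2 (\<lambda>y. 0 + 0) p = gen f1 e1 f2 (\<lambda>y. 0) p + gen f1 e1 f2 (\<lambda>y. 0) p"
    by (rule gen_add_e2) (simp_all add: assms)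
  then show ?case by simp
next
  case (Suc n)
  have "gen f1 e1 f2 (\<lambda>y. (\<Sum>i<n. h i y *\<^sub>R es i y) + h n y *\<^sub>R es n y) p
      = gen f1 e1 f2 (\<lambda>y. \<Sum>i<n. h i y *\<^sub>R es i y) p + gen f1 e1 f2 (\<lambda>y. h n y *\<^sub>R es n y) p"
    by (intro gen_add_e2 S_sum S_scale) (simp_all add: assms Suc.prems)
  then show ?case using Suc assms by (simp add: gen_balanced2)
qed

lemma d_\<psi>: "d (\<lambda>q. \<psi> (\<phi> p) (\<phi> q)) p = (\<lambda>v. 0)"
  by (auto simp: differential_def \<psi>_critical)

lemma rho_\<psi>: "e \<in> S \<Longrightarrow> \<rho>' e p (\<lambda>q. \<psi> (\<phi> p) (\<phi> q)) = 0"
  by (simp add: \<psi>_critical)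

text \<open>At \<open>p\<close> the formula sees only values and first derivatives of its
  coefficient functions, and the weight has value 1 and differential 0 there.\<close>

lemma gen_\<psi>1:
  assumes "e1 \<in> S" "e2 \<in> S" "FN f1" "FN f2"
  shows "gen (\<lambda>q. f1 q * \<psi> (\<phi> p) (\<phi> q)) e1 f2 e2 p = gen f1 e1 f2 e2 p"
  using assms by (simp add: gen_eq rho_tangent_mult d_mult d_\<psi> rho_\<psi>)

lemma gen_\<psi>2:
  assumes "e1 \<in> S" "e2 \<in> S" "FN f1" "FN f2"
  shows "gen f1 e1 (\<lambda>q. f2 q * \<psi> (\<phi> p) (\<phi> q)) e2 p = gen f1 e1 f2 e2 p"
  using assms by (simp add: gen_eq rho_tangent_mult rho_\<psi>)

section \<open>The bracket on all sections of the pullback bundle\<close>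

text \<open>
  The frame varies with \<open>p\<close>; the value does not depend on its choice, because \<open>gen\<close> is balanced over
  functions on the base.
\<close>

definition B :: "('n \<Rightarrow> 'e) \<Rightarrow> ('n \<Rightarrow> 'e) \<Rightarrow> 'n \<Rightarrow> 'e" where
  "B \<sigma> \<tau> p = (\<Sum>i<rk. \<Sum>j<rk. gen (\<lambda>q. fm (\<phi> p) i (\<phi> q) (\<sigma> q)) (fe (\<phi> p) i)
      (\<lambda>q. fm (\<phi> p) j (\<phi> q) (\<tau> q)) (fe (\<phi> p) j) p)"

text \<open>The frame coefficients of \<open>f1\<close> times a pullback are \<open>f1\<close> times
  functions from \<open>M\<close>. Balancedness moves the latter into the section arguments, where
  they reassemble to \<open>\<psi>\<close> times the section; moved out again, \<open>\<psi>\<close>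
  disappears by criticality.\<close>

lemma B_gen:
  assumes e: "e1 \<in> S" "e2 \<in> S" and f: "FN f1" "FN f2"
  shows "B (\<lambda>q. f1 q *\<^sub>R e1 (\<phi> q)) (\<lambda>q. f2 q *\<^sub>R e2 (\<phi> q)) p = gen f1 e1 f2 e2 p"
proof -
  let ?x = "\<phi> p"
  let ?a = "\<lambda>i y. fm ?x i y (e1 y)" and ?b = "\<lambda>j y. fm ?x j y (e2 y)"
  have "B (\<lambda>q. f1 q *\<^sub>R e1 (\<phi> q)) (\<lambda>q. f2 q *\<^sub>R e2 (\<phi> q)) p =
    (\<Sum>i<rk. \<Sum>j<rk. gen (\<lambda>q. f1 q * ?a i (\<phi> q)) (fe ?x i) (\<lambda>q. f2 q * ?b j (\<phi> q)) (fe ?x j) p)"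
    unfolding B_def using e by (intro sum.cong) (simp_all add: S'_scale)
  also have "\<dots> = (\<Sum>i<rk. gen (\<lambda>q. f1 q * ?a i (\<phi> q)) (fe ?x i) f2 (\<lambda>y. \<Sum>j<rk. ?b j y *\<^sub>R fe ?x j y) p)"
    using e f by (intro sum.cong gen_sum2[symmetric]) simp_all
  also have "\<dots> = gen f1 (\<lambda>y. \<Sum>i<rk. ?a i y *\<^sub>R fe ?x i y) f2 (\<lambda>y. \<Sum>j<rk. ?b j y *\<^sub>R fe ?x j y) p"
    using e f by (intro gen_sum1[symmetric] S_sum) simp_all
  also have "\<dots> = gen f1 (\<lambda>y. \<psi> ?x y *\<^sub>R e1 y) f2 (\<lambda>y. \<psi> ?x y *\<^sub>R e2 y) p"
    using e by (simp add: frame_expand)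
  also have "\<dots> = gen f1 e1 f2 e2 p"
    using e f by (simp add: gen_\<psi>1 gen_\<psi>2 flip: gen_balanced1 gen_balanced2)
  finally show ?thesis .
qed

lemma B_add_left:
  assumes "\<sigma> \<in> \<Gamma>" "\<sigma>' \<in> \<Gamma>" "\<tau> \<in> \<Gamma>"
  shows "B (\<lambda>q. \<sigma> q + \<sigma>' q) \<tau> p = B \<sigma> \<tau> p + B \<sigma>' \<tau> p"
  unfolding B_def sum.distrib[symmetric]
  using assms by (intro sum.cong) (simp_all add: S'_add gen_add_f1)

lemma B_add_right:
  assumes "\<sigma> \<in> \<Gamma>" "\<tau> \<in> \<Gamma>" "\<tau>' \<in> \<Gamma>"
  shows "B \<sigma> (\<lambda>q. \<tau> q + \<tau>' q) p = B \<sigma> \<tau> p + B \<sigma> \<tau>' p"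
  unfolding B_def sum.distrib[symmetric]
  using assms by (intro sum.cong) (simp_all add: S'_add gen_add_f2)

lemma fibre_linear_sum:
  assumes add: "\<And>u v. u \<in> fibre E x \<Longrightarrow> v \<in> fibre E x \<Longrightarrow> L (u + v) = L u + (L v :: 'v::real_vector)"
    and scale: "\<And>r u. u \<in> fibre E x \<Longrightarrow> L (r *\<^sub>R u) = r *\<^sub>R L u"
    and "\<And>i. i \<in> I \<Longrightarrow> us i \<in> fibre E x"
  shows "L (\<Sum>i\<in>I. c i *\<^sub>R us i) = (\<Sum>i\<in>I. c i *\<^sub>R L (us i))"
proof -
  have 0: "L 0 = 0" using scale[of 0 0] by simp
  show ?thesis using assms(3)
  proof (induction I rule: infinite_finite_induct)
    case (insert i I)
    have "(\<Sum>i\<in>I. c i *\<^sub>R us i) \<in> fibre E x"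
      by (intro fibre_sum fibre_closed) (use insert.prems in auto)
    then show ?case using insert by (simp add: add scale)
  qed (simp_all add: 0)
qed

lemma \<rho>N_expand:
  assumes "u \<in> fibre E (\<phi> p)"
  shows "\<rho>N p u f = (\<Sum>j<rk. fm (\<phi> p) j (\<phi> p) u * \<rho>' (fe (\<phi> p) j) p f)"
proof -
  have "\<rho>N p (\<Sum>j<rk. fm (\<phi> p) j (\<phi> p) u *\<^sub>R fe (\<phi> p) j (\<phi> p)) f
      = (\<Sum>j<rk. fm (\<phi> p) j (\<phi> p) u *\<^sub>R \<rho>N p (fe (\<phi> p) j (\<phi> p)) f)"
    by (rule fibre_linear_sum[of "\<phi> p" "\<lambda>u. \<rho>N p u f"]) (simp_all add: \<rho>N_add \<rho>N_scale)
  then show ?thesis using frame_expand_self[OF assms] by simp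
qed

lemma aN_expand:
  assumes \<eta>: "\<eta> \<in> T' p" and u: "u \<in> fibre E (\<phi> p)" and v: "v \<in> fibre E (\<phi> p)"
  shows "aN p \<eta> u v = (\<Sum>i<rk. \<Sum>j<rk. (fm (\<phi> p) i (\<phi> p) u * fm (\<phi> p) j (\<phi> p) v) *\<^sub>R
    aN p \<eta> (fe (\<phi> p) i (\<phi> p)) (fe (\<phi> p) j (\<phi> p)))"
proof -
  let ?x = "\<phi> p"
  have 1: "aN p \<eta> (\<Sum>i<rk. fm ?x i ?x u *\<^sub>R fe ?x i ?x) v
      = (\<Sum>i<rk. fm ?x i ?x u *\<^sub>R aN p \<eta> (fe ?x i ?x) v)"
    by (rule fibre_linear_sum[of ?x "\<lambda>u. aN p \<eta> u v"]) (simp_all add: \<eta> v aN_add2 aN_scale2)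
  have 2: "aN p \<eta> w (\<Sum>j<rk. fm ?x j ?x v *\<^sub>R fe ?x j ?x)
      = (\<Sum>j<rk. fm ?x j ?x v *\<^sub>R aN p \<eta> w (fe ?x j ?x))" if "w \<in> fibre E ?x" for w
    by (rule fibre_linear_sum[of ?x "\<lambda>v. aN p \<eta> w v"]) (simp_all add: \<eta> that aN_add3 aN_scale3)
  have "aN p \<eta> u v = (\<Sum>i<rk. fm ?x i ?x u *\<^sub>R aN p \<eta> (fe ?x i ?x) v)"
    using 1 frame_expand_self[OF u] by simp
  also have "\<dots> = (\<Sum>i<rk. fm ?x i ?x u *\<^sub>R (\<Sum>j<rk. fm ?x j ?x v *\<^sub>R aN p \<eta> (fe ?x i ?x) (fe ?x j ?x)))"
    using 2 frame_expand_self[OF v] by (intro sum.cong) simp_all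
  finally show ?thesis by (simp add: scaleR_sum_right)
qed

lemma B_scale_left:
  assumes f: "FN f" and \<sigma>: "\<sigma> \<in> \<Gamma>" and \<tau>: "\<tau> \<in> \<Gamma>"
  shows "B (\<lambda>q. f q *\<^sub>R \<sigma> q) \<tau> p
    = f p *\<^sub>R B \<sigma> \<tau> p - \<rho>N p (\<tau> p) f *\<^sub>R \<sigma> p + aN p (d f p) (\<sigma> p) (\<tau> p)"
proof -
  let ?x = "\<phi> p"
  let ?a = "\<lambda>i. fm ?x i ?x (\<sigma> p)" and ?b = "\<lambda>j. fm ?x j ?x (\<tau> p)"
  let ?G = "\<lambda>i j. gen (\<lambda>q. fm ?x i (\<phi> q) (\<sigma> q)) (fe ?x i) (\<lambda>q. fm ?x j (\<phi> q) (\<tau> q)) (fe ?x j) p"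
  have "B (\<lambda>q. f q *\<^sub>R \<sigma> q) \<tau> p = (\<Sum>i<rk. \<Sum>j<rk. f p *\<^sub>R ?G i j
      - (?a i * ?b j * \<rho>' (fe ?x j) p f) *\<^sub>R fe ?x i ?x
      + (?a i * ?b j) *\<^sub>R aN p (d f p) (fe ?x i ?x) (fe ?x j ?x))"
    unfolding B_def using assms by (intro sum.cong) (simp_all add: S'_scale gen_mult_f1)
  also have "\<dots> = f p *\<^sub>R (\<Sum>i<rk. \<Sum>j<rk. ?G i j)
      - (\<Sum>i<rk. \<Sum>j<rk. (?a i * ?b j * \<rho>' (fe ?x j) p f) *\<^sub>R fe ?x i ?x)
      + (\<Sum>i<rk. \<Sum>j<rk. (?a i * ?b j) *\<^sub>R aN p (d f p) (fe ?x i ?x) (fe ?x j ?x))"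
    by (simp add: sum.distrib sum_subtractf scaleR_sum_right)
  \<comment> \<open>The sum over \<open>j\<close> rebuilds the anchor of \<open>\<tau> p\<close>
    from its values on the frame.\<close>
  also have "(\<Sum>i<rk. \<Sum>j<rk. (?a i * ?b j * \<rho>' (fe ?x j) p f) *\<^sub>R fe ?x i ?x)
      = (\<Sum>i<rk. (\<rho>N p (\<tau> p) f * ?a i) *\<^sub>R fe ?x i ?x)"
    using \<tau> by (intro sum.cong)
      (simp_all add: \<rho>N_expand sum_distrib_left sum_distrib_right mult_ac flip: scaleR_sum_left)
  also have "\<dots> = \<rho>N p (\<tau> p) f *\<^sub>R (\<Sum>i<rk. ?a i *\<^sub>R fe ?x i ?x)"
    by (simp add: scaleR_sum_right)
  also have "(\<Sum>i<rk. ?a i *\<^sub>R fe ?x i ?x) = \<sigma> p" using frame_expand_self \<sigma> by simp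
  finally show ?thesis
    using aN_expand[OF d_cotangent, of "\<sigma> p" p "\<tau> p" f] \<sigma> \<tau> by (simp add: B_def)
qed

lemma B_scale_right:
  assumes f: "FN f" and \<sigma>: "\<sigma> \<in> \<Gamma>" and \<tau>: "\<tau> \<in> \<Gamma>"
  shows "B \<sigma> (\<lambda>q. f q *\<^sub>R \<tau> q) p = f p *\<^sub>R B \<sigma> \<tau> p + \<rho>N p (\<sigma> p) f *\<^sub>R \<tau> p"
proof -
  let ?x = "\<phi> p"
  let ?a = "\<lambda>i. fm ?x i ?x (\<sigma> p)" and ?b = "\<lambda>j. fm ?x j ?x (\<tau> p)"
  let ?G = "\<lambda>i j. gen (\<lambda>q. fm ?x i (\<phi> q) (\<sigma> q)) (fe ?x i) (\<lambda>q. fm ?x j (\<phi> q) (\<tau> q)) (fe ?x j) p"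
  have "B \<sigma> (\<lambda>q. f q *\<^sub>R \<tau> q) p = (\<Sum>i<rk. \<Sum>j<rk. f p *\<^sub>R ?G i j
      + (?a i * ?b j * \<rho>' (fe ?x i) p f) *\<^sub>R fe ?x j ?x)"
    unfolding B_def using assms by (intro sum.cong) (simp_all add: S'_scale gen_mult_f2)
  also have "\<dots> = f p *\<^sub>R (\<Sum>i<rk. \<Sum>j<rk. ?G i j)
      + (\<Sum>i<rk. \<Sum>j<rk. (?a i * ?b j * \<rho>' (fe ?x i) p f) *\<^sub>R fe ?x j ?x)"
    by (simp add: sum.distrib scaleR_sum_right)
  also have "(\<Sum>i<rk. \<Sum>j<rk. (?a i * ?b j * \<rho>' (fe ?x i) p f) *\<^sub>R fe ?x j ?x)
      = (\<Sum>i<rk. (?a i * \<rho>' (fe ?x i) p f) *\<^sub>R (\<Sum>j<rk. ?b j *\<^sub>R fe ?x j ?x))"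
    by (simp add: scaleR_sum_right mult_ac)
  also have "(\<Sum>j<rk. ?b j *\<^sub>R fe ?x j ?x) = \<tau> p" using frame_expand_self \<tau> by simp
  finally show ?thesis
    using \<sigma> by (simp add: B_def \<rho>N_expand flip: scaleR_sum_left)
qed

lemma B_sum_left:
  assumes "\<tau> \<in> \<Gamma>" "\<And>i. i < n \<Longrightarrow> \<sigma>s i \<in> \<Gamma>"
  shows "B (\<lambda>q. \<Sum>i<n. \<sigma>s i q) \<tau> p = (\<Sum>i<(n::nat). B (\<sigma>s i) \<tau> p)"
  using assms(2)
proof (induction n)
  case 0
  show ?case using B_add_left[OF \<Gamma>_zero \<Gamma>_zero assms(1)] by simp
next
  case (Suc n)
  \<comment> \<open>The factor 1 gives the sum the shape expected by
    \<open>\<Gamma>_sum\<close>.\<close>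
  have "(\<lambda>q. \<Sum>i<n. 1 *\<^sub>R \<sigma>s i q) \<in> \<Gamma>" by (intro \<Gamma>_sum) (use Suc.prems in auto)
  then have "(\<lambda>q. \<Sum>i<n. \<sigma>s i q) \<in> \<Gamma>" by simp
  then show ?case using Suc B_add_left[of _ "\<sigma>s n"] assms(1) by simp
qed

lemma B_sum_right:
  assumes "\<sigma> \<in> \<Gamma>" "\<And>i. i < n \<Longrightarrow> \<tau>s i \<in> \<Gamma>"
  shows "B \<sigma> (\<lambda>q. \<Sum>i<n. \<tau>s i q) p = (\<Sum>i<(n::nat). B \<sigma> (\<tau>s i) p)"
  using assms(2)
proof (induction n)
  case 0
  show ?case using B_add_right[OF assms(1) \<Gamma>_zero \<Gamma>_zero] by simp
next
  case (Suc n)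
  have "(\<lambda>q. \<Sum>i<n. 1 *\<^sub>R \<tau>s i q) \<in> \<Gamma>" by (intro \<Gamma>_sum) (use Suc.prems in auto)
  then have "(\<lambda>q. \<Sum>i<n. \<tau>s i q) \<in> \<Gamma>" by simp
  then show ?case using Suc B_add_right[of _ _ "\<tau>s n"] assms(1) by simp
qed

lemma B_fibre: "\<sigma> \<in> \<Gamma> \<Longrightarrow> \<tau> \<in> \<Gamma> \<Longrightarrow> B \<sigma> \<tau> p \<in> fibre E (\<phi> p)"
  unfolding B_def by (intro fibre_sum \<Gamma>_fibre gen_section pairing_\<Gamma> fm fe) auto

text \<open>The frame inside \<open>B\<close> jumps with the point, so smoothness is not visible
  from the definition. With the frame at a fixed \<open>x\<close>, the weighted
  \<open>\<tau>\<close> is a sum of generators and \<open>B_gen\<close> gives a formula valid at all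
  points at once. Only the second argument is treated here, so that both arguments in that formula
  are generators.\<close>

lemma B_section_generator:
  assumes e: "e \<in> S" and f: "FN f" and \<tau>: "\<tau> \<in> \<Gamma>"
  shows "B (\<lambda>q. f q *\<^sub>R e (\<phi> q)) \<tau> \<in> \<Gamma>"
proof (rule \<Gamma>I)
  let ?s = "\<lambda>q. f q *\<^sub>R e (\<phi> q)"
  have s: "?s \<in> \<Gamma>" using e f by simp
  show "B ?s \<tau> p \<in> fibre E (\<phi> p)" for p using B_fibre[OF s \<tau>] .
  fix \<mu> assume \<mu>: "\<mu> \<in> S'"
  show "FN (\<lambda>p. \<mu> (\<phi> p) (B ?s \<tau> p))"
  proof (rule FN_cancel)
    fix x
    let ?t = "\<lambda>j q. fm x j (\<phi> q) (\<tau> q) *\<^sub>R fe x j (\<phi> q)"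
    have eq: "(\<lambda>q. \<psi> x (\<phi> q) *\<^sub>R \<tau> q) = (\<lambda>q. \<Sum>j<rk. ?t j q)"
      using frame_expand \<tau> by simp
    have "B ?s (\<lambda>q. \<psi> x (\<phi> q) *\<^sub>R \<tau> q) p
        = (\<Sum>j<rk. 1 *\<^sub>R gen f e (\<lambda>q. fm x j (\<phi> q) (\<tau> q)) (fe x j) p)" for p
      unfolding eq using e f \<tau> by (subst B_sum_right) (auto intro!: sum.cong B_gen)
    then have "B ?s (\<lambda>q. \<psi> x (\<phi> q) *\<^sub>R \<tau> q)
        = (\<lambda>p. \<Sum>j<rk. 1 *\<^sub>R gen f e (\<lambda>q. fm x j (\<phi> q) (\<tau> q)) (fe x j) p)" by blast
    also have "\<dots> \<in> \<Gamma>"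
      by (intro \<Gamma>_sum gen_section smooth_N(1) pairing_\<Gamma> fm fe) (use e f \<tau> in auto)
    \<comment> \<open>As \<open>p\<close> moves away from the fibre over \<open>x\<close>, the
      derivative of the weight need not vanish. Subtracting the anchor term removes it and leaves
      the weighted pairing by \<open>B_scale_right\<close>.\<close>
    finally have "FN (\<lambda>p. \<mu> (\<phi> p) (B ?s (\<lambda>q. \<psi> x (\<phi> q) *\<^sub>R \<tau> q) p)
        - \<rho>N p (?s p) (\<lambda>q. \<psi> x (\<phi> q)) * \<mu> (\<phi> p) (\<tau> p))"
      using s \<mu> \<tau> by (intro smooth_N pairing_\<Gamma> \<rho>N_smooth[OF s] smooth_pull \<psi>_smooth)
    then show "FN (\<lambda>q. \<psi> x (\<phi> q) * \<mu> (\<phi> q) (B ?s \<tau> q))"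
      using B_fibre[OF s \<tau>] \<tau> by (simp add: B_scale_right[OF _ s \<tau>] S'_add[OF \<mu>] S'_scale[OF \<mu>])
  qed
qed

text \<open>The first argument is now decomposed with a fixed frame; its summands are generators,
  covered by the preceding lemma, and \<open>B_scale_left\<close> accounts for the derivatives of
  the weight.\<close>

lemma B_section [simp]:
  assumes \<sigma>: "\<sigma> \<in> \<Gamma>" and \<tau>: "\<tau> \<in> \<Gamma>"
  shows "B \<sigma> \<tau> \<in> \<Gamma>"
proof (rule \<Gamma>I)
  show "B \<sigma> \<tau> p \<in> fibre E (\<phi> p)" for p using B_fibre[OF \<sigma> \<tau>] .
  fix \<mu> assume \<mu>: "\<mu> \<in> S'"
  show "FN (\<lambda>p. \<mu> (\<phi> p) (B \<sigma> \<tau> p))"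
  proof (rule FN_cancel)
    fix x
    let ?f = "\<lambda>q. \<psi> x (\<phi> q)"
    let ?s = "\<lambda>j q. fm x j (\<phi> q) (\<sigma> q) *\<^sub>R fe x j (\<phi> q)"
    have eq: "(\<lambda>q. ?f q *\<^sub>R \<sigma> q) = (\<lambda>q. \<Sum>j<rk. ?s j q)"
      using frame_expand \<sigma> by simp
    have "B (\<lambda>q. ?f q *\<^sub>R \<sigma> q) \<tau> p = (\<Sum>j<rk. 1 *\<^sub>R B (?s j) \<tau> p)" for p
      unfolding eq using \<sigma> \<tau> by (subst B_sum_left) simp_all
    then have "B (\<lambda>q. ?f q *\<^sub>R \<sigma> q) \<tau> = (\<lambda>p. \<Sum>j<rk. 1 *\<^sub>R B (?s j) \<tau> p)" by blast
    also have "\<dots> \<in> \<Gamma>"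
      by (intro \<Gamma>_sum B_section_generator smooth_N(1) pairing_\<Gamma> fm fe) (use \<sigma> \<tau> in auto)
    finally have "FN (\<lambda>p. \<mu> (\<phi> p) (B (\<lambda>q. ?f q *\<^sub>R \<sigma> q) \<tau> p)
        + \<rho>N p (\<tau> p) ?f * \<mu> (\<phi> p) (\<sigma> p) - \<mu> (\<phi> p) (aN p (d ?f p) (\<sigma> p) (\<tau> p)))"
      using \<mu> \<sigma> \<tau> by (intro smooth_N pairing_\<Gamma> \<rho>N_smooth[OF \<tau>] d_section smooth_pull \<psi>_smooth)
    then show "FN (\<lambda>q. ?f q * \<mu> (\<phi> q) (B \<sigma> \<tau> q))"
      using B_fibre[OF \<sigma> \<tau>] \<sigma> \<tau>
      by (simp add: B_scale_left[OF _ \<sigma> \<tau>] S'_add[OF \<mu>] S'_diff[OF \<mu>] S'_scale[OF \<mu>])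
  qed
qed

lemma B_bilinear: "bilinear_bracket AN (pullback_bundle \<phi> E) B"
proof -
  have scale: "B (\<lambda>x. r *\<^sub>R \<sigma> x) \<tau> p = r *\<^sub>R B \<sigma> \<tau> p" "B \<sigma> (\<lambda>x. r *\<^sub>R \<tau> x) p = r *\<^sub>R B \<sigma> \<tau> p"
    if "\<sigma> \<in> \<Gamma>" "\<tau> \<in> \<Gamma>" for \<sigma> \<tau> r p
    using that B_scale_left[of "\<lambda>_. r" \<sigma> \<tau>] B_scale_right[of "\<lambda>_. r" \<sigma> \<tau>]
    by (simp_all add: tangent_const[OF AN \<rho>N_tangent] aN_d_const)
  show ?thesis
    unfolding bilinear_bracket_def fun_eq_iff by (simp add: B_add_left B_add_right scale)
qed

lemma B_pull:
  assumes "e1 \<in> S" "e2 \<in> S"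
  shows "B (\<lambda>p. e1 (\<phi> p)) (\<lambda>p. e2 (\<phi> p)) = (\<lambda>p. br e1 e2 (\<phi> p))"
proof
  fix p
  show "B (\<lambda>p. e1 (\<phi> p)) (\<lambda>p. e2 (\<phi> p)) p = br e1 e2 (\<phi> p)"
    using B_gen[OF assms smooth_N(1) smooth_N(1), of 1 1 p] assms
    by (simp add: gen_eq tangent_const[OF AN rho_tangent] aN_d_const)
qed

section \<open>Compatibility and the algebroid axioms\<close>

lemma extended: "extended_bracket AM E br AN \<phi> \<rho>N aN B"
  unfolding extended_bracket_def
  by (intro conjI B_bilinear ballI ext B_gen) simp_all

text \<open>The action conditions quantify over every bracket extending the formula on generators;
  \<open>B\<close> is such a bracket, so they become available for it.\<close>

lemma compatible: "bracket_compatible AM E br AN \<phi> \<rho>' aN B"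
  and \<rho>N_aN: "\<lbrakk>e1 \<in> S; e2 \<in> S; FN f\<rbrakk> \<Longrightarrow> \<rho>N p (aN p (d f p) (e1 (\<phi> p)) (e2 (\<phi> p))) = (\<lambda>_. 0)"
proof -
  note last = action_conds[THEN conjunct2, THEN conjunct2, THEN conjunct2, unfolded Let_def]
  show "bracket_compatible AM E br AN \<phi> \<rho>' aN B"
    using last[THEN conjunct1, THEN spec, THEN mp, OF extended] .
  show "\<rho>N p (aN p (d f p) (e1 (\<phi> p)) (e2 (\<phi> p))) = (\<lambda>_. 0)" if "e1 \<in> S" "e2 \<in> S" "FN f"
    using that by (intro last[THEN conjunct2, rule_format]) simp_all
qed

abbreviation "aN_sec f \<sigma> \<tau> \<equiv> (\<lambda>p. aN p (d f p) (\<sigma> p) (\<tau> p))"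
abbreviation "\<rho>N_sec \<sigma> f \<equiv> (\<lambda>p. \<rho>N p (\<sigma> p) f)"

lemma compatible_pointwise:
  assumes e: "e1 \<in> S" "e2 \<in> S" "e3 \<in> S" and f: "FN f" "FN g"
  shows "aN_sec f (\<lambda>p. e1 (\<phi> p)) (\<lambda>p. br e2 e3 (\<phi> p)) p
      - B (aN_sec f (\<lambda>p. e1 (\<phi> p)) (\<lambda>p. e2 (\<phi> p))) (\<lambda>p. e3 (\<phi> p)) p
      - B (\<lambda>p. e2 (\<phi> p)) (aN_sec f (\<lambda>p. e1 (\<phi> p)) (\<lambda>p. e3 (\<phi> p))) p
    = - (\<rho>' e3 p f *\<^sub>R (br e1 e2 (\<phi> p) + br e2 e1 (\<phi> p)))
      + aN_sec f (\<lambda>p. br e1 e2 (\<phi> p)) (\<lambda>p. e3 (\<phi> p)) p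
      - aN_sec (\<lambda>q. \<rho>' e2 q f) (\<lambda>p. e1 (\<phi> p)) (\<lambda>p. e3 (\<phi> p)) p" (is ?c1)
    and "B (\<lambda>p. e1 (\<phi> p)) (aN_sec g (\<lambda>p. e2 (\<phi> p)) (\<lambda>p. e3 (\<phi> p))) p
    = aN_sec g (\<lambda>p. br e1 e2 (\<phi> p)) (\<lambda>p. e3 (\<phi> p)) p
      + aN_sec (\<lambda>q. \<rho>' e1 q g) (\<lambda>p. e2 (\<phi> p)) (\<lambda>p. e3 (\<phi> p)) p
      + aN_sec g (\<lambda>p. e2 (\<phi> p)) (\<lambda>p. br e1 e3 (\<phi> p)) p" (is ?c2)
    and "aN_sec f (\<lambda>p. e1 (\<phi> p)) (aN_sec g (\<lambda>p. e2 (\<phi> p)) (\<lambda>p. e3 (\<phi> p))) p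
      - aN_sec g (\<lambda>p. e2 (\<phi> p)) (aN_sec f (\<lambda>p. e1 (\<phi> p)) (\<lambda>p. e3 (\<phi> p))) p
    = aN_sec g (aN_sec f (\<lambda>p. e1 (\<phi> p)) (\<lambda>p. e2 (\<phi> p))) (\<lambda>p. e3 (\<phi> p)) p
      + \<rho>' e1 p g *\<^sub>R aN_sec f (\<lambda>p. e2 (\<phi> p)) (\<lambda>p. e3 (\<phi> p)) p
      - \<rho>' e2 p f *\<^sub>R aN_sec g (\<lambda>p. e1 (\<phi> p)) (\<lambda>p. e3 (\<phi> p)) p
      - \<rho>' e3 p f *\<^sub>R aN_sec g (\<lambda>p. e2 (\<phi> p)) (\<lambda>p. e1 (\<phi> p)) p" (is ?c3)
proof -
  have f': "f \<in> smooth_funs AN" "g \<in> smooth_funs AN" using f by simp_all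
  have conds: "?c1 \<and> ?c2 \<and> ?c3"
    using compatible[unfolded bracket_compatible_def Let_def comp_def, THEN bspec, OF e(1),
        THEN bspec, OF e(2), THEN bspec, OF e(3), THEN bspec, OF f'(1), THEN bspec, OF f'(2),
        THEN spec, of p] .
  show ?c1 by (rule conds[THEN conjunct1])
  show ?c2 by (rule conds[THEN conjunct2, THEN conjunct1])
  show ?c3 by (rule conds[THEN conjunct2, THEN conjunct2])
qed

lemma loday_generators_N:
  "loday_generators {f. FN f} \<Gamma> {\<lambda>p. e (\<phi> p) | e. e \<in> S} B \<rho>N_sec aN_sec"
proof (unfold_locales, goal_cases)
  \<comment> \<open>Cases follow the order of the locale assumptions: 7 is generation near a point,
    with the critical weight as \<open>\<psi>\<close>; 25 to 27 are Jacobi and the two anchor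
    conditions; 28 to 30 are the compatibility conditions. The others are closure, linearity and
    Leibniz rules.\<close>
  case (7 \<sigma> p)
  let ?x = "\<phi> p"
  define w where "w = (\<lambda>q. \<psi> ?x (\<phi> q))"
  define c where "c i = (\<lambda>q. fm ?x i (\<phi> q) (\<sigma> q))" for i
  define u where "u i = (\<lambda>q. fe ?x i (\<phi> q))" for i
  have w: "w \<in> {f. FN f}" "w p = 1" by (simp_all add: w_def)
  have c: "\<forall>i<rk. c i \<in> {f. FN f}" using 7 by (simp add: c_def)
  have u: "\<forall>i<rk. u i \<in> {\<lambda>p. e (\<phi> p) | e. e \<in> S}" using fe u_def by blast
  have sum: "w \<bullet>\<^sub>s \<sigma> = (\<Sum>i<rk. c i \<bullet>\<^sub>s u i)"
  proof
    fix q
    have sum_apply: "(\<Sum>i<n. F i) q = (\<Sum>i<n. F i q)" for n :: nat and F :: "nat \<Rightarrow> 'n \<Rightarrow> 'e"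
      by (induction n) simp_all
    show "(w \<bullet>\<^sub>s \<sigma>) q = (\<Sum>i<rk. c i \<bullet>\<^sub>s u i) q"
      unfolding sum_apply using frame_expand[of "\<sigma> q" "\<phi> q" ?x] 7
      by (simp add: smul_apply w_def c_def u_def)
  qed
  show ?case
    using w c u sum by blast
next
  case (25 e1 e2 e3)
  then obtain u1 u2 u3 where e: "e1 = (\<lambda>p. u1 (\<phi> p))" "e2 = (\<lambda>p. u2 (\<phi> p))" "e3 = (\<lambda>p. u3 (\<phi> p))"
    and u: "u1 \<in> S" "u2 \<in> S" "u3 \<in> S" by auto
  show ?case using br_jacobi[OF u] u by (simp add: e B_pull plus_fun_def)
next
  case (26 e1 e2 f)
  then show ?case by (auto simp: B_pull rho_br lie_bracket_def fun_diff_def)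
next
  case (27 e1 e2 f g)
  then show ?case by (auto simp: \<rho>N_aN zero_fun_def)
next
  case (28 e1 e2 e3 f)
  then obtain u1 u2 u3 where e: "e1 = (\<lambda>p. u1 (\<phi> p))" "e2 = (\<lambda>p. u2 (\<phi> p))" "e3 = (\<lambda>p. u3 (\<phi> p))"
    and u: "u1 \<in> S" "u2 \<in> S" "u3 \<in> S" and f: "FN f" by auto
  show ?case
    unfolding e
  proof (rule ext, goal_cases)
    case (1 p)
    show ?case
      using compatible_pointwise(1)[OF u f f, of p] u by (simp add: B_pull smul_apply)
  qed
next
  case (29 e1 e2 e3 g)
  then obtain u1 u2 u3 where e: "e1 = (\<lambda>p. u1 (\<phi> p))" "e2 = (\<lambda>p. u2 (\<phi> p))" "e3 = (\<lambda>p. u3 (\<phi> p))"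
    and u: "u1 \<in> S" "u2 \<in> S" "u3 \<in> S" and g: "FN g" by auto
  show ?case
    unfolding e
  proof (rule ext, goal_cases)
    case (1 p)
    show ?case
      using compatible_pointwise(2)[OF u g g, of p] u by (simp add: B_pull)
  qed
next
  case (30 e1 e2 e3 f g)
  then obtain u1 u2 u3 where e: "e1 = (\<lambda>p. u1 (\<phi> p))" "e2 = (\<lambda>p. u2 (\<phi> p))" "e3 = (\<lambda>p. u3 (\<phi> p))"
    and u: "u1 \<in> S" "u2 \<in> S" "u3 \<in> S" and f: "FN f" "FN g" by auto
  show ?case
    unfolding e
  proof (rule ext, goal_cases)
    case (1 p)
    show ?case
      using compatible_pointwise(3)[OF u f, of p] u by (simp add: smul_apply)
  qed
qed (auto simp: plus_fun_def times_fun_def fun_diff_def smul_def B_add_left B_add_right B_scale_left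
    B_scale_right \<rho>N_add \<rho>N_scale tangent_add[OF \<rho>N_tangent] tangent_mult[OF \<rho>N_tangent]
    aN_d_add aN_d_mult aN_add2 aN_add3 aN_scale2 aN_scale3)

interpretation N: loday_generators "{f. FN f}" \<Gamma> "{\<lambda>p. e (\<phi> p) | e. e \<in> S}" B \<rho>N_sec aN_sec
  by (rule loday_generators_N)

lemma loday_algebroid_N: "loday_algebroid AN (pullback_bundle \<phi> E) B \<rho>N aN"
  unfolding loday_algebroid_def
proof (intro conjI ballI AN \<Gamma>_bundle B_bilinear left_anchor_N right_anchor_N, goal_cases)
  case (1 \<sigma> \<tau> \<omega>)
  then show ?case unfolding N.jacobi[OF 1] by (simp add: plus_fun_def)
qed (simp_all add: fun_eq_iff B_scale_right B_scale_left)

section \<open>The transposed tensor on the pullback bundle\<close>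

lemma tensor_map_N: "tensor_map AN (pullback_bundle \<phi> E) AN id (alpha_transpose AN aN)"
proof -
  note fib = pullback_simps(1)[OF AM E AN \<phi>]
  have vf: "alpha_transpose AN aN \<sigma> \<tau> \<nu> \<in> vector_fields AN"
    if "\<sigma> \<in> \<Gamma>" "\<tau> \<in> \<Gamma>" and \<nu>: "\<nu> \<in> dual_sections AN (pullback_bundle \<phi> E)" for \<sigma> \<tau> \<nu>
  proof -
    have "FN (\<lambda>p. \<nu> p (aN p (d f p) (\<sigma> p) (\<tau> p)))" if "FN f" for f
      using smooth_pairing[OF AN \<Gamma>_bundle \<nu> d_section[OF that \<open>\<sigma> \<in> \<Gamma>\<close> \<open>\<tau> \<in> \<Gamma>\<close>]] by simp
    then show ?thesis
      using that
      by (simp add: vector_fields_def tangent_space_def alpha_transpose_def aN_d_add aN_d_mult aN_d_const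
          dual_section_add[OF AN \<Gamma>_bundle \<nu>] dual_section_scaleR[OF AN \<Gamma>_bundle \<nu>] fib)
  qed
  show ?thesis
    unfolding tensor_map_def
    by (intro ballI conjI vf)
      (auto simp: alpha_transpose_def fun_eq_iff aN_add2 aN_add3 aN_scale2 aN_scale3 fib
        dual_section_add[OF AN \<Gamma>_bundle] dual_section_scaleR[OF AN \<Gamma>_bundle])
qed

lemma alpha_transpose_N:
  assumes e: "e1 \<in> S" "e2 \<in> S" and \<mu>: "\<mu> \<in> S'"
  shows "alpha_transpose AN aN (\<lambda>p. f1 p *\<^sub>R e1 (\<phi> p)) (\<lambda>p. f2 p *\<^sub>R e2 (\<phi> p)) (\<lambda>p v. g p * \<mu> (\<phi> p) v)
    = (\<lambda>p h. f1 p * f2 p * g p * aT e1 e2 \<mu> p h)"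
proof (intro ext)
  fix p h
  show "alpha_transpose AN aN (\<lambda>p. f1 p *\<^sub>R e1 (\<phi> p)) (\<lambda>p. f2 p *\<^sub>R e2 (\<phi> p)) (\<lambda>p v. g p * \<mu> (\<phi> p) v) p h
    = f1 p * f2 p * g p * aT e1 e2 \<mu> p h"
  proof (cases "FN h")
    case True
    then show ?thesis
      using e \<mu> by (simp add: alpha_transpose_def aN_scale2 aN_scale3 S'_scale aN_pairing differential_apply)
  next
    \<comment> \<open>On a function that is not smooth both sides are 0: the left by the default in
      \<open>alpha_transpose\<close>, the right by the normalisation of tangent vectors.\<close>
    case False
    then show ?thesis
      using tangent_not_smooth[OF aT_tangent[OF e \<mu>] False] by (simp add: alpha_transpose_def)
  qed
qed

end

theorem theorem2p11:
  fixes AM :: "('m::{t2_space,second_countable_topology}, 'b::real_inner) atlas"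
    and E :: "('m, 'e::real_vector) vbundle"
    and br :: "('m \<Rightarrow> 'e) \<Rightarrow> ('m \<Rightarrow> 'e) \<Rightarrow> 'm \<Rightarrow> 'e"
    and \<rho> :: "'m \<Rightarrow> 'e \<Rightarrow> 'm tvec"
    and \<alpha> :: "'m \<Rightarrow> 'm covec \<Rightarrow> 'e \<Rightarrow> 'e \<Rightarrow> 'e"
    and AN :: "('n::{t2_space,second_countable_topology}, 'c::real_inner) atlas"
    and \<phi> :: "'n \<Rightarrow> 'm"
    and \<rho>' :: "('m \<Rightarrow> 'e) \<Rightarrow> 'n \<Rightarrow> 'n tvec"
    and aT :: "('m \<Rightarrow> 'e) \<Rightarrow> ('m \<Rightarrow> 'e) \<Rightarrow> ('m \<Rightarrow> 'e \<Rightarrow> real) \<Rightarrow> 'n \<Rightarrow> 'n tvec"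
  assumes "loday_algebroid AM E br \<rho> \<alpha>"
    and "smooth_manifold AN"
    and "smooth_map AN AM \<phi>"
    and "loday_action AM E br \<rho> \<alpha> AN \<phi> \<rho>' aT"
  shows "\<exists>\<rho>N aTN aN B.
     loday_algebroid AN (pullback_bundle \<phi> E) B \<rho>N aN \<and>
     (\<forall>f\<in>smooth_funs AN. \<forall>e\<in>sections AM E. \<forall>p.
        \<rho>N p (f p *\<^sub>R e (\<phi> p)) = (\<lambda>h. f p * \<rho>' e p h)) \<and>
     tensor_map AN (pullback_bundle \<phi> E) AN id aTN \<and>
     (\<forall>f1\<in>smooth_funs AN. \<forall>f2\<in>smooth_funs AN. \<forall>g\<in>smooth_funs AN.
      \<forall>e1\<in>sections AM E. \<forall>e2\<in>sections AM E. \<forall>\<mu>\<in>dual_sections AM E.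
        aTN (\<lambda>p. f1 p *\<^sub>R e1 (\<phi> p)) (\<lambda>p. f2 p *\<^sub>R e2 (\<phi> p)) (\<lambda>p v. g p * \<mu> (\<phi> p) v)
          = (\<lambda>p h. f1 p * f2 p * g p * aT e1 e2 \<mu> p h)) \<and>
     (\<forall>f1\<in>smooth_funs AN. \<forall>f2\<in>smooth_funs AN. \<forall>g\<in>smooth_funs AN.
      \<forall>e1\<in>sections AM E. \<forall>e2\<in>sections AM E. \<forall>\<mu>\<in>dual_sections AM E. \<forall>p.
        g p * \<mu> (\<phi> p) (aN p (differential AN f1 p) (e1 (\<phi> p)) (f2 p *\<^sub>R e2 (\<phi> p)))
          = aTN (\<lambda>p. e1 (\<phi> p)) (\<lambda>p. f2 p *\<^sub>R e2 (\<phi> p)) (\<lambda>p v. g p * \<mu> (\<phi> p) v) p f1) \<and>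
     (\<forall>f1\<in>smooth_funs AN. \<forall>f2\<in>smooth_funs AN. \<forall>e1\<in>sections AM E. \<forall>e2\<in>sections AM E.
        B (\<lambda>p. f1 p *\<^sub>R e1 (\<phi> p)) (\<lambda>p. f2 p *\<^sub>R e2 (\<phi> p)) = (\<lambda>p.
          (f1 p * f2 p) *\<^sub>R br e1 e2 (\<phi> p)
          + (f1 p * \<rho>N p (e1 (\<phi> p)) f2) *\<^sub>R e2 (\<phi> p)
          - (f2 p * \<rho>N p (e2 (\<phi> p)) f1) *\<^sub>R e1 (\<phi> p)
          + f2 p *\<^sub>R aN p (differential AN f1 p) (e1 (\<phi> p)) (e2 (\<phi> p))))"
proof -
  interpret action AM E br \<rho> \<alpha> AN \<phi> \<rho>' aT
    using assms by unfold_locales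
  show ?thesis
  proof (intro exI conjI)
    show "loday_algebroid AN (pullback_bundle \<phi> E) B \<rho>N aN" by (rule loday_algebroid_N)
    \<comment> \<open>The fibrewise map \<open>aN\<close> comes first and its transpose serves as
      the witness for \<open>aTN\<close>; the relation between the two then holds by definition, and
      the formula on generators is \<open>alpha_transpose_N\<close>.\<close>
    show "tensor_map AN (pullback_bundle \<phi> E) AN id (alpha_transpose AN aN)" by (rule tensor_map_N)
    show "\<forall>f\<in>smooth_funs AN. \<forall>e\<in>sections AM E. \<forall>p. \<rho>N p (f p *\<^sub>R e (\<phi> p)) = (\<lambda>h. f p * \<rho>' e p h)"
      by (simp add: \<rho>N_scale)
    show "\<forall>f1\<in>smooth_funs AN. \<forall>f2\<in>smooth_funs AN. \<forall>g\<in>smooth_funs AN.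
      \<forall>e1\<in>sections AM E. \<forall>e2\<in>sections AM E. \<forall>\<mu>\<in>dual_sections AM E.
        alpha_transpose AN aN (\<lambda>p. f1 p *\<^sub>R e1 (\<phi> p)) (\<lambda>p. f2 p *\<^sub>R e2 (\<phi> p)) (\<lambda>p v. g p * \<mu> (\<phi> p) v)
          = (\<lambda>p h. f1 p * f2 p * g p * aT e1 e2 \<mu> p h)"
      by (intro ballI alpha_transpose_N)
    show "\<forall>f1\<in>smooth_funs AN. \<forall>f2\<in>smooth_funs AN. \<forall>g\<in>smooth_funs AN.
      \<forall>e1\<in>sections AM E. \<forall>e2\<in>sections AM E. \<forall>\<mu>\<in>dual_sections AM E. \<forall>p.
        g p * \<mu> (\<phi> p) (aN p (differential AN f1 p) (e1 (\<phi> p)) (f2 p *\<^sub>R e2 (\<phi> p)))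
          = alpha_transpose AN aN (\<lambda>p. e1 (\<phi> p)) (\<lambda>p. f2 p *\<^sub>R e2 (\<phi> p))
              (\<lambda>p v. g p * \<mu> (\<phi> p) v) p f1"
      by (simp add: alpha_transpose_def)
    show "\<forall>f1\<in>smooth_funs AN. \<forall>f2\<in>smooth_funs AN. \<forall>e1\<in>sections AM E. \<forall>e2\<in>sections AM E.
        B (\<lambda>p. f1 p *\<^sub>R e1 (\<phi> p)) (\<lambda>p. f2 p *\<^sub>R e2 (\<phi> p)) = (\<lambda>p.
          (f1 p * f2 p) *\<^sub>R br e1 e2 (\<phi> p)
          + (f1 p * \<rho>N p (e1 (\<phi> p)) f2) *\<^sub>R e2 (\<phi> p)
          - (f2 p * \<rho>N p (e2 (\<phi> p)) f1) *\<^sub>R e1 (\<phi> p)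
          + f2 p *\<^sub>R aN p (differential AN f1 p) (e1 (\<phi> p)) (e2 (\<phi> p)))"
      unfolding bracket_on_generators_def[symmetric] by (intro ballI ext B_gen) simp_all
  qed
qed

end
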